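(* Let $(\boldsymbol{\theta}_k)_{k\ge 0}$ be generated by the variational Bayesian adaptive Metropolis (VBAM) algorithm (defined in the context, in either of its two variants: with $\lambda_k$ adapted or with $\lambda_k\equiv\lambda_0$ fixed), targeting a probability density $\pi$ on $\mathbb{R}^d$. Suppose that $\pi$ is bounded and has bounded support, that the state space model used in VBAM is uniformly completely observable and uniformly completely controllable, and that $\sum_{k\ge 1} k^{-1}\gamma_k<\infty$. Then for every bounded (measurable) function $f:\mathbb{R}^d\to\mathbb{R}$, the strong law of large numbers holds: $$\frac1n\sum_{k=1}^n f(\boldsymbol{\theta}_k)\ \longrightarrow\ \int_{\mathbb{R}^d} f(\boldsymbol{\theta})\,\pi(\boldsymbol{\theta})\,\mathrm{d}\boldsymbol{\theta}\qquad\text{almost surely as } n\to\infty .$$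
   Context: For symmetric matrices, $A\le B$ (resp. $A<B$) means $B-A$ is positive semidefinite (resp. positive definite). State space model. Given deterministic matrices $\mathbf{A}_k\in\mathbb{R}^{n_x\times n_x}$ (invertible), $\mathbf{Q}_k\ge 0$ in $\mathbb{R}^{n_x\times n_x}$ ($k\ge0$), $\mathbf{H}_k\in\mathbb{R}^{d\times n_x}$ ($k\ge1$), the model is $\mathbf{x}_k\sim N(\mathbf{A}_{k-1}\mathbf{x}_{k-1},\mathbf{Q}_{k-1})$, $\mathbf{y}_k\sim N(\mathbf{H}_k\mathbf{x}_k,\boldsymbol{\Sigma}_k)$, with $\boldsymbol{\Sigma}_k$ an unknown $d\times d$ noise covariance. Observability and controllability. Let $\Phi(M,k)=\mathbf{A}_{M-1}\mathbf{A}_{M-2}\cdots\mathbf{A}_k$ for $k\le M$ (with $\Phi(M,M)=\mathbf{I}$) and $\Phi(k,M)=\Phi(M,k)^{-1}$. For a sequence $(\boldsymbol{\Sigma}_k)$ of positive definite matrices the information matrix is $F(M,M_0)=\sum_{k=\max(M_0,1)}^{M}\Phi(k,M)^T\mathbf{H}_k^T\boldsymbol{\Sigma}_k^{-1}\mathbf{H}_k\Phi(k,M)$, and the controllability matrix is $C(M,M_0)=\sum_{k=M_0}^{M-1}\Phi(M,k+1)\mathbf{Q}_k\Phi(M,k+1)^T$. The system is uniformly completely observable (resp. controllable) if there are a positive integer $L$ and constants $\beta_1,\beta_2>0$ such that $\beta_1\mathbf{I}\le F(M,M-L)\le\beta_2\mathbf{I}$ (resp. $\beta_1\mathbf{I}\le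 C(M,M-L)\le\beta_2\mathbf{I}$) for all $M\ge L$. In VBAM these properties are required for every sequence $(\boldsymbol{\Sigma}_k)$ with $\mu_1\mathbf{I}\le\boldsymbol{\Sigma}_k\le\mu_2\mathbf{I}$, where $\mu_1,\mu_2$ are the constants below. VBAM algorithm. Fix constants $0<\mu_1\le\mu_2<\infty$, $\delta_\lambda\in(0,1]$, a target acceptance rate $\overline\alpha\in(0,1)$ and a gain sequence $\gamma_k\ge0$ with $\sum_k\gamma_k=\infty$ and $\sum_k\gamma_k^{1+\delta}<\infty$ for some $\delta\in(0,1]$. Initialize $\boldsymbol{\theta}_0$ with $\pi(\boldsymbol{\theta}_0)>0$, $\boldsymbol{\Sigma}_0$ with $\mu_1\mathbf{I}\le\boldsymbol{\Sigma}_0\le\mu_2\mathbf{I}$, $\mathbf{m}_0\in\mathbb{R}^{n_x}$, a covariance matrix $\mathbf{P}_0\in\mathbb{R}^{n_x\times n_x}$, $\nu_0>d+1$, $\lambda_0\in[\delta_\lambda,\delta_\lambda^{-1}]$. For $k=1,2,\dots$: 1. (Metropolis step) Draw $\boldsymbol{\theta}_*\sim N(\boldsymbol{\theta}_{k-1},\lambda_{k-1}\boldsymbol{\Sigma}_{k-1})$, put $\alpha_k=\min\{1,\pi(\boldsymbol{\theta}_* )/\pi(\boldsymbol{\theta}_{k-1})\}$, draw $u\sim U(0,1)$ independently; set $\boldsymbol{\theta}_k=\boldsymbol{\theta}_*$ if $u<\alpha_k$ and $\boldsymbol{\theta}_k=\boldsymbol{\theta}_{k-1}$ otherwise. 2.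 (VB-AKF update with measurement $\mathbf{y}_k=\boldsymbol{\theta}_k$, and with covariance-dynamics parameters $\rho=1$, $\mathbf{B}=\mathbf{I}$) Set $\mathbf{m}_k^-=\mathbf{A}_{k-1}\mathbf{m}_{k-1}$, $\mathbf{P}_k^-=\mathbf{A}_{k-1}\mathbf{P}_{k-1}\mathbf{A}_{k-1}^T+\mathbf{Q}_{k-1}$, $\nu_k=\nu_{k-1}+1$, $\boldsymbol{\Sigma}_k^-=\boldsymbol{\Sigma}_{k-1}$, $\boldsymbol{\Sigma}_k^{(1)}=\boldsymbol{\Sigma}_k^-$, and iterate for $j=1,2,\dots$: $\mathbf{S}_k^{(j+1)}=\mathbf{H}_k\mathbf{P}_k^-\mathbf{H}_k^T+\boldsymbol{\Sigma}_k^{(j)}$, $\mathbf{K}_k^{(j+1)}=\mathbf{P}_k^-\mathbf{H}_k^T(\mathbf{S}_k^{(j+1)})^{-1}$, $\mathbf{m}_k^{(j+1)}=\mathbf{m}_k^-+\mathbf{K}_k^{(j+1)}(\mathbf{y}_k-\mathbf{H}_k\mathbf{m}_k^-)$, $\mathbf{P}_k^{(j+1)}=\mathbf{P}_k^--\mathbf{K}_k^{(j+1)}\mathbf{S}_k^{(j+1)}(\mathbf{K}_k^{(j+1)})^T$, $\boldsymbol{\Sigma}_k^{(j+1)}=\frac{\nu_{k-1}-d-1}{\nu_k-d-1}\boldsymbol{\Sigma}_k^-+\frac{1}{\nu_k-d-1}\big[\mathbf{H}_k\mathbf{P}_k^{(j+1)}\mathbf{H}_k^T+(\mathbf{y}_k-\mathbf{H}_k\mathbf{m}_k^{(j+1)})(\mathbf{y}_k-\mathbf{H}_k\mathbf{m}_k^{(j+1)})^T\big]$.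 The iteration is run to convergence: $\boldsymbol{\Sigma}_k,\mathbf{m}_k,\mathbf{P}_k$ are the limits as $j\to\infty$ (so they satisfy the corresponding fixed point equations). 3. (Truncation) If $\mu_1\mathbf{I}<\boldsymbol{\Sigma}_k<\mu_2\mathbf{I}$ fails, reset $\boldsymbol{\Sigma}_k=\boldsymbol{\Sigma}_{k-1}$ and let $\mathbf{m}_k,\mathbf{P}_k$ be the result of one pass of the formulas for $\mathbf{S},\mathbf{K},\mathbf{m},\mathbf{P}$ above using noise covariance $\boldsymbol{\Sigma}_{k-1}$. 4. (Optional scale adaptation) Either keep $\lambda_k=\lambda_{k-1}$ (variant with fixed $\lambda$), or set $\log\lambda_k=\log\lambda_{k-1}+\gamma_k(\alpha_k-\overline\alpha)$ and then project $\lambda_k$ onto $[\delta_\lambda,\delta_\lambda^{-1}]$ if it falls outside. *)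

theory Defs
  imports "HOL-Probability.Probability"
begin

section \<open>Loewner order\<close>

definition psd :: "real^'n^'n \<Rightarrow> bool" where
  "psd B \<longleftrightarrow> transpose B = B \<and> (\<forall>x. 0 \<le> x \<bullet> (B *v x))"

definition posdef :: "real^'n^'n \<Rightarrow> bool" where
  "posdef B \<longleftrightarrow> transpose B = B \<and> (\<forall>x. x \<noteq> 0 \<longrightarrow> 0 < x \<bullet> (B *v x))"

definition loewner_le :: "real^'n^'n \<Rightarrow> real^'n^'n \<Rightarrow> bool" where
  "loewner_le B C \<longleftrightarrow> psd (C - B)"

definition loewner_less :: "real^'n^'n \<Rightarrow> real^'n^'n \<Rightarrow> bool" where
  "loewner_less B C \<longleftrightarrow> posdef (C - B)"


section \<open>Observability and controllability\<close>

text \<open>Matrices with \<open>m\<close> rows and \<open>n\<close> columns have type \<open>real^'n^'m\<close>; thus \<open>H k :: real^'n^'d\<close>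
  maps states (index type \<open>'n\<close>) to measurements (index type \<open>'d\<close>).\<close>

text \<open>\<open>forward_prod A k j = A (k+j-1) ** \<dots> ** A k\<close>.\<close>

primrec forward_prod :: "(nat \<Rightarrow> real^'n^'n) \<Rightarrow> nat \<Rightarrow> nat \<Rightarrow> real^'n^'n" where
  "forward_prod A k 0 = mat 1"
| "forward_prod A k (Suc j) = A (k + j) ** forward_prod A k j"

definition transition :: "(nat \<Rightarrow> real^'n^'n) \<Rightarrow> nat \<Rightarrow> nat \<Rightarrow> real^'n^'n" where
  "transition A M k =
    (if k \<le> M then forward_prod A k (M - k) else matrix_inv (forward_prod A M (k - M)))"

definition information_matrix ::
  "(nat \<Rightarrow> real^'n^'n) \<Rightarrow> (nat \<Rightarrow> real^'n^'d) \<Rightarrow> (nat \<Rightarrow> real^'d^'d) \<Rightarrow> nat \<Rightarrow> nat \<Rightarrow> real^'n^'n" where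
  "information_matrix A H Sig M M0 =
    (\<Sum>k = max M0 1..M. transpose (transition A k M) ** transpose (H k) ** matrix_inv (Sig k)
       ** H k ** transition A k M)"

definition controllability_matrix ::
  "(nat \<Rightarrow> real^'n^'n) \<Rightarrow> (nat \<Rightarrow> real^'n^'n) \<Rightarrow> nat \<Rightarrow> nat \<Rightarrow> real^'n^'n" where
  "controllability_matrix A Q M M0 =
    (\<Sum>k = M0..<M. transition A M (k + 1) ** Q k ** transpose (transition A M (k + 1)))"

definition uniformly_completely_observable ::
  "(nat \<Rightarrow> real^'n^'n) \<Rightarrow> (nat \<Rightarrow> real^'n^'d) \<Rightarrow> (nat \<Rightarrow> real^'d^'d) \<Rightarrow> bool" where
  "uniformly_completely_observable A H Sig \<longleftrightarrow>
    (\<exists>L \<beta>1 \<beta>2. L \<ge> 1 \<and> \<beta>1 > 0 \<and> \<beta>2 > 0 \<and>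
      (\<forall>M\<ge>L. loewner_le (\<beta>1 *\<^sub>R mat 1) (information_matrix A H Sig M (M - L)) \<and>
             loewner_le (information_matrix A H Sig M (M - L)) (\<beta>2 *\<^sub>R mat 1)))"

definition uniformly_completely_controllable ::
  "(nat \<Rightarrow> real^'n^'n) \<Rightarrow> (nat \<Rightarrow> real^'n^'n) \<Rightarrow> bool" where
  "uniformly_completely_controllable A Q \<longleftrightarrow>
    (\<exists>L \<beta>1 \<beta>2. L \<ge> 1 \<and> \<beta>1 > 0 \<and> \<beta>2 > 0 \<and>
      (\<forall>M\<ge>L. loewner_le (\<beta>1 *\<^sub>R mat 1) (controllability_matrix A Q M (M - L)) \<and>
             loewner_le (controllability_matrix A Q M (M - L)) (\<beta>2 *\<^sub>R mat 1)))"


section \<open>Multivariate normal distribution\<close>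

text \<open>Intended for positive definite covariance \<open>S\<close> only.\<close>

definition mvn_density :: "real^'d \<Rightarrow> real^'d^'d \<Rightarrow> real^'d \<Rightarrow> real" where
  "mvn_density m S x =
    exp (- ((x - m) \<bullet> (matrix_inv S *v (x - m))) / 2) / sqrt ((2 * pi) ^ CARD('d) * det S)"

definition mvn :: "real^'d \<Rightarrow> real^'d^'d \<Rightarrow> (real^'d) measure" where
  "mvn m S = density lborel (\<lambda>x. ennreal (mvn_density m S x))"


section \<open>Variational Bayesian adaptive Kalman filter update\<close>

text \<open>\<open>mp\<close>, \<open>Pp\<close> are the predicted mean and covariance, \<open>S\<close> a noise covariance and \<open>y\<close> the measurement.\<close>

definition innov_cov :: "real^'n^'d \<Rightarrow> real^'n^'n \<Rightarrow> real^'d^'d \<Rightarrow> real^'d^'d" where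
  "innov_cov H Pp S = H ** Pp ** transpose H + S"

definition gain :: "real^'n^'d \<Rightarrow> real^'n^'n \<Rightarrow> real^'d^'d \<Rightarrow> real^'d^'n" where
  "gain H Pp S = Pp ** transpose H ** matrix_inv (innov_cov H Pp S)"

definition upd_mean ::
  "real^'n^'d \<Rightarrow> real^'n \<Rightarrow> real^'n^'n \<Rightarrow> real^'d \<Rightarrow> real^'d^'d \<Rightarrow> real^'n" where
  "upd_mean H mp Pp y S = mp + gain H Pp S *v (y - H *v mp)"

definition upd_cov :: "real^'n^'d \<Rightarrow> real^'n^'n \<Rightarrow> real^'d^'d \<Rightarrow> real^'n^'n" where
  "upd_cov H Pp S = Pp - gain H Pp S ** innov_cov H Pp S ** transpose (gain H Pp S)"

definition outer :: "real^'d \<Rightarrow> real^'d^'d" where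
  "outer v = (\<chi> i j. v $ i * v $ j)"

text \<open>\<open>nu\<close> and \<open>nu'\<close> are the previous and the current degrees of freedom,
  \<open>Sp\<close> is the predicted noise covariance and \<open>S\<close> the current iterate.\<close>

definition vb_noise_update ::
  "real^'n^'d \<Rightarrow> real^'n \<Rightarrow> real^'n^'n \<Rightarrow> real^'d \<Rightarrow> real \<Rightarrow> real \<Rightarrow> real^'d^'d \<Rightarrow> real^'d^'d \<Rightarrow> real^'d^'d" where
  "vb_noise_update H mp Pp y nu nu' Sp S =
    ((nu - real CARD('d) - 1) / (nu' - real CARD('d) - 1)) *\<^sub>R Sp
    + (1 / (nu' - real CARD('d) - 1)) *\<^sub>R
        (H ** upd_cov H Pp S ** transpose H + outer (y - H *v upd_mean H mp Pp y S))"

text \<open>\<open>vb_iterate \<dots> j\<close> is the iterate with number \<open>j + 1\<close>, since the iteration is started from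
  number \<open>1\<close>.\<close>

definition vb_iterate ::
  "real^'n^'d \<Rightarrow> real^'n \<Rightarrow> real^'n^'n \<Rightarrow> real^'d \<Rightarrow> real \<Rightarrow> real \<Rightarrow> real^'d^'d \<Rightarrow> nat \<Rightarrow> real^'d^'d" where
  "vb_iterate H mp Pp y nu nu' Sp j = (vb_noise_update H mp Pp y nu nu' Sp ^^ j) Sp"

definition vb_limits ::
  "real^'n^'d \<Rightarrow> real^'n \<Rightarrow> real^'n^'n \<Rightarrow> real^'d \<Rightarrow> real \<Rightarrow> real \<Rightarrow> real^'d^'d
    \<Rightarrow> real^'d^'d \<Rightarrow> real^'n \<Rightarrow> real^'n^'n \<Rightarrow> bool" where
  "vb_limits H mp Pp y nu nu' Sp S m P \<longleftrightarrow>
    (\<lambda>j. vb_iterate H mp Pp y nu nu' Sp j) \<longlonglongrightarrow> S \<and>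
    (\<lambda>j. upd_mean H mp Pp y (vb_iterate H mp Pp y nu nu' Sp j)) \<longlonglongrightarrow> m \<and>
    (\<lambda>j. upd_cov H Pp (vb_iterate H mp Pp y nu nu' Sp j)) \<longlonglongrightarrow> P"

text \<open>Converged update followed by truncation: \<open>(S, m, P)\<close> is the resulting noise covariance and
  filter state.\<close>

definition vbakf_step ::
  "real \<Rightarrow> real \<Rightarrow> real^'n^'d \<Rightarrow> real^'n \<Rightarrow> real^'n^'n \<Rightarrow> real^'d \<Rightarrow> real \<Rightarrow> real \<Rightarrow> real^'d^'d
    \<Rightarrow> real^'d^'d \<Rightarrow> real^'n \<Rightarrow> real^'n^'n \<Rightarrow> bool" where
  "vbakf_step \<mu>1 \<mu>2 H mp Pp y nu nu' Sp S m P \<longleftrightarrow>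
    (\<exists>S' m' P'. vb_limits H mp Pp y nu nu' Sp S' m' P' \<and>
      (if loewner_less (\<mu>1 *\<^sub>R mat 1) S' \<and> loewner_less S' (\<mu>2 *\<^sub>R mat 1)
       then S = S' \<and> m = m' \<and> P = P'
       else S = Sp \<and> m = upd_mean H mp Pp y Sp \<and> P = upd_cov H Pp Sp))"


section \<open>The algorithm\<close>

definition accept_prob :: "(real^'d \<Rightarrow> real) \<Rightarrow> real^'d \<Rightarrow> real^'d \<Rightarrow> real" where
  "accept_prob target x y = min 1 (target y / target x)"

definition scale_update :: "real \<Rightarrow> real \<Rightarrow> real \<Rightarrow> real \<Rightarrow> real \<Rightarrow> real" where
  "scale_update \<delta>lam target_acc g a l =
    max \<delta>lam (min (1 / \<delta>lam) (exp (ln l + g * (a - target_acc))))"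

definition is_density :: "(real^'d \<Rightarrow> real) \<Rightarrow> bool" where
  "is_density target \<longleftrightarrow> target \<in> borel_measurable borel \<and> (\<forall>x. 0 \<le> target x) \<and>
    (\<integral>\<^sup>+ x. ennreal (target x) \<partial>lborel) = 1"

text \<open>The filtration \<open>F\<close> may be the natural one or any larger one for which the draws have the
  stated conditional law. Assumption \<open>draws\<close> says that, given \<open>F k\<close>, the proposal
  \<open>theta_star (Suc k)\<close> and the variable \<open>U (Suc k)\<close> are independent with distributions
  \<open>N(\<theta>, \<lambda>\<Sigma>)\<close> and \<open>U(0,1)\<close>. The flag \<open>adapt_scale\<close> selects the variant of the algorithm.
  The values \<open>H 0\<close> and \<open>gam 0\<close> are never used.\<close>

locale vbam = prob_space M + filtration "space M" F
  for M :: "'w measure" and F :: "nat \<Rightarrow> 'w measure" +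
  fixes target :: "real^'d \<Rightarrow> real"
    and A Q :: "nat \<Rightarrow> real^'n^'n" and H :: "nat \<Rightarrow> real^'n^'d"
    and \<mu>1 \<mu>2 \<delta>lam target_acc :: real and gam :: "nat \<Rightarrow> real" and adapt_scale :: bool
    and theta0 :: "real^'d" and Sig0 :: "real^'d^'d"
    and m0 :: "real^'n" and P0 :: "real^'n^'n" and lam0 :: real
    and nu :: "nat \<Rightarrow> real"
    and theta_star :: "nat \<Rightarrow> 'w \<Rightarrow> real^'d" and U :: "nat \<Rightarrow> 'w \<Rightarrow> real"
    and theta :: "nat \<Rightarrow> 'w \<Rightarrow> real^'d" and Sig :: "nat \<Rightarrow> 'w \<Rightarrow> real^'d^'d"
    and m :: "nat \<Rightarrow> 'w \<Rightarrow> real^'n" and P :: "nat \<Rightarrow> 'w \<Rightarrow> real^'n^'n"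
    and lam :: "nat \<Rightarrow> 'w \<Rightarrow> real"
  assumes invertible_A: "\<And>k. invertible (A k)"
    and psd_Q: "\<And>k. psd (Q k)"
    and mu_bounds: "0 < \<mu>1" "\<mu>1 \<le> \<mu>2"
    and delta_lam: "0 < \<delta>lam" "\<delta>lam \<le> 1"
    and target_acc: "0 < target_acc" "target_acc < 1"
    and gam_nonneg: "\<And>k. k \<ge> 1 \<Longrightarrow> 0 \<le> gam k"
    and gam_diverges: "\<not> summable (\<lambda>k. gam (Suc k))"
    and gam_power_summable:
      "\<exists>\<delta>. 0 < \<delta> \<and> \<delta> \<le> 1 \<and> summable (\<lambda>k. gam (Suc k) powr (1 + \<delta>))"
    and theta0_pos: "0 < target theta0"
    and Sig0_bounds: "loewner_le (\<mu>1 *\<^sub>R mat 1) Sig0" "loewner_le Sig0 (\<mu>2 *\<^sub>R mat 1)"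
    and psd_P0: "psd P0"
    and lam0_bounds: "\<delta>lam \<le> lam0" "lam0 \<le> 1 / \<delta>lam"
    and nu_0: "nu 0 > real CARD('d) + 1"
    and nu_Suc: "\<And>k. nu (Suc k) = nu k + 1"
    and subalgebra_F: "\<And>k. subalgebra M (F k)"
    and adapted_draws: "\<And>k. theta_star (Suc k) \<in> borel_measurable (F (Suc k))"
      "\<And>k. U (Suc k) \<in> borel_measurable (F (Suc k))"
    and adapted: "\<And>k. theta k \<in> borel_measurable (F k)" "\<And>k. Sig k \<in> borel_measurable (F k)"
      "\<And>k. m k \<in> borel_measurable (F k)" "\<And>k. P k \<in> borel_measurable (F k)"
      "\<And>k. lam k \<in> borel_measurable (F k)"
    and init: "AE \<omega> in M. theta 0 \<omega> = theta0 \<and> Sig 0 \<omega> = Sig0 \<and> m 0 \<omega> = m0 \<and> P 0 \<omega> = P0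
      \<and> lam 0 \<omega> = lam0"
    and draws: "\<And>k B C. B \<in> sets borel \<Longrightarrow> C \<in> sets borel \<Longrightarrow>
      AE \<omega> in M.
        real_cond_exp M (F k) (\<lambda>\<omega>'. indicator B (theta_star (Suc k) \<omega>') * indicator C (U (Suc k) \<omega>')) \<omega>
        = measure (mvn (theta k \<omega>) (lam k \<omega> *\<^sub>R Sig k \<omega>)) B
          * measure (uniform_measure lborel {0<..<1}) C"
    and metropolis: "\<And>k. AE \<omega> in M. theta (Suc k) \<omega> =
      (if U (Suc k) \<omega> < accept_prob target (theta k \<omega>) (theta_star (Suc k) \<omega>)
       then theta_star (Suc k) \<omega> else theta k \<omega>)"
    and filter_update: "\<And>k. AE \<omega> in M.
      vbakf_step \<mu>1 \<mu>2 (H (Suc k)) (A k *v m k \<omega>) (A k ** P k \<omega> ** transpose (A k) + Q k)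
        (theta (Suc k) \<omega>) (nu k) (nu (Suc k)) (Sig k \<omega>)
        (Sig (Suc k) \<omega>) (m (Suc k) \<omega>) (P (Suc k) \<omega>)"
    and scale: "\<And>k. AE \<omega> in M. lam (Suc k) \<omega> =
      (if adapt_scale
       then scale_update \<delta>lam target_acc (gam (Suc k))
              (accept_prob target (theta k \<omega>) (theta_star (Suc k) \<omega>)) (lam k \<omega>)
       else lam k \<omega>)"

end

theory Submission
  imports Defs "HOL-Library.Discrete_Functions"
begin

text \<open>All proposal covariances lie in a compact set of positive definite matrices, so boundedness of the
  target and of its support gives one Doeblin minorisation of all Metropolis kernels by the target, and
  these kernels depend uniformly continuously on the covariance. A truncated Neumann series for the
  Poisson equation then splits the ergodic sum into bounded martingale differences, a telescoping sum
  and the variation of the kernels along the chain. Hence it suffices that the Cesaro means of the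
  covariance increments vanish. For the scale this follows from \<open>\<gamma>\<^sub>k \<rightarrow> 0\<close>. For the noise covariance, a
  converged update with \<open>c = \<nu>\<^sub>k - d - 1\<close> adds \<open>(G - \<Sigma>) / c\<close> with \<open>G\<close> positive semidefinite, so \<open>G\<close> is
  controlled by its trace; since the trace of \<open>\<Sigma>\<close> stays bounded, the sum of the first \<open>n\<close> increments is
  \<open>O(log n)\<close>.\<close>

section \<open>Positive semidefinite matrices\<close>

text \<open>A single increment of the noise covariance has no evident bound of order 1/k: the
  residual and the filter covariance inside \<open>G\<close> may be large. Positivity turns this
  around, since a large \<open>G\<close> shows up as an increase of the trace, which telescopes and
  is capped by the truncation. Only Cesaro means of increments are controlled in this way, so the
  ergodic argument is arranged to need no more: the truncated Neumann series varies with the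
  covariance by at most \<open>e + K * dist s s'\<close>, where \<open>e\<close> is arbitrary and
  the distance enters linearly. Truncation keeps this a finite composition of uniformly continuous
  maps, while the Doeblin constant makes the remainder small uniformly over all covariances. The
  martingale part rests on orthogonality of the differences, second moments along squares and
  interpolation. Two more points shape the setup: the law of the draws itself supplies the
  normalisation of the Gaussian density, and bounds that hold almost surely are made to hold
  everywhere by modifying the covariance on a null set.\<close>

lemma inner_matrix_vector: "x \<bullet> (B *v y) = (transpose B *v x) \<bullet> y" for B :: "real^'a^'b"
  by (simp add: dot_lmul_matrix)

lemma transpose_add: "transpose (B + C) = transpose B + transpose C"
  by (simp add: transpose_def vec_eq_iff)

lemma transpose_diff: "transpose (B - C) = transpose B - transpose C"
  for B C :: "'a::ab_group_add^'b^'c"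
  by (simp add: transpose_def vec_eq_iff)

lemma trace_scaleR: "trace (c *\<^sub>R B) = c * trace B" for B :: "real^'a^'a"
  by (simp add: trace_def sum_distrib_left)

lemma inner_scaleR_mat_1: "x \<bullet> ((c *\<^sub>R mat 1 :: real^'a^'a) *v x) = c * (norm x)\<^sup>2"
  by (simp add: scaleR_matrix_vector_assoc [symmetric] power2_norm_eq_inner)

lemma psd_add: "psd B \<Longrightarrow> psd C \<Longrightarrow> psd (B + C)"
  by (auto simp: psd_def transpose_add matrix_vector_mult_add_rdistrib inner_add_right)

lemma psd_scaleR: "psd B \<Longrightarrow> 0 \<le> c \<Longrightarrow> psd (c *\<^sub>R B)"
  by (auto simp: psd_def transpose_scalar scaleR_matrix_vector_assoc [symmetric])

lemma posdef_add_psd: "posdef B \<Longrightarrow> psd C \<Longrightarrow> posdef (B + C)"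
  by (auto simp: posdef_def psd_def transpose_add matrix_vector_mult_add_rdistrib inner_add_right
      add_pos_nonneg)

lemma posdef_scaleR: "posdef B \<Longrightarrow> 0 < c \<Longrightarrow> posdef (c *\<^sub>R B)"
  by (auto simp: posdef_def transpose_scalar scaleR_matrix_vector_assoc [symmetric])

lemma posdef_imp_psd: "posdef B \<Longrightarrow> psd B"
  by (metis inner_eq_zero_iff inner_zero_left less_eq_real_def order_refl posdef_def psd_def)

lemma psd_congruence:
  fixes C :: "real^'a^'b"
  assumes "psd B" shows "psd (C ** B ** transpose C)"
proof -
  have "x \<bullet> ((C ** B ** transpose C) *v x) = (transpose C *v x) \<bullet> (B *v (transpose C *v x))" for x
    by (simp add: inner_matrix_vector [of x C] matrix_vector_mul_assoc [symmetric])
  then show ?thesis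
    using assms by (auto simp: psd_def matrix_transpose_mul matrix_mul_assoc)
qed

lemma psd_outer: "psd (outer v)"
proof -
  have "outer v *v x = (v \<bullet> x) *\<^sub>R v" for x
    by (simp add: outer_def matrix_vector_mult_def vec_eq_iff inner_vec_def sum_distrib_left mult_ac)
  then have "x \<bullet> (outer v *v x) = (v \<bullet> x)\<^sup>2" for x
    by (simp add: power2_eq_square inner_commute)
  then show ?thesis
    by (auto simp: psd_def outer_def transpose_def vec_eq_iff)
qed

section \<open>Entries, trace and norm of positive semidefinite matrices\<close>

lemma inner_axis_matrix: "axis i 1 \<bullet> (B *v axis j 1) = B $ i $ j" for B :: "real^'a^'b"
  by (simp add: inner_axis' matrix_vector_mult_basis column_def)

lemma psd_diagonal_nonneg: "psd B \<Longrightarrow> 0 \<le> B $ i $ i"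
  using inner_axis_matrix [of i B i] by (metis psd_def)

text \<open>The form at the sum and at the difference of two unit vectors is nonnegative, which
  bounds twice the modulus of the entry by two diagonal entries; each of these is at most the trace
  because the diagonal is nonnegative.\<close>

lemma psd_entry_le_trace:
  assumes B: "psd B" shows "\<bar>B $ i $ j\<bar> \<le> trace B"
proof -
  have sym: "B $ j $ i = B $ i $ j"
    using B unfolding psd_def transpose_def by (metis vec_lambda_beta)
  have d: "B $ k $ k \<le> trace B" for k
    unfolding trace_def by (intro member_le_sum) (auto intro: psd_diagonal_nonneg B)
  have "0 \<le> (axis i 1 + axis j 1) \<bullet> (B *v (axis i 1 + axis j 1))"
    "0 \<le> (axis i 1 - axis j 1) \<bullet> (B *v (axis i 1 - axis j 1))"
    using B unfolding psd_def by blast+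
  then have "0 \<le> B $ i $ i + B $ j $ j + 2 * (B $ i $ j)" "0 \<le> B $ i $ i + B $ j $ j - 2 * (B $ i $ j)"
    by (simp_all add: matrix_vector_right_distrib matrix_vector_mult_diff_distrib inner_add_left
        inner_add_right inner_diff_left inner_diff_right inner_axis_matrix sym)
  then show ?thesis
    using d [of i] d [of j] by linarith
qed

lemma trace_psd_nonneg: "psd B \<Longrightarrow> 0 \<le> trace B"
  by (simp add: psd_diagonal_nonneg sum_nonneg trace_def)

text \<open>The norm is at most the sum of the moduli of all entries, each of which is at most the
  trace. The crude dimension factor only enters constants.\<close>

lemma psd_norm_le_trace:
  fixes B :: "real^'a^'a"
  assumes "psd B" shows "norm B \<le> (real CARD('a))\<^sup>2 * trace B"
proof -
  have "norm B \<le> (\<Sum>i\<in>UNIV. norm (B $ i))"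
    unfolding norm_vec_def [of B] by (rule L2_set_le_sum) auto
  also have "\<dots> \<le> (\<Sum>i\<in>UNIV. \<Sum>j\<in>UNIV. \<bar>B $ i $ j\<bar>)"
    by (intro sum_mono norm_le_l1_cart)
  also have "\<dots> \<le> (\<Sum>i\<in>(UNIV::'a set). \<Sum>j\<in>(UNIV::'a set). trace B)"
    by (intro sum_mono psd_entry_le_trace assms)
  finally show ?thesis
    by (simp add: power2_eq_square)
qed

lemma trace_le_of_loewner_le:
  fixes B :: "real^'a^'a"
  assumes "loewner_le B (c *\<^sub>R mat 1)" shows "trace B \<le> real CARD('a) * c"
  using trace_psd_nonneg [OF assms [unfolded loewner_le_def]]
  by (simp add: trace_sub trace_scaleR trace_I mult.commute)

section \<open>Limits of positive semidefinite matrices\<close>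

lemma tendsto_matrix_vector_mult [tendsto_intros]:
  fixes f :: "'b \<Rightarrow> real^'a^'c"
  assumes "(f \<longlongrightarrow> B) N"
  shows "((\<lambda>k. f k *v x) \<longlongrightarrow> B *v x) N"
  unfolding matrix_vector_mult_def
  by (intro tendsto_vec_lambda tendsto_sum tendsto_mult tendsto_vec_nth assms tendsto_const)

text \<open>The cone is closed. This transfers positivity to the limits of the fixed point
  iteration, about which only convergence is known.\<close>

lemma psd_limit:
  assumes lim: "X \<longlonglongrightarrow> B" and psd: "\<And>j. psd (X j)"
  shows "psd B"
proof -
  have "0 \<le> x \<bullet> (B *v x)" for x
  proof (rule LIMSEQ_le_const)
    show "(\<lambda>j. x \<bullet> (X j *v x)) \<longlonglongrightarrow> x \<bullet> (B *v x)"
      by (intro tendsto_intros lim)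
  qed (use psd in \<open>auto simp: psd_def\<close>)
  moreover have "B $ j $ i = B $ i $ j" for i j
  proof (rule LIMSEQ_unique)
    have *: "X k $ j $ i = X k $ i $ j" for k
      using psd [of k] unfolding psd_def transpose_def by (metis vec_lambda_beta)
    show "(\<lambda>k. X k $ i $ j) \<longlonglongrightarrow> B $ j $ i"
      unfolding * [symmetric] by (intro tendsto_vec_nth lim)
    show "(\<lambda>k. X k $ i $ j) \<longlonglongrightarrow> B $ i $ j"
      by (intro tendsto_vec_nth lim)
  qed
  ultimately show ?thesis
    by (auto simp: psd_def transpose_def vec_eq_iff)
qed

section \<open>Nonsingularity from a positive quadratic form, without symmetry\<close>

lemma invertible_of_quadratic_form:
  fixes B :: "real^'a^'a"
  assumes "\<And>x. x \<noteq> 0 \<Longrightarrow> 0 < x \<bullet> (B *v x)"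
  shows "invertible B"
proof -
  have "x = 0" if "B *v x = 0" for x
    using assms [of x] that by force
  then show ?thesis
    by (meson invertible_left_inverse matrix_left_invertible_ker)
qed

lemma posdef_invertible: "posdef B \<Longrightarrow> invertible B"
  by (rule invertible_of_quadratic_form) (simp add: posdef_def)

lemma matrix_inv_right:
  fixes B :: "real^'a^'a" assumes "invertible B" shows "B ** matrix_inv B = mat 1"
  using someI_ex [of "\<lambda>A'. B ** A' = mat 1 \<and> A' ** B = mat 1"] assms
  unfolding invertible_def matrix_inv_def by auto

text \<open>A matrix with positive quadratic form is connected to the identity by a segment of
  nonsingular matrices, so its determinant keeps the sign of \<open>det (mat 1)\<close>.\<close>

lemma det_pos_of_quadratic_form:
  fixes B :: "real^'a^'a"
  assumes pos: "\<And>x. x \<noteq> 0 \<Longrightarrow> 0 < x \<bullet> (B *v x)"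
  shows "0 < det B"
proof (rule ccontr)
  assume neg: "\<not> 0 < det B"
  define p where "p t = det ((1 - t) *\<^sub>R mat 1 + t *\<^sub>R B)" for t :: real
  have "continuous_on {0..1} p"
    unfolding p_def det_def by (intro continuous_intros)
  then obtain t where t: "0 \<le> t" "t \<le> 1" "p t = 0"
    using IVT2' [of p 1 0 0] neg by (auto simp: p_def)
  have "invertible ((1 - t) *\<^sub>R mat 1 + t *\<^sub>R B)"
  proof (rule invertible_of_quadratic_form)
    fix x :: "real^'a" assume "x \<noteq> 0"
    then have "0 < (1 - t) * (norm x)\<^sup>2 + t * (x \<bullet> (B *v x))"
      using pos [of x] t by (cases "t = 0") (auto intro!: add_nonneg_pos mult_nonneg_nonneg)
    then show "0 < x \<bullet> (((1 - t) *\<^sub>R mat 1 + t *\<^sub>R B) *v x)"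
      by (simp add: matrix_vector_mult_add_rdistrib scaleR_matrix_vector_assoc [symmetric]
          inner_add_right power2_norm_eq_inner)
  qed
  then show False
    using t by (simp add: p_def invertible_det_nz)
qed


section \<open>The filter update\<close>

lemma posdef_innov_cov: "psd Pp \<Longrightarrow> posdef S \<Longrightarrow> posdef (innov_cov H Pp S)"
  unfolding innov_cov_def by (subst add.commute) (intro posdef_add_psd psd_congruence)

text \<open>With \<open>w = K\<^sup>T x\<close> and \<open>z = x - H\<^sup>T w\<close> the quadratic form of the updated covariance at \<open>x\<close>
  is that of the prediction at \<open>z\<close> plus that of the noise at \<open>w\<close> (Joseph form).\<close>

lemma psd_upd_cov:
  fixes H :: "real^'a^'b"
  assumes Pp: "psd Pp" and S: "posdef S"
  shows "psd (upd_cov H Pp S)"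
proof -
  define V where "V = innov_cov H Pp S"
  define K where "K = gain H Pp S"
  have V: "posdef V"
    unfolding V_def by (rule posdef_innov_cov [OF Pp S])
  then have tV: "transpose V = V" and iV: "V ** matrix_inv V = mat 1"
    by (simp_all add: posdef_def matrix_inv_right posdef_invertible)
  have tP: "transpose Pp = Pp"
    using Pp by (simp add: psd_def)
  \<comment> \<open>This identity removes the inverse hidden in the gain; the computation of the
    quadratic form uses nothing else about \<open>K\<close>.\<close>
  have KV: "V ** transpose K = H ** Pp"
  proof -
    have "transpose K = transpose (matrix_inv V) ** (H ** Pp)"
      by (simp add: K_def gain_def V_def matrix_transpose_mul tP)
    moreover have "V ** transpose (matrix_inv V) = mat 1"
    proof -
      have "transpose (matrix_inv V) ** V = mat 1"
        by (metis iV matrix_transpose_mul tV transpose_mat matrix_left_right_inverse)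
      then show ?thesis
        using matrix_left_right_inverse by blast
    qed
    ultimately show ?thesis
      by (simp add: matrix_mul_assoc)
  qed
  have "0 \<le> x \<bullet> (upd_cov H Pp S *v x)" for x
  proof -
    define w where "w = transpose K *v x"
    define z where "z = x - transpose H *v w"
    have Vw: "V *v w = H *v (Pp *v x)"
      by (simp add: w_def matrix_vector_mul_assoc KV del: transpose_matrix_vector)
    have cov: "x \<bullet> (upd_cov H Pp S *v x) = x \<bullet> (Pp *v x) - w \<bullet> (V *v w)"
      unfolding upd_cov_def K_def [symmetric] V_def [symmetric] w_def
      by (simp add: matrix_vector_mult_diff_rdistrib inner_diff_right inner_matrix_vector [of x K]
          matrix_vector_mul_assoc [symmetric] del: transpose_matrix_vector)
    \<comment> \<open>Both cross terms of the form of \<open>Pp\<close> at \<open>z\<close> equal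
      the form of \<open>V\<close> at \<open>w\<close>; the pure term falls short of it by the noise
      part, because \<open>V - S\<close> is the congruence of \<open>Pp\<close> by
      \<open>H\<close>.\<close>
    have "(transpose H *v w) \<bullet> (Pp *v x) = w \<bullet> (V *v w)"
      by (simp add: Vw inner_matrix_vector [of w H] del: transpose_matrix_vector)
    moreover have "x \<bullet> (Pp *v (transpose H *v w)) = w \<bullet> (V *v w)"
      using inner_matrix_vector [of x Pp "transpose H *v w"] calculation
      by (simp add: tP inner_commute del: transpose_matrix_vector)
    moreover have "(transpose H *v w) \<bullet> (Pp *v (transpose H *v w)) = w \<bullet> (V *v w) - w \<bullet> (S *v w)"
      unfolding V_def innov_cov_def
      by (simp add: matrix_vector_mult_add_rdistrib inner_add_right inner_matrix_vector [of w H]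
          matrix_vector_mul_assoc [symmetric] del: transpose_matrix_vector)
    ultimately have "z \<bullet> (Pp *v z) = x \<bullet> (Pp *v x) - w \<bullet> (V *v w) - w \<bullet> (S *v w)"
      unfolding z_def
      by (simp add: matrix_vector_mult_diff_distrib inner_diff_left inner_diff_right
          del: transpose_matrix_vector)
    moreover have "0 \<le> z \<bullet> (Pp *v z)" "0 \<le> w \<bullet> (S *v w)"
      using Pp posdef_imp_psd [OF S] by (auto simp: psd_def)
    ultimately show ?thesis
      unfolding cov by linarith
  qed
  moreover have "transpose (upd_cov H Pp S) = upd_cov H Pp S"
    unfolding upd_cov_def K_def [symmetric] V_def [symmetric]
    by (simp add: transpose_diff matrix_transpose_mul tP tV matrix_mul_assoc)
  ultimately show ?thesis
    by (simp add: psd_def)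
qed

lemma loewner_pos_imp_posdef:
  assumes "0 < c" "loewner_le (c *\<^sub>R mat 1) S" shows "posdef S"
proof -
  have "posdef (c *\<^sub>R mat 1 :: real^'a^'a)"
    using assms by (auto simp: posdef_def transpose_scalar inner_scaleR_mat_1)
  from posdef_add_psd [OF this assms(2) [unfolded loewner_le_def]] show ?thesis
    by simp
qed

lemma loewner_less_imp_le: "loewner_less B C \<Longrightarrow> loewner_le B C"
  by (simp add: loewner_le_def loewner_less_def posdef_imp_psd)

text \<open>With \<open>c = nu' - d - 1\<close>, the matrix \<open>c \<cdot> (S - Sp) + Sp\<close> of a converged update is a limit of positive
  semidefinite matrices, hence its norm is controlled by its trace.\<close>

lemma vbakf_step_bounds:
  fixes H :: "real^'n^'d"
  assumes step: "vbakf_step \<mu>1 \<mu>2 H mp Pp y nu nu' Sp S m P"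
    and mu: "0 < \<mu>1" and Sp: "loewner_le (\<mu>1 *\<^sub>R mat 1) Sp" "loewner_le Sp (\<mu>2 *\<^sub>R mat 1)"
    and Pp: "psd Pp" and nu: "nu > real CARD('d) + 1" "nu' = nu + 1"
  shows "psd P" "loewner_le (\<mu>1 *\<^sub>R mat 1) S" "loewner_le S (\<mu>2 *\<^sub>R mat 1)"
    "norm (S - Sp) \<le> (real CARD('d))\<^sup>2 * (trace S - trace Sp)
       + 2 * (real CARD('d))^3 * \<mu>2 / (nu' - real CARD('d) - 1)"
proof -
  define c where "c = nu' - real CARD('d) - 1"
  have c: "c > 1"
    using nu by (simp add: c_def)
  have pSp: "posdef Sp"
    using loewner_pos_imp_posdef mu Sp(1) by blast
  have trSp: "0 \<le> trace Sp" "trace Sp \<le> real CARD('d) * \<mu>2"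
    using trace_psd_nonneg [OF posdef_imp_psd [OF pSp]] trace_le_of_loewner_le [OF Sp(2)] by auto
  obtain S' m' P' where lim: "vb_limits H mp Pp y nu nu' Sp S' m' P'"
    and cases: "if loewner_less (\<mu>1 *\<^sub>R mat 1) S' \<and> loewner_less S' (\<mu>2 *\<^sub>R mat 1)
       then S = S' \<and> m = m' \<and> P = P'
       else S = Sp \<and> m = upd_mean H mp Pp y Sp \<and> P = upd_cov H Pp Sp"
    using step unfolding vbakf_step_def by blast
  define X where "X j = vb_iterate H mp Pp y nu nu' Sp j" for j
  define G where "G T = H ** upd_cov H Pp T ** transpose H + outer (y - H *v upd_mean H mp Pp y T)" for T
  have G: "psd (G T)" if "posdef T" for T
    unfolding G_def by (intro psd_add psd_congruence psd_outer psd_upd_cov Pp that)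
  \<comment> \<open>Since \<open>nu' = nu + 1\<close>, the weight of the previous covariance is
    \<open>(c - 1) / c\<close>. It is positive, so every iterate inherits definiteness from
    \<open>Sp\<close>.\<close>
  have X_Suc: "X (Suc j) = ((c - 1) / c) *\<^sub>R Sp + (1 / c) *\<^sub>R G (X j)" for j
    by (simp add: X_def vb_iterate_def vb_noise_update_def G_def c_def nu)
  have X: "posdef (X j)" for j
  proof (induction j)
    case 0
    then show ?case by (simp add: X_def vb_iterate_def pSp)
  next
    case (Suc j)
    then show ?case
      unfolding X_Suc using c by (intro posdef_add_psd posdef_scaleR psd_scaleR G pSp) auto
  qed
  show "psd P"
  proof (cases "loewner_less (\<mu>1 *\<^sub>R mat 1) S' \<and> loewner_less S' (\<mu>2 *\<^sub>R mat 1)")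
    case True
    have "(\<lambda>j. upd_cov H Pp (X j)) \<longlonglongrightarrow> P"
      using lim cases True by (simp add: vb_limits_def X_def)
    then show ?thesis
      by (rule psd_limit) (intro psd_upd_cov Pp X)
  next
    case False
    then show ?thesis
      using cases psd_upd_cov [OF Pp pSp] by auto
  qed
  show "loewner_le (\<mu>1 *\<^sub>R mat 1) S" "loewner_le S (\<mu>2 *\<^sub>R mat 1)"
    using cases Sp by (auto split: if_splits dest: loewner_less_imp_le)
  \<comment> \<open>If the update is rejected, the increment and the trace difference vanish and
    only this remainder is left on the right.\<close>
  have rest: "0 \<le> 2 * (real CARD('d))^3 * \<mu>2 / c"
  proof -
    have "0 \<le> real CARD('d) * \<mu>2"
      using trSp by linarith
    then have "0 \<le> \<mu>2"
      by (simp add: zero_le_mult_iff)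
    then show ?thesis
      using c by simp
  qed
  show "norm (S - Sp) \<le> (real CARD('d))\<^sup>2 * (trace S - trace Sp)
       + 2 * (real CARD('d))^3 * \<mu>2 / (nu' - real CARD('d) - 1)"
  proof (cases "loewner_less (\<mu>1 *\<^sub>R mat 1) S' \<and> loewner_less S' (\<mu>2 *\<^sub>R mat 1)")
    case False
    then show ?thesis
      using cases rest by (auto simp: c_def)
  next
    case True
    then have "X \<longlonglongrightarrow> S"
      using lim cases by (simp add: vb_limits_def X_def [abs_def])
    then have "(\<lambda>j. X (Suc j)) \<longlonglongrightarrow> S"
      by (rule LIMSEQ_Suc)
    then have "(\<lambda>j. c *\<^sub>R (X (Suc j) - ((c - 1) / c) *\<^sub>R Sp)) \<longlonglongrightarrow> c *\<^sub>R (S - ((c - 1) / c) *\<^sub>R Sp)"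
      by (intro tendsto_intros)
    \<comment> \<open>By \<open>X_Suc\<close> the approximants are exactly the matrices
      \<open>G (X j)\<close>.\<close>
    then have psd: "psd (c *\<^sub>R (S - ((c - 1) / c) *\<^sub>R Sp))"
      by (rule psd_limit) (use c G X in \<open>simp add: X_Suc\<close>)
    define D where "D = c *\<^sub>R (S - ((c - 1) / c) *\<^sub>R Sp)"
    have "c * ((c - 1) / c) = c - 1"
      using c by simp
    then have D: "D = c *\<^sub>R (S - Sp) + Sp"
      by (simp add: D_def scaleR_diff_right) (simp add: algebra_simps)
    have trD: "trace D = c * (trace S - trace Sp) + trace Sp"
      unfolding D by (simp add: trace_add trace_scaleR trace_sub)
    have "c * norm (S - Sp) = norm (D - Sp)"
      using c by (simp add: D)
    also have "\<dots> \<le> norm D + norm Sp"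
      by (rule norm_triangle_ineq4)
    also have "\<dots> \<le> (real CARD('d))\<^sup>2 * trace D + (real CARD('d))\<^sup>2 * trace Sp"
      using psd_norm_le_trace [OF psd] psd_norm_le_trace [OF posdef_imp_psd [OF pSp]]
      by (simp add: D_def)
    \<comment> \<open>One \<open>trace Sp\<close> comes from \<open>trace D\<close>, the other from
      the norm of \<open>Sp\<close>; both are bounded through \<open>\<mu>2\<close>, which produces
      the cubic dimension constant.\<close>
    also have "\<dots> = c * ((real CARD('d))\<^sup>2 * (trace S - trace Sp)) + 2 * (real CARD('d))\<^sup>2 * trace Sp"
      by (simp add: trD algebra_simps)
    also have "\<dots> \<le> c * ((real CARD('d))\<^sup>2 * (trace S - trace Sp))
        + 2 * (real CARD('d))\<^sup>2 * (real CARD('d) * \<mu>2)"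
      using trSp by (intro add_left_mono mult_left_mono) auto
    also have "\<dots> = c * ((real CARD('d))\<^sup>2 * (trace S - trace Sp) + 2 * (real CARD('d))^3 * \<mu>2 / c)"
      using c by (simp add: field_simps power2_eq_square power3_eq_cube)
    finally show ?thesis
      using c by (simp add: c_def)
  qed
qed


section \<open>Metropolis kernels with bounded target of bounded support\<close>

lemma nn_integral_lborel_shift:
  fixes x :: "'a::euclidean_space"
  assumes [measurable]: "f \<in> borel_measurable borel"
  shows "(\<integral>\<^sup>+ y. f (y - x) \<partial>lborel) = (\<integral>\<^sup>+ z. f z \<partial>lborel)"
proof -
  have "(\<integral>\<^sup>+ y. f (y - x) \<partial>lborel) = (\<integral>\<^sup>+ y. f (y - x) \<partial>distr lborel borel ((+) x))"
    by (simp add: lborel_distr_plus)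
  also have "\<dots> = (\<integral>\<^sup>+ z. f z \<partial>lborel)"
    by (subst nn_integral_distr) auto
  finally show ?thesis .
qed

text \<open>The proposal increments have densities \<open>q s\<close>, with parameter \<open>s\<close> ranging over \<open>\<S>\<close>.\<close>

locale metropolis_family =
  fixes target :: "real^'d \<Rightarrow> real" and q :: "'s::metric_space \<Rightarrow> real^'d \<Rightarrow> real"
    and \<S> :: "'s set" and B R q0 :: real
  assumes density: "is_density target"
    and target_le: "\<And>x. target x \<le> B"
    and support: "\<And>x. target x \<noteq> 0 \<Longrightarrow> norm x \<le> R"
    and q_measurable: "(\<lambda>(s, z). q s z) \<in> borel_measurable (borel \<Otimes>\<^sub>M borel)"
    and q_nonneg: "\<And>s z. s \<in> \<S> \<Longrightarrow> 0 \<le> q s z"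
    and q_even: "\<And>s z. q s (- z) = q s z"
    and q_density: "\<And>s. s \<in> \<S> \<Longrightarrow> (\<integral>\<^sup>+ z. ennreal (q s z) \<partial>lborel) = 1"
    and q0_pos: "0 < q0"
    and q_lower: "\<And>s z. s \<in> \<S> \<Longrightarrow> norm z \<le> 2 * R \<Longrightarrow> q0 \<le> q s z"
    and q_uniform: "\<And>e. 0 < e \<Longrightarrow> \<exists>\<delta>>0. \<forall>s\<in>\<S>. \<forall>s'\<in>\<S>. dist s s' < \<delta> \<longrightarrow>
      (\<forall>z. norm z \<le> 2 * R \<longrightarrow> \<bar>q s z - q s' z\<bar> \<le> e)"
begin

lemma target_measurable [measurable]: "target \<in> borel_measurable borel"
  and target_nonneg: "0 \<le> target x"
  and nn_integral_target: "(\<integral>\<^sup>+ x. ennreal (target x) \<partial>lborel) = 1"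
  using density by (auto simp: is_density_def)

lemma integrable_target [simp]: "integrable lborel target"
  by (rule integrableI_nonneg) (auto simp: target_nonneg nn_integral_target)

lemma integral_target [simp]: "(\<integral>x. target x \<partial>lborel) = 1"
  by (subst integral_eq_nn_integral) (auto simp: target_nonneg nn_integral_target)

lemma q_measurable' [measurable (raw)]:
  assumes "f \<in> N \<rightarrow>\<^sub>M borel" "g \<in> N \<rightarrow>\<^sub>M borel"
  shows "(\<lambda>x. q (f x) (g x)) \<in> borel_measurable N"
  using measurable_compose [OF measurable_Pair [OF assms] q_measurable] by simp

lemma support_nonempty: obtains x where "target x \<noteq> 0"
proof (rule ccontr)
  assume "\<not> thesis"
  with that have "target x = 0" for x
    by blast
  then show False
    using nn_integral_target by simp
qed

lemma B_pos: "0 < B"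
proof -
  obtain x where "target x \<noteq> 0"
    by (rule support_nonempty)
  then show ?thesis
    using target_nonneg [of x] target_le [of x] by linarith
qed

lemma accept_prob_nonneg: "0 \<le> accept_prob target x y"
  and accept_prob_le_1: "accept_prob target x y \<le> 1"
  by (auto simp: accept_prob_def target_nonneg)

lemma accept_prob_measurable [measurable (raw)]:
  assumes [measurable]: "f \<in> N \<rightarrow>\<^sub>M borel" "g \<in> N \<rightarrow>\<^sub>M borel"
  shows "(\<lambda>x. accept_prob target (f x) (g x)) \<in> borel_measurable N"
  unfolding accept_prob_def by measurable

text \<open>The core of detailed balance: the right side is symmetric in x and y. At
  \<open>target x = 0\<close> both sides vanish; otherwise the factor clears the
  denominator.\<close>

lemma accept_prob_times_target: "accept_prob target x y * target x = min (target x) (target y)"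
  using target_nonneg [of x] target_nonneg [of y]
  by (cases "target x = 0") (auto simp: accept_prob_def min_def field_simps)

text \<open>The density of accepted moves. The mass missing to 1 is the probability of staying, so
  the kernel is this part plus an atom at x.\<close>

definition rate :: "'s \<Rightarrow> real^'d \<Rightarrow> real^'d \<Rightarrow> real" where
  "rate s x y = accept_prob target x y * q s (y - x)"

lemma rate_measurable [measurable (raw)]:
  assumes [measurable]: "f \<in> N \<rightarrow>\<^sub>M borel" "g \<in> N \<rightarrow>\<^sub>M borel" "h \<in> N \<rightarrow>\<^sub>M borel"
  shows "(\<lambda>x. rate (f x) (g x) (h x)) \<in> borel_measurable N"
  unfolding rate_def by measurable

lemma rate_nonneg: "s \<in> \<S> \<Longrightarrow> 0 \<le> rate s x y"
  by (simp add: rate_def accept_prob_nonneg q_nonneg)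

lemma rate_eq_0: "target y = 0 \<Longrightarrow> rate s x y = 0"
  by (simp add: rate_def accept_prob_def)

lemma nn_integral_q_shift:
  assumes "s \<in> \<S>" shows "(\<integral>\<^sup>+ y. ennreal (q s (y - x)) \<partial>lborel) = 1"
  using q_density [OF assms] by (subst nn_integral_lborel_shift) auto

lemma nn_integral_rate:
  assumes "s \<in> \<S>" shows "(\<integral>\<^sup>+ y. ennreal (rate s x y) \<partial>lborel) \<le> 1"
proof -
  have "rate s x y \<le> q s (y - x)" for y
    unfolding rate_def using q_nonneg [OF assms] accept_prob_le_1 accept_prob_nonneg
    by (intro mult_left_le_one_le) auto
  then have "(\<integral>\<^sup>+ y. ennreal (rate s x y) \<partial>lborel) \<le> (\<integral>\<^sup>+ y. ennreal (q s (y - x)) \<partial>lborel)"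
    by (intro nn_integral_mono ennreal_leI)
  then show ?thesis
    by (simp add: nn_integral_q_shift [OF assms])
qed

lemma integrable_rate:
  assumes "s \<in> \<S>" shows "integrable lborel (rate s x)"
  by (rule integrableI_nonneg)
    (use nn_integral_rate [OF assms, of x] in \<open>auto simp: rate_nonneg assms intro: order.strict_trans1\<close>)

lemma integral_rate_le_1:
  assumes "s \<in> \<S>" shows "(\<integral>y. rate s x y \<partial>lborel) \<le> 1"
proof -
  have "ennreal (\<integral>y. rate s x y \<partial>lborel) \<le> ennreal 1"
    using nn_integral_rate [OF assms, of x]
    by (subst nn_integral_eq_integral [symmetric]) (auto simp: rate_nonneg integrable_rate assms)
  then show ?thesis
    by (subst (asm) ennreal_le_iff) auto
qed

lemma integrable_rate_times:
  assumes s: "s \<in> \<S>" and [measurable]: "h \<in> borel_measurable borel" and h: "\<And>y. \<bar>h y\<bar> \<le> c"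
  shows "integrable lborel (\<lambda>y. rate s x y * h y)"
proof (rule Bochner_Integration.integrable_bound)
  show "integrable lborel (\<lambda>y. c * rate s x y)"
    by (intro integrable_mult_right integrable_rate s)
  show "AE y in lborel. norm (rate s x y * h y) \<le> norm (c * rate s x y)"
  proof (rule AE_I2)
    fix y
    have "0 \<le> c"
      using h [of y] by linarith
    with h [of y] rate_nonneg [OF s, of x y]
    show "norm (rate s x y * h y) \<le> norm (c * rate s x y)"
      by (simp add: abs_mult mult.commute mult_left_mono mult_right_mono)
  qed
qed simp

text \<open>The weight of the Doeblin minorisation of all kernels by the target.\<close>

definition eps :: real where "eps = q0 / B"

lemma eps_pos: "0 < eps"
  by (simp add: eps_def q0_pos B_pos)

text \<open>As the target is at most \<open>B\<close>, a move to y is accepted with probability at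
  least \<open>target y / B\<close>. Two points of the support are at most \<open>2 * R\<close>
  apart, where the proposal density is at least \<open>q0\<close>.\<close>

lemma rate_lower:
  assumes s: "s \<in> \<S>" and x: "target x \<noteq> 0"
  shows "eps * target y \<le> rate s x y"
proof (cases "target y = 0")
  case True
  then show ?thesis by (simp add: rate_nonneg s)
next
  case False
  have pos: "0 < target x" "0 < target y"
    using x False target_nonneg [of x] target_nonneg [of y] by auto
  have "target y / B \<le> 1"
    using target_le [of y] B_pos by simp
  moreover have "target y / B \<le> target y / target x"
    using pos target_le [of x] B_pos by (intro divide_left_mono) auto
  ultimately have a: "target y / B \<le> accept_prob target x y"
    by (simp add: accept_prob_def)
  have "norm (y - x) \<le> 2 * R"
    using norm_triangle_ineq4 [of y x] support [OF x] support [OF False] by linarith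
  then have "q0 \<le> q s (y - x)"
    by (rule q_lower [OF s])
  with a have "(target y / B) * q0 \<le> rate s x y"
    unfolding rate_def using pos q0_pos by (intro mult_mono accept_prob_nonneg) auto
  then show ?thesis
    by (simp add: eps_def mult.commute)
qed

text \<open>Integrating the minorisation over y compares \<open>eps\<close> with the accepted
  mass.\<close>

lemma eps_le_1:
  assumes s: "s \<in> \<S>" shows "eps \<le> 1"
proof -
  obtain x where x: "target x \<noteq> 0"
    by (rule support_nonempty)
  have "eps = (\<integral>y. eps * target y \<partial>lborel)"
    by simp
  also have "\<dots> \<le> (\<integral>y. rate s x y \<partial>lborel)"
    by (intro integral_mono integrable_rate s rate_lower x) simp
  also have "\<dots> \<le> 1"
    by (rule integral_rate_le_1 [OF s])
  finally show ?thesis .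
qed

text \<open>The value \<open>0\<close> off the support makes the bounds below hold everywhere; the support is never left.\<close>

definition step :: "'s \<Rightarrow> (real^'d \<Rightarrow> real) \<Rightarrow> real^'d \<Rightarrow> real" where
  "step s h x = (if target x = 0 then 0 else h x + (\<integral>y. rate s x y * (h y - h x) \<partial>lborel))"

text \<open>Parameter, function and point may all vary together, as they do when a kernel is
  evaluated along the adaptive chain.\<close>

lemma step_measurable [measurable (raw)]:
  assumes [measurable]: "f \<in> N \<rightarrow>\<^sub>M borel" "g \<in> N \<rightarrow>\<^sub>M borel"
    and h: "(\<lambda>(x, y). h x y) \<in> borel_measurable (N \<Otimes>\<^sub>M borel)"
  shows "(\<lambda>x. step (f x) (h x) (g x)) \<in> borel_measurable N"
proof -
  have [measurable]: "(\<lambda>x. h x (g x)) \<in> borel_measurable N"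
    using measurable_compose [OF _ h, of "\<lambda>x. (x, g x)" N] by simp
  have [measurable]: "(\<lambda>(x, y). h x y) \<in> borel_measurable (N \<Otimes>\<^sub>M lborel)"
    using h by simp
  show ?thesis
    unfolding step_def by measurable
qed

text \<open>Separates the accepted part from the atom at x, whose masses the contraction argument
  estimates one by one.\<close>

lemma step_eq:
  assumes s: "s \<in> \<S>" and [measurable]: "h \<in> borel_measurable borel" and h: "\<And>y. \<bar>h y\<bar> \<le> c"
    and x: "target x \<noteq> 0"
  shows "step s h x = (\<integral>y. rate s x y * h y \<partial>lborel) + h x * (1 - (\<integral>y. rate s x y \<partial>lborel))"
proof -
  have "(\<integral>y. rate s x y * (h y - h x) \<partial>lborel)
      = (\<integral>y. rate s x y * h y - h x * rate s x y \<partial>lborel)"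
    by (simp add: algebra_simps)
  also have "\<dots> = (\<integral>y. rate s x y * h y \<partial>lborel) - h x * (\<integral>y. rate s x y \<partial>lborel)"
    by (subst Bochner_Integration.integral_diff)
      (auto intro!: integrable_rate_times [OF s _ h] integrable_mult_right integrable_rate s)
  finally show ?thesis
    using x by (simp add: step_def algebra_simps)
qed

lemma step_diff:
  assumes s: "s \<in> \<S>" and [measurable]: "h \<in> borel_measurable borel" "h' \<in> borel_measurable borel"
    and h: "\<And>y. \<bar>h y\<bar> \<le> c" and h': "\<And>y. \<bar>h' y\<bar> \<le> c'"
  shows "step s h x - step s h' x = step s (\<lambda>y. h y - h' y) x"
proof (cases "target x = 0")
  case False
  have b: "\<bar>h y - h' y\<bar> \<le> c + c'" for y
    using h [of y] h' [of y] by linarith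
  have "(\<integral>y. rate s x y * (h y - h' y) \<partial>lborel)
      = (\<integral>y. rate s x y * h y \<partial>lborel) - (\<integral>y. rate s x y * h' y \<partial>lborel)"
    unfolding right_diff_distrib
    by (intro Bochner_Integration.integral_diff integrable_rate_times [OF s _ h]
        integrable_rate_times [OF s _ h']) measurable
  then show ?thesis
    by (subst step_eq [OF s _ h False], simp, subst step_eq [OF s _ h' False], simp,
        subst step_eq [OF s _ b False], simp, simp add: algebra_simps)
qed (simp add: step_def)

section \<open>Contraction, invariance and parameter dependence of a single kernel\<close>

lemma integrable_times_target:
  assumes [measurable]: "h \<in> borel_measurable borel" and h: "\<And>y. \<bar>h y\<bar> \<le> c"
  shows "integrable lborel (\<lambda>y. h y * target y)"
proof (rule Bochner_Integration.integrable_bound [of _ "\<lambda>y. c * target y"])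
  have "\<bar>h y * target y\<bar> \<le> \<bar>c * target y\<bar>" for y
    using h [of y] target_nonneg [of y] by (simp add: abs_mult mult_right_mono)
  then show "AE y in lborel. norm (h y * target y) \<le> norm (c * target y)"
    by simp
qed auto

text \<open>Subtracting \<open>e * target\<close> from the accepted density leaves a nonnegative
  weight whose mass is smaller by \<open>e\<close>, while the subtracted part integrates
  \<open>h\<close> to zero. The mean condition carries the factor \<open>e\<close>, so that
  \<open>e = 0\<close> yields plain boundedness without centring and \<open>e = eps\<close> yields
  the contraction.\<close>

lemma step_contract_aux:
  assumes s: "s \<in> \<S>" and [measurable]: "h \<in> borel_measurable borel" and h: "\<And>y. \<bar>h y\<bar> \<le> c"
    and e: "0 \<le> e" "e \<le> eps" and mean: "e * (\<integral>y. h y * target y \<partial>lborel) = 0"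
  shows "\<bar>step s h x\<bar> \<le> (1 - e) * c"
proof (cases "target x = 0")
  case True
  have "0 \<le> c"
    using h [of x] by linarith
  then show ?thesis
    using True e eps_le_1 [OF s] by (simp add: step_def)
next
  case False
  let ?r = "\<integral>y. rate s x y \<partial>lborel"
  define w where "w y = rate s x y - e * target y" for y
  have [measurable]: "w \<in> borel_measurable borel"
    unfolding w_def by measurable
  have w_nonneg: "0 \<le> w y" for y
    using rate_lower [OF s False, of y] mult_right_mono [OF e(2) target_nonneg [of y]]
    by (simp add: w_def)
  have iw: "integrable lborel w"
    unfolding w_def by (intro Bochner_Integration.integrable_diff integrable_rate s) simp
  have int_w: "(\<integral>y. w y \<partial>lborel) = ?r - e"
    unfolding w_def by (subst Bochner_Integration.integral_diff) (auto simp: integrable_rate s)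
  have wh: "\<bar>w y * h y\<bar> \<le> c * w y" for y
    using mult_right_mono [OF h [of y] w_nonneg [of y]] w_nonneg [of y] by (simp add: abs_mult mult.commute)
  have iwh: "integrable lborel (\<lambda>y. w y * h y)"
  proof (rule Bochner_Integration.integrable_bound [of _ "\<lambda>y. c * w y"])
    show "AE y in lborel. norm (w y * h y) \<le> norm (c * w y)"
      using order_trans [OF wh abs_ge_self] by simp
  qed (use iw in auto)
  have iht: "integrable lborel (\<lambda>y. h y * target y)"
    by (rule integrable_times_target [OF _ h]) measurable
  have "(\<integral>y. rate s x y * h y \<partial>lborel) = (\<integral>y. w y * h y + e * (h y * target y) \<partial>lborel)"
    by (simp add: w_def algebra_simps)
  also have "\<dots> = (\<integral>y. w y * h y \<partial>lborel)"
    by (subst Bochner_Integration.integral_add) (use iwh iht mean in auto)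
  finally have eq: "(\<integral>y. rate s x y * h y \<partial>lborel) = (\<integral>y. w y * h y \<partial>lborel)" .
  have "\<bar>\<integral>y. w y * h y \<partial>lborel\<bar> \<le> (\<integral>y. \<bar>w y * h y\<bar> \<partial>lborel)"
    by (rule integral_abs_bound)
  also have "\<dots> \<le> (\<integral>y. c * w y \<partial>lborel)"
    by (intro integral_mono integrable_abs iwh integrable_mult_right iw wh)
  also have "\<dots> = c * (?r - e)"
    by (simp add: int_w)
  finally have 1: "\<bar>\<integral>y. w y * h y \<partial>lborel\<bar> \<le> c * (?r - e)" .
  have 2: "\<bar>h x * (1 - ?r)\<bar> \<le> c * (1 - ?r)"
    using h [of x] integral_rate_le_1 [OF s, of x] by (simp add: abs_mult mult_right_mono)
  have "\<bar>step s h x\<bar> \<le> c * (?r - e) + c * (1 - ?r)"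
    unfolding step_eq [OF s \<open>h \<in> borel_measurable borel\<close> h False] eq using 1 2 by linarith
  then show ?thesis
    by (simp add: algebra_simps)
qed

lemma step_bound:
  assumes "s \<in> \<S>" "h \<in> borel_measurable borel" "\<And>y. \<bar>h y\<bar> \<le> c"
  shows "\<bar>step s h x\<bar> \<le> c"
  using step_contract_aux [of s h c 0 x] assms eps_pos by simp

lemma step_contract:
  assumes "s \<in> \<S>" "h \<in> borel_measurable borel" "\<And>y. \<bar>h y\<bar> \<le> c"
    and "(\<integral>y. h y * target y \<partial>lborel) = 0"
  shows "\<bar>step s h x\<bar> \<le> (1 - eps) * c"
  using step_contract_aux [of s h c eps x] assms eps_pos by simp

text \<open>Reversibility: the flow \<open>rate s x y * target x\<close> is symmetric in \<open>x\<close> and \<open>y\<close>.\<close>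

lemma step_invariant:
  assumes s: "s \<in> \<S>" and [measurable]: "h \<in> borel_measurable borel" and h: "\<And>y. \<bar>h y\<bar> \<le> c"
  shows "(\<integral>x. step s h x * target x \<partial>lborel) = (\<integral>x. h x * target x \<partial>lborel)"
proof -
  define k where "k x y = target x * (rate s x y * (h y - h x))" for x y
  have k_alt: "k x y = min (target x) (target y) * q s (y - x) * (h y - h x)" for x y
    unfolding k_def rate_def accept_prob_times_target [symmetric] by (simp add: mult_ac)
  have anti: "k y x = - k x y" for x y
    using q_even [of s "x - y"] by (simp add: k_alt min.commute algebra_simps)
  have [measurable]: "(\<lambda>(x, y). k x y) \<in> borel_measurable (lborel \<Otimes>\<^sub>M lborel)"
    unfolding k_def by measurable
  have c: "0 \<le> c"
    using h [of 0] by linarith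
  have ik: "integrable (lborel \<Otimes>\<^sub>M lborel) (\<lambda>(x, y). k x y)"
  proof (rule integrableI_bounded)
    have "(\<integral>\<^sup>+ p. ennreal (norm (case p of (x, y) \<Rightarrow> k x y)) \<partial>(lborel \<Otimes>\<^sub>M lborel))
        = (\<integral>\<^sup>+ x. \<integral>\<^sup>+ y. ennreal \<bar>k x y\<bar> \<partial>lborel \<partial>lborel)"
      by (subst lborel.nn_integral_fst [symmetric]) auto
    also have "\<dots> \<le> (\<integral>\<^sup>+ x. ennreal (2 * c) * ennreal (target x) \<partial>lborel)"
    proof (rule nn_integral_mono)
      fix x
      have "\<bar>k x y\<bar> \<le> (2 * c * target x) * rate s x y" for y
      proof -
        have "\<bar>h y - h x\<bar> \<le> 2 * c"
          using h [of x] h [of y] by linarith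
        then have "target x * rate s x y * \<bar>h y - h x\<bar> \<le> target x * rate s x y * (2 * c)"
          by (intro mult_left_mono mult_nonneg_nonneg target_nonneg rate_nonneg s)
        then show ?thesis
          by (simp add: k_def abs_mult target_nonneg rate_nonneg s mult_ac)
      qed
      then have "(\<integral>\<^sup>+ y. ennreal \<bar>k x y\<bar> \<partial>lborel)
          \<le> (\<integral>\<^sup>+ y. ennreal (2 * c * target x) * ennreal (rate s x y) \<partial>lborel)"
        using c target_nonneg [of x]
        by (intro nn_integral_mono) (simp add: ennreal_mult [symmetric] rate_nonneg s)
      also have "\<dots> = ennreal (2 * c * target x) * (\<integral>\<^sup>+ y. ennreal (rate s x y) \<partial>lborel)"
        by (intro nn_integral_cmult) measurable
      also have "\<dots> \<le> ennreal (2 * c * target x) * 1"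
        by (intro mult_left_mono nn_integral_rate s) simp
      finally show "(\<integral>\<^sup>+ y. ennreal \<bar>k x y\<bar> \<partial>lborel) \<le> ennreal (2 * c) * ennreal (target x)"
        using c target_nonneg [of x] by (simp add: ennreal_mult)
    qed
    also have "\<dots> < \<infinity>"
      by (subst nn_integral_cmult) (auto simp: nn_integral_target)
    finally show "(\<integral>\<^sup>+ p. ennreal (norm (case p of (x, y) \<Rightarrow> k x y)) \<partial>(lborel \<Otimes>\<^sub>M lborel)) < \<infinity>" .
  qed measurable
  \<comment> \<open>Exchanging the integrals and using antisymmetry turns the total flow into its
    own negative.\<close>
  have "(\<integral>x. \<integral>y. k x y \<partial>lborel \<partial>lborel) = (\<integral>y. \<integral>x. k x y \<partial>lborel \<partial>lborel)"
    by (rule lborel_pair.Fubini_integral [OF ik, symmetric])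
  also have "\<dots> = - (\<integral>x. \<integral>y. k x y \<partial>lborel \<partial>lborel)"
    by (subst anti) simp
  finally have zero: "(\<integral>x. \<integral>y. k x y \<partial>lborel \<partial>lborel) = 0"
    by simp
  have "step s h x * target x = h x * target x + (\<integral>y. k x y \<partial>lborel)" for x
    by (cases "target x = 0") (simp_all add: step_def k_def distrib_right mult.commute [of "target x"])
  then have "(\<integral>x. step s h x * target x \<partial>lborel)
      = (\<integral>x. h x * target x + (\<integral>y. k x y \<partial>lborel) \<partial>lborel)"
    by simp
  also have "\<dots> = (\<integral>x. h x * target x \<partial>lborel) + (\<integral>x. \<integral>y. k x y \<partial>lborel \<partial>lborel)"
    by (rule Bochner_Integration.integral_add)
      (use integrable_times_target [OF _ h] lborel_pair.integrable_fst [OF ik] in auto)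
  finally show ?thesis
    using zero by simp
qed

text \<open>Acceptance does not depend on the parameter and \<open>rate\<close> vanishes at points y
  off the support, so only increments of norm at most \<open>2 * R\<close> matter and the difference
  of proposal densities is integrated over a ball of radius \<open>R\<close>. The modulus depends on
  \<open>h\<close> only through \<open>c\<close>, which allows its use on iterates.\<close>

lemma step_uniform:
  assumes e: "0 < e"
  shows "\<exists>\<delta>>0. \<forall>s\<in>\<S>. \<forall>s'\<in>\<S>. dist s s' < \<delta> \<longrightarrow> (\<forall>h x. h \<in> borel_measurable borel \<longrightarrow>
    (\<forall>y. \<bar>h y\<bar> \<le> c) \<longrightarrow> \<bar>step s h x - step s' h x\<bar> \<le> e)"
proof (cases "0 \<le> c")
  \<comment> \<open>No function has a negative bound on its modulus, so the claim is
    vacuous.\<close>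
  case False
  then show ?thesis
    by (intro exI [of _ 1]) (auto dest: order_trans [OF abs_ge_zero])
next
  case c: True
  define vol where "vol = measure lborel (cball (0::real^'d) R)"
  \<comment> \<open>Integration over the ball costs the factor \<open>2 * c * vol\<close>; the added
    1 keeps the denominator positive when that factor is 0.\<close>
  define e' where "e' = e / (2 * c * vol + 1)"
  have vol: "0 \<le> vol"
    by (simp add: vol_def)
  have e': "0 < e'" "2 * c * e' * vol \<le> e"
  proof -
    have pos: "0 < 2 * c * vol + 1"
      using c vol by (intro add_nonneg_pos) auto
    then show "0 < e'"
      using e by (simp add: e'_def)
    have "2 * c * e' * vol = e' * (2 * c * vol + 1) - e'"
      by (simp add: algebra_simps)
    also have "\<dots> = e - e'"
      using pos by (simp add: e'_def)
    finally show "2 * c * e' * vol \<le> e"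
      using \<open>0 < e'\<close> by simp
  qed
  obtain \<delta> where \<delta>: "0 < \<delta>" and q: "\<And>s s' z. s \<in> \<S> \<Longrightarrow> s' \<in> \<S> \<Longrightarrow> dist s s' < \<delta> \<Longrightarrow>
      norm z \<le> 2 * R \<Longrightarrow> \<bar>q s z - q s' z\<bar> \<le> e'"
    using q_uniform [OF e'(1)] by blast
  have "\<bar>step s h x - step s' h x\<bar> \<le> e"
    if s: "s \<in> \<S>" "s' \<in> \<S>" "dist s s' < \<delta>" and [measurable]: "h \<in> borel_measurable borel"
      and h: "\<And>y. \<bar>h y\<bar> \<le> c" for s s' h x
  proof (cases "target x = 0")
    case True
    then show ?thesis using e by (simp add: step_def)
  next
    case x: False
    let ?g = "\<lambda>y. rate s x y * (h y - h x) - rate s' x y * (h y - h x)"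
    have h2: "\<bar>h y - h x\<bar> \<le> 2 * c" for y
      using h [of x] h [of y] by linarith
    have int: "integrable lborel (\<lambda>y. rate t x y * (h y - h x))" if "t \<in> \<S>" for t
      by (rule integrable_rate_times [OF that _ h2]) measurable
    have "step s h x - step s' h x = (\<integral>y. ?g y \<partial>lborel)"
      by (subst Bochner_Integration.integral_diff) (use int s x in \<open>auto simp: step_def\<close>)
    then have "\<bar>step s h x - step s' h x\<bar> \<le> (\<integral>y. \<bar>?g y\<bar> \<partial>lborel)"
      using integral_abs_bound [of lborel ?g] by simp
    also have "\<dots> \<le> (\<integral>y. indicator (cball (0::real^'d) R) y * (2 * c * e') \<partial>lborel)"
    proof (rule integral_mono)
      show "integrable lborel (\<lambda>y. \<bar>?g y\<bar>)"
        by (intro integrable_abs Bochner_Integration.integrable_diff int s)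
      show "integrable lborel (\<lambda>y::real^'d. indicator (cball 0 R) y * (2 * c * e'))"
        by (intro integrable_mult_left integrable_real_indicator)
          (auto simp: emeasure_lborel_cball_finite [unfolded infinity_ennreal_def])
      fix y
      show "\<bar>?g y\<bar> \<le> indicator (cball 0 R) y * (2 * c * e')"
      proof (cases "target y = 0")
        case True
        then show ?thesis
          using c e'(1) by (simp add: rate_eq_0)
      next
        case y: False
        have "norm (y - x) \<le> 2 * R"
          using norm_triangle_ineq4 [of y x] support [OF x] support [OF y] by linarith
        then have "\<bar>q s (y - x) - q s' (y - x)\<bar> \<le> e'"
          by (rule q [OF s])
        then have "accept_prob target x y * \<bar>q s (y - x) - q s' (y - x)\<bar> \<le> 1 * e'"
          using accept_prob_le_1 accept_prob_nonneg by (intro mult_mono) auto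
        then have "accept_prob target x y * \<bar>q s (y - x) - q s' (y - x)\<bar> * \<bar>h y - h x\<bar> \<le> e' * (2 * c)"
          using h2 [of y] e'(1) by (intro mult_mono) auto
        moreover have "?g y = accept_prob target x y * (q s (y - x) - q s' (y - x)) * (h y - h x)"
          unfolding rate_def by (simp add: left_diff_distrib right_diff_distrib mult.assoc)
        then have "\<bar>?g y\<bar> = accept_prob target x y * \<bar>q s (y - x) - q s' (y - x)\<bar> * \<bar>h y - h x\<bar>"
          by (simp only: abs_mult abs_of_nonneg [OF accept_prob_nonneg])
        ultimately show ?thesis
          using support [OF y] by (simp add: mult_ac)
      qed
    qed
    also have "\<dots> = 2 * c * e' * vol"
      by (simp add: vol_def)
    finally show ?thesis
      using e'(2) by linarith
  qed
  with \<delta> show ?thesis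
    by blast
qed

section \<open>Iterates of one kernel and truncated Neumann series\<close>

lemma iter_measurable [measurable (raw)]:
  assumes f [measurable]: "f \<in> borel_measurable borel"
    and [measurable]: "g \<in> N \<rightarrow>\<^sub>M borel" "h \<in> N \<rightarrow>\<^sub>M borel"
  shows "(\<lambda>x. (step (g x) ^^ n) f (h x)) \<in> borel_measurable N"
proof -
  \<comment> \<open>Parameter and point stay joint variables in the induction, since the iterate fed
    into \<open>step\<close> depends on the parameter as well.\<close>
  have *: "(\<lambda>p. (step (fst p) ^^ n) f (snd p)) \<in> borel_measurable (borel \<Otimes>\<^sub>M borel)"
  proof (induction n)
    case (Suc n)
    have "(\<lambda>p. (fst (fst p), snd p)) \<in> (borel \<Otimes>\<^sub>M borel) \<Otimes>\<^sub>M borel \<rightarrow>\<^sub>M borel \<Otimes>\<^sub>M borel"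
      by measurable
    from measurable_compose [OF this Suc]
    have "(\<lambda>p. step (fst p) ((step (fst p) ^^ n) f) (snd p)) \<in> borel_measurable (borel \<Otimes>\<^sub>M borel)"
      by (intro step_measurable) (auto simp: case_prod_unfold)
    then show ?case
      by simp
  qed simp
  show ?thesis
    using measurable_compose [OF _ *, of "\<lambda>x. (g x, h x)" N] by simp
qed

lemma iter_bound:
  assumes s: "s \<in> \<S>" and [measurable]: "f \<in> borel_measurable borel" and f: "\<And>y. \<bar>f y\<bar> \<le> c"
  shows "\<bar>(step s ^^ n) f x\<bar> \<le> c"
proof (induction n arbitrary: x)
  case (Suc n)
  then show ?case
    using step_bound [OF s, of "(step s ^^ n) f" c x] by simp
qed (simp add: f)

lemma iter_mean:
  assumes s: "s \<in> \<S>" and [measurable]: "f \<in> borel_measurable borel" and f: "\<And>y. \<bar>f y\<bar> \<le> c"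
  shows "(\<integral>x. (step s ^^ n) f x * target x \<partial>lborel) = (\<integral>x. f x * target x \<partial>lborel)"
proof (induction n)
  case (Suc n)
  then show ?case
    using step_invariant [OF s _ iter_bound [OF s _ f, where n = n]] by simp
qed simp

text \<open>Invariance keeps the mean of every iterate at zero, so the centred contraction applies
  anew each time.\<close>

lemma iter_contract:
  assumes s: "s \<in> \<S>" and [measurable]: "f \<in> borel_measurable borel" and f: "\<And>y. \<bar>f y\<bar> \<le> c"
    and mean: "(\<integral>x. f x * target x \<partial>lborel) = 0"
  shows "\<bar>(step s ^^ n) f x\<bar> \<le> (1 - eps) ^ n * c"
proof (induction n arbitrary: x)
  case (Suc n)
  have "(\<integral>x. (step s ^^ n) f x * target x \<partial>lborel) = 0"
    using iter_mean [OF s _ f, where n = n] mean by simp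
  then show ?case
    using step_contract [OF s, of "(step s ^^ n) f" "(1 - eps) ^ n * c" x] Suc by (simp add: mult_ac)
qed (simp add: f)

text \<open>The change of parameter is made in two moves: in the inner iterate under a fixed outer
  kernel, which does not expand, and then in the outer kernel on a common bounded iterate.\<close>

lemma iter_uniform:
  assumes fm [measurable]: "f \<in> borel_measurable borel" and f: "\<And>y. \<bar>f y\<bar> \<le> c" and e: "0 < e"
  shows "\<exists>\<delta>>0. \<forall>s\<in>\<S>. \<forall>s'\<in>\<S>. dist s s' < \<delta> \<longrightarrow> (\<forall>x. \<bar>(step s ^^ n) f x - (step s' ^^ n) f x\<bar> \<le> e)"
  using e
proof (induction n arbitrary: e)
  case 0
  then show ?case by (intro exI [of _ 1]) auto
next
  case (Suc n)
  obtain \<delta>1 where \<delta>1: "0 < \<delta>1" and 1: "\<And>s s' x. s \<in> \<S> \<Longrightarrow> s' \<in> \<S> \<Longrightarrow> dist s s' < \<delta>1 \<Longrightarrow>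
      \<bar>(step s ^^ n) f x - (step s' ^^ n) f x\<bar> \<le> e / 2"
    using Suc.IH [of "e / 2"] Suc.prems by (metis half_gt_zero)
  obtain \<delta>2 where \<delta>2: "0 < \<delta>2" and 2: "\<And>s s' h x. s \<in> \<S> \<Longrightarrow> s' \<in> \<S> \<Longrightarrow> dist s s' < \<delta>2 \<Longrightarrow>
      h \<in> borel_measurable borel \<Longrightarrow> (\<forall>y. \<bar>h y\<bar> \<le> c) \<Longrightarrow> \<bar>step s h x - step s' h x\<bar> \<le> e / 2"
    using step_uniform [of "e / 2" c] Suc.prems by (metis half_gt_zero)
  have "\<bar>(step s ^^ Suc n) f x - (step s' ^^ Suc n) f x\<bar> \<le> e"
    if s: "s \<in> \<S>" "s' \<in> \<S>" "dist s s' < min \<delta>1 \<delta>2" for s s' x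
  proof -
    let ?h = "(step s ^^ n) f" and ?h' = "(step s' ^^ n) f"
    have "\<bar>step s (\<lambda>y. ?h y - ?h' y) x\<bar> \<le> e / 2"
      by (rule step_bound [OF s(1)]) (use s 1 in auto)
    then have "\<bar>step s ?h x - step s ?h' x\<bar> \<le> e / 2"
      by (subst step_diff [OF s(1) _ _ iter_bound [OF s(1) fm f] iter_bound [OF s(2) fm f]]) auto
    moreover have "\<bar>step s ?h' x - step s' ?h' x\<bar> \<le> e / 2"
      using s by (intro 2) (auto intro!: iter_bound f)
    ultimately show ?thesis
      unfolding funpow.simps o_apply by linarith
  qed
  then show ?case
    using \<delta>1 \<delta>2 by (intro exI [of _ "min \<delta>1 \<delta>2"]) auto
qed

text \<open>A truncated Neumann series, solving the Poisson equation up to the remainder \<open>(step s ^^ N) f\<close>.\<close>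

definition neumann :: "(real^'d \<Rightarrow> real) \<Rightarrow> nat \<Rightarrow> 's \<Rightarrow> real^'d \<Rightarrow> real" where
  "neumann f N s x = (\<Sum>n<N. (step s ^^ n) f x)"

lemma neumann_measurable [measurable (raw)]:
  assumes [measurable]: "f \<in> borel_measurable borel" "g \<in> N \<rightarrow>\<^sub>M borel" "h \<in> N \<rightarrow>\<^sub>M borel"
  shows "(\<lambda>x. neumann f n (g x) (h x)) \<in> borel_measurable N"
  unfolding neumann_def by measurable

lemma neumann_bound:
  assumes "s \<in> \<S>" "f \<in> borel_measurable borel" "\<And>y. \<bar>f y\<bar> \<le> c"
  shows "\<bar>neumann f N s x\<bar> \<le> real N * c"
proof -
  have "\<bar>neumann f N s x\<bar> \<le> (\<Sum>n<N. \<bar>(step s ^^ n) f x\<bar>)"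
    unfolding neumann_def by (rule sum_abs)
  also have "\<dots> \<le> (\<Sum>n<N. c)"
    by (intro sum_mono iter_bound assms)
  finally show ?thesis
    by simp
qed

text \<open>On bounded functions \<open>step s\<close> respects differences, so it sends each term
  of the series to the next one; the difference telescopes to the initial term minus the first
  omitted one.\<close>

lemma neumann_poisson:
  assumes s: "s \<in> \<S>" and f [measurable]: "f \<in> borel_measurable borel" and b: "\<And>y. \<bar>f y\<bar> \<le> c"
  shows "neumann f N s x - step s (neumann f N s) x = f x - (step s ^^ N) f x"
proof -
  have "step s (neumann f N s) x = (\<Sum>n<N. (step s ^^ Suc n) f x)"
  proof (induction N)
    case 0
    show ?case by (simp add: neumann_def [abs_def] step_def)
  next
    case (Suc N)
    have "step s (neumann f (Suc N) s) x - step s ((step s ^^ N) f) x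
        = step s (\<lambda>y. neumann f (Suc N) s y - (step s ^^ N) f y) x"
      by (rule step_diff [OF s _ _ neumann_bound [OF s f b] iter_bound [OF s f b]]) measurable
    also have "(\<lambda>y. neumann f (Suc N) s y - (step s ^^ N) f y) = neumann f N s"
      by (simp add: neumann_def fun_eq_iff)
    finally show ?case
      using Suc by simp
  qed
  then have "neumann f N s x - step s (neumann f N s) x
      = (\<Sum>n<N. (step s ^^ n) f x - (step s ^^ Suc n) f x)"
    by (simp add: neumann_def sum_subtractf)
  also have "\<dots> = f x - (step s ^^ N) f x"
    by (subst sum_lessThan_telescope') simp
  finally show ?thesis .
qed

lemma neumann_uniform:
  assumes fm [measurable]: "f \<in> borel_measurable borel" and f: "\<And>y. \<bar>f y\<bar> \<le> c" and e: "0 < e"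
  shows "\<exists>\<delta>>0. \<forall>s\<in>\<S>. \<forall>s'\<in>\<S>. dist s s' < \<delta> \<longrightarrow> (\<forall>x. \<bar>neumann f N s x - neumann f N s' x\<bar> \<le> e)"
  using e
proof (induction N arbitrary: e)
  case 0
  then show ?case by (intro exI [of _ 1]) (auto simp: neumann_def)
next
  case (Suc N)
  obtain \<delta>1 where \<delta>1: "0 < \<delta>1" and 1: "\<And>s s' x. s \<in> \<S> \<Longrightarrow> s' \<in> \<S> \<Longrightarrow> dist s s' < \<delta>1 \<Longrightarrow>
      \<bar>neumann f N s x - neumann f N s' x\<bar> \<le> e / 2"
    using Suc.IH [of "e / 2"] Suc.prems by (metis half_gt_zero)
  obtain \<delta>2 where \<delta>2: "0 < \<delta>2" and 2: "\<And>s s' x. s \<in> \<S> \<Longrightarrow> s' \<in> \<S> \<Longrightarrow> dist s s' < \<delta>2 \<Longrightarrow>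
      \<bar>(step s ^^ N) f x - (step s' ^^ N) f x\<bar> \<le> e / 2"
    using iter_uniform [OF fm f, where e = "e / 2" and n = N] Suc.prems by (auto simp: half_gt_zero)
  have "\<bar>neumann f (Suc N) s x - neumann f (Suc N) s' x\<bar> \<le> e"
    if s: "s \<in> \<S>" "s' \<in> \<S>" "dist s s' < min \<delta>1 \<delta>2" for s s' x
  proof -
    have "neumann f (Suc N) t x = neumann f N t x + (step t ^^ N) f x" for t
      by (simp add: neumann_def)
    then have "\<bar>neumann f (Suc N) s x - neumann f (Suc N) s' x\<bar>
        \<le> \<bar>neumann f N s x - neumann f N s' x\<bar> + \<bar>(step s ^^ N) f x - (step s' ^^ N) f x\<bar>"
      by simp
    moreover have "\<dots> \<le> e / 2 + e / 2"
      using s by (intro add_mono 1 2) auto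
    ultimately show ?thesis
      by simp
  qed
  then show ?case
    using \<delta>1 \<delta>2 by (intro exI [of _ "min \<delta>1 \<delta>2"]) auto
qed

text \<open>Close parameters are covered by uniform continuity; for distances of at least \<delta>
  the crude bound on the oscillation, divided by \<delta>, serves as slope. The affine form lets
  Cesaro means of distances be inserted directly.\<close>

lemma neumann_lipschitz_up_to:
  assumes fm [measurable]: "f \<in> borel_measurable borel" and f: "\<And>y. \<bar>f y\<bar> \<le> c" and e: "0 < e"
  obtains K where "0 \<le> K"
    "\<And>s s' x. s \<in> \<S> \<Longrightarrow> s' \<in> \<S> \<Longrightarrow> \<bar>neumann f N s x - neumann f N s' x\<bar> \<le> e + K * dist s s'"
proof -
  obtain \<delta> where \<delta>: "0 < \<delta>" and close: "\<And>s s' x. s \<in> \<S> \<Longrightarrow> s' \<in> \<S> \<Longrightarrow> dist s s' < \<delta> \<Longrightarrow>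
      \<bar>neumann f N s x - neumann f N s' x\<bar> \<le> e"
    using neumann_uniform [OF fm f e, where N = N] by auto
  define C where "C = 2 * (real N * c)"
  have "0 \<le> c"
    using f [of 0] by linarith
  then have C: "0 \<le> C"
    by (simp add: C_def)
  have "\<bar>neumann f N s x - neumann f N s' x\<bar> \<le> e + (C / \<delta>) * dist s s'"
    if s: "s \<in> \<S>" "s' \<in> \<S>" for s s' x
  proof (cases "dist s s' < \<delta>")
    case True
    moreover have "0 \<le> (C / \<delta>) * dist s s'"
      using C \<delta> by simp
    ultimately show ?thesis
      using close [OF s, of x] by linarith
  next
    case False
    have "\<bar>neumann f N s x - neumann f N s' x\<bar> \<le> C"
      using neumann_bound [OF s(1) fm f, where N = N and x = x] neumann_bound [OF s(2) fm f, where N = N and x = x] by (simp add: C_def)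
    also have "C = (C / \<delta>) * \<delta>"
      using \<delta> by simp
    also have "\<dots> \<le> (C / \<delta>) * dist s s'"
      using False C \<delta> by (intro mult_left_mono) auto
    finally show ?thesis
      using e by linarith
  qed
  then show ?thesis
    using C \<delta> by (intro that [of "C / \<delta>"]) auto
qed

end


section \<open>Averages\<close>

lemma cesaro_null:
  fixes u :: "nat \<Rightarrow> real"
  assumes "u \<longlonglongrightarrow> 0"
  shows "(\<lambda>n. (\<Sum>k<n. u k) / real n) \<longlonglongrightarrow> 0"
proof (rule LIMSEQ_I)
  fix e :: real assume e: "0 < e"
  obtain N where "\<forall>k\<ge>N. norm (u k - 0) < e / 2"
    using LIMSEQ_D [OF assms half_gt_zero [OF e]] by blast
  then have N: "\<bar>u k\<bar> \<le> e / 2" if "N \<le> k" for k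
    using that by (metis diff_zero less_imp_le real_norm_def)
  define c where "c = (\<Sum>k<N. \<bar>u k\<bar>)"
  obtain n0 where n0: "\<And>n. n0 \<le> n \<Longrightarrow> c / real n < e / 2"
    using order_tendstoD(2) [OF lim_const_over_n [of c] half_gt_zero [OF e]]
    unfolding eventually_sequentially by blast
  have "\<bar>(\<Sum>k<n. u k) / real n\<bar> < e" if n: "max (max n0 N) 1 \<le> n" for n
  proof -
    have "\<bar>\<Sum>k<n. u k\<bar> \<le> (\<Sum>k<n. \<bar>u k\<bar>)"
      by (rule sum_abs)
    also have "\<dots> = c + (\<Sum>k\<in>{N..<n}. \<bar>u k\<bar>)"
      unfolding c_def lessThan_atLeast0 using n by (intro sum.atLeastLessThan_concat [symmetric]) auto
    also have "(\<Sum>k\<in>{N..<n}. \<bar>u k\<bar>) \<le> (\<Sum>k\<in>{N..<n}. e / 2)"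
      by (intro sum_mono N) auto
    also have "\<dots> \<le> real n * (e / 2)"
      using e by simp
    finally have "\<bar>\<Sum>k<n. u k\<bar> / real n \<le> c / real n + e / 2"
      using n by (simp add: field_simps)
    moreover have "c / real n < e / 2"
      using n by (intro n0) simp
    ultimately have "\<bar>\<Sum>k<n. u k\<bar> / real n < e"
      by linarith
    then show ?thesis
      by simp
  qed
  then show "\<exists>n0. \<forall>n\<ge>n0. norm ((\<Sum>k<n. u k) / real n - 0) < e"
    by (intro exI [of _ "max (max n0 N) 1"]) auto
qed

text \<open>Every n exceeds the largest square \<open>m\<^sup>2\<close> below or at it by at most
  \<open>2 * m\<close>, so bounded increments change the sum by at most \<open>2 * m * c\<close>,
  which is negligible against \<open>m\<^sup>2\<close>.\<close>

lemma tendsto_div_of_squares: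
  fixes S :: "nat \<Rightarrow> real"
  assumes inc: "\<And>n. \<bar>S (Suc n) - S n\<bar> \<le> c"
    and sq: "(\<lambda>m. S (m\<^sup>2) / real (m\<^sup>2)) \<longlonglongrightarrow> 0"
  shows "(\<lambda>n. S n / real n) \<longlonglongrightarrow> 0"
proof -
  have c: "0 \<le> c"
    using inc [of 0] by linarith
  have lip: "\<bar>S (n + k) - S n\<bar> \<le> real k * c" for n k
  proof (induction k)
    case (Suc k)
    then show ?case
      using inc [of "n + k"] by (simp add: algebra_simps)
  qed simp
  have fs: "filterlim floor_sqrt at_top at_top"
    unfolding filterlim_at_top
  proof
    fix m :: nat
    show "\<forall>\<^sub>F n in sequentially. m \<le> floor_sqrt n"
      using eventually_ge_at_top [of "m\<^sup>2"]
      by eventually_elim (metis floor_sqrt_inverse_power2 mono_floor_sqrt')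
  qed
  have "(\<lambda>m. \<bar>S (m\<^sup>2) / real (m\<^sup>2)\<bar> + 2 * c / real m) \<longlonglongrightarrow> \<bar>0\<bar> + 0"
    by (intro tendsto_add tendsto_rabs sq lim_const_over_n)
  then have lim: "(\<lambda>m. \<bar>S (m\<^sup>2) / real (m\<^sup>2)\<bar> + 2 * c / real m) \<longlonglongrightarrow> 0"
    by simp
  have "(\<lambda>n. \<bar>S ((floor_sqrt n)\<^sup>2) / real ((floor_sqrt n)\<^sup>2)\<bar> + 2 * c / real (floor_sqrt n)) \<longlonglongrightarrow> 0"
    by (rule filterlim_compose [OF lim fs])
  moreover have "\<forall>\<^sub>F n in sequentially. norm (S n / real n)
      \<le> \<bar>S ((floor_sqrt n)\<^sup>2) / real ((floor_sqrt n)\<^sup>2)\<bar> + 2 * c / real (floor_sqrt n)"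
    using eventually_ge_at_top [of 1]
  proof eventually_elim
    case (elim n)
    define m where "m = floor_sqrt n"
    have m: "1 \<le> m" "m\<^sup>2 \<le> n" "n < (Suc m)\<^sup>2"
      using elim mono_floor_sqrt' [of 1 n] by (auto simp: m_def Suc_floor_sqrt_power2_gt)
    define k where "k = n - m\<^sup>2"
    have k: "n = m\<^sup>2 + k" "k \<le> 2 * m"
      using m by (auto simp: k_def power2_eq_square)
    have "\<bar>S n\<bar> \<le> \<bar>S (m\<^sup>2)\<bar> + real k * c"
      using lip [of "m\<^sup>2" k] by (simp add: k(1))
    also have "\<dots> \<le> \<bar>S (m\<^sup>2)\<bar> + 2 * real m * c"
      using k(2) c by (intro add_left_mono mult_right_mono) auto
    finally have "\<bar>S n\<bar> / real n \<le> (\<bar>S (m\<^sup>2)\<bar> + 2 * real m * c) / real n"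
      by (simp add: divide_right_mono)
    also have "\<dots> \<le> (\<bar>S (m\<^sup>2)\<bar> + 2 * real m * c) / real (m\<^sup>2)"
      using m c elim by (intro divide_left_mono) auto
    also have "\<dots> = \<bar>S (m\<^sup>2) / real (m\<^sup>2)\<bar> + 2 * c / real m"
      using m by (simp add: field_simps power2_eq_square)
    finally show ?case
      by (simp add: m_def)
  qed
  ultimately show ?thesis
    by (rule Lim_null_comparison [rotated])
qed

text \<open>Orthogonality makes the second moment of the n-th sum at most
  \<open>n * c\<^sup>2\<close>. Along squares the second moments of the averages are therefore
  summable, which forces almost sure convergence there; boundedness of the summands fills the
  gaps.\<close>

lemma (in prob_space) bounded_uncorrelated_slln:
  fixes D :: "nat \<Rightarrow> 'a \<Rightarrow> real"
  assumes [measurable]: "\<And>k. D k \<in> borel_measurable M"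
    and D: "\<And>k \<omega>. \<omega> \<in> space M \<Longrightarrow> \<bar>D k \<omega>\<bar> \<le> c"
    and uncorrelated: "\<And>i j. i < j \<Longrightarrow> expectation (\<lambda>\<omega>. D i \<omega> * D j \<omega>) = 0"
  shows "AE \<omega> in M. (\<lambda>n. (\<Sum>k<n. D k \<omega>) / real n) \<longlonglongrightarrow> 0"
proof -
  define S where "S n \<omega> = (\<Sum>k<n. D k \<omega>)" for n \<omega>
  have [measurable]: "S n \<in> borel_measurable M" for n
    unfolding S_def by measurable
  have Sb: "\<bar>S n \<omega>\<bar> \<le> real n * c" if "\<omega> \<in> space M" for n \<omega>
  proof -
    have "\<bar>S n \<omega>\<bar> \<le> (\<Sum>k<n. \<bar>D k \<omega>\<bar>)"
      unfolding S_def by (rule sum_abs)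
    also have "\<dots> \<le> (\<Sum>k<n. c)"
      by (intro sum_mono D that)
    finally show ?thesis by simp
  qed
  have int: "integrable M (\<lambda>\<omega>. X \<omega> * Y \<omega>)"
    if [measurable]: "X \<in> borel_measurable M" "Y \<in> borel_measurable M"
      and b: "\<And>\<omega>. \<omega> \<in> space M \<Longrightarrow> \<bar>X \<omega>\<bar> \<le> a" "\<And>\<omega>. \<omega> \<in> space M \<Longrightarrow> \<bar>Y \<omega>\<bar> \<le> b" for X Y and a b :: real
  proof (rule integrable_const_bound [of _ "a * b"])
    show "AE \<omega> in M. norm (X \<omega> * Y \<omega>) \<le> a * b"
    proof (rule AE_I2)
      fix \<omega> assume "\<omega> \<in> space M"
      from b(1) [OF this] b(2) [OF this] show "norm (X \<omega> * Y \<omega>) \<le> a * b"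
        by (auto simp: abs_mult intro!: mult_mono)
    qed
  qed measurable
  have second: "expectation (\<lambda>\<omega>. S n \<omega> * S n \<omega>) \<le> real n * c\<^sup>2" for n
  proof (induction n)
    case (Suc n)
    have iDD: "integrable M (\<lambda>\<omega>. D i \<omega> * D j \<omega>)" for i j
      by (rule int [OF _ _ D D]) auto
    have "expectation (\<lambda>\<omega>. S n \<omega> * D n \<omega>) = (\<Sum>k<n. expectation (\<lambda>\<omega>. D k \<omega> * D n \<omega>))"
      unfolding S_def sum_distrib_right by (intro Bochner_Integration.integral_sum iDD)
    also have "\<dots> = 0"
      by (intro sum.neutral) (auto simp: uncorrelated)
    finally have cross: "expectation (\<lambda>\<omega>. S n \<omega> * D n \<omega>) = 0" .
    have "expectation (\<lambda>\<omega>. D n \<omega> * D n \<omega>) \<le> expectation (\<lambda>\<omega>. c\<^sup>2)"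
    proof (rule integral_mono [OF iDD])
      fix \<omega> assume "\<omega> \<in> space M"
      from D [OF this, of n] show "D n \<omega> * D n \<omega> \<le> c\<^sup>2"
        by (metis abs_le_square_iff abs_of_nonneg abs_ge_zero order_trans power2_eq_square)
    qed simp
    then have last: "expectation (\<lambda>\<omega>. D n \<omega> * D n \<omega>) \<le> c\<^sup>2"
      by (simp add: prob_space)
    have "expectation (\<lambda>\<omega>. S (Suc n) \<omega> * S (Suc n) \<omega>)
        = expectation (\<lambda>\<omega>. S n \<omega> * S n \<omega> + (2 * (S n \<omega> * D n \<omega>) + D n \<omega> * D n \<omega>))"
      by (simp add: S_def algebra_simps)
    also have "\<dots> = expectation (\<lambda>\<omega>. S n \<omega> * S n \<omega>)
        + (2 * expectation (\<lambda>\<omega>. S n \<omega> * D n \<omega>) + expectation (\<lambda>\<omega>. D n \<omega> * D n \<omega>))"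
    proof -
      have i: "integrable M (\<lambda>\<omega>. S n \<omega> * S n \<omega>)" "integrable M (\<lambda>\<omega>. S n \<omega> * D n \<omega>)"
        by (rule int [OF _ _ Sb Sb], auto) (rule int [OF _ _ Sb D], auto)
      then show ?thesis
        using iDD by simp
    qed
    finally show ?case
      using Suc cross last by (simp add: algebra_simps)
  qed (simp add: S_def)
  \<comment> \<open>The shift to \<open>Suc m\<close> avoids the average over zero terms.\<close>
  define T where "T m \<omega> = (S ((Suc m)\<^sup>2) \<omega> / real ((Suc m)\<^sup>2))\<^sup>2" for m \<omega>
  have [measurable]: "T m \<in> borel_measurable M" for m
    unfolding T_def by measurable
  have T_mean: "(\<integral>\<^sup>+ \<omega>. ennreal (T m \<omega>) \<partial>M) \<le> ennreal (c\<^sup>2 * inverse ((real (Suc m))\<^sup>2))" for m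
  proof -
    define n where "n = (Suc m)\<^sup>2"
    have n: "0 < real n"
      by (simp add: n_def)
    have i: "integrable M (\<lambda>\<omega>. S n \<omega> * S n \<omega>)"
      by (rule int [OF _ _ Sb Sb]) auto
    have Tm: "T m = (\<lambda>\<omega>. S n \<omega> * S n \<omega> / (real n)\<^sup>2)"
      by (simp add: fun_eq_iff T_def n_def power_divide power2_eq_square)
    have "(\<integral>\<^sup>+ \<omega>. ennreal (T m \<omega>) \<partial>M) = ennreal (expectation (T m))"
    proof (intro nn_integral_eq_integral)
      show "integrable M (T m)"
        unfolding Tm using i by simp
    qed (simp add: T_def)
    also have "expectation (T m) = expectation (\<lambda>\<omega>. S n \<omega> * S n \<omega>) / (real n)\<^sup>2"
      unfolding Tm by simp
    also have "\<dots> \<le> real n * c\<^sup>2 / (real n)\<^sup>2"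
      by (intro divide_right_mono second) simp
    also have "\<dots> = c\<^sup>2 * inverse ((real (Suc m))\<^sup>2)"
      using n unfolding n_def of_nat_power by (simp add: power2_eq_square divide_simps del: of_nat_Suc)
    finally show ?thesis
      by (simp add: ennreal_leI)
  qed
  \<comment> \<open>A finite expected sum makes the series of squared averages converge almost
    surely, hence its terms vanish.\<close>
  have "(\<integral>\<^sup>+ \<omega>. (\<Sum>m. ennreal (T m \<omega>)) \<partial>M) = (\<Sum>m. \<integral>\<^sup>+ \<omega>. ennreal (T m \<omega>) \<partial>M)"
    by (intro nn_integral_suminf) measurable
  also have "\<dots> \<le> (\<Sum>m. ennreal (c\<^sup>2 * inverse ((real (Suc m))\<^sup>2)))"
    by (intro suminf_le T_mean) auto
  also have "\<dots> < \<infinity>"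
  proof -
    have "summable (\<lambda>m. c\<^sup>2 * inverse ((real (Suc m))\<^sup>2))"
      using inverse_power_summable [of 2, where ?'a = real] by (intro summable_mult) (subst summable_Suc_iff, simp)
    then show ?thesis
      by (subst suminf_ennreal2) auto
  qed
  finally have "AE \<omega> in M. (\<Sum>m. ennreal (T m \<omega>)) \<noteq> \<infinity>"
    by (intro nn_integral_PInf_AE) auto
  with AE_space show ?thesis
  proof eventually_elim
    case (elim \<omega>)
    then have "summable (\<lambda>m. T m \<omega>)"
      by (intro summable_suminf_not_top) (auto simp: T_def)
    then have "(\<lambda>m. T m \<omega>) \<longlonglongrightarrow> 0"
      by (rule summable_LIMSEQ_zero)
    then have "(\<lambda>m. sqrt (T m \<omega>)) \<longlonglongrightarrow> sqrt 0"
      by (rule tendsto_real_sqrt)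
    then have "(\<lambda>m. S ((Suc m)\<^sup>2) \<omega> / real ((Suc m)\<^sup>2)) \<longlonglongrightarrow> 0"
      unfolding T_def real_sqrt_abs real_sqrt_zero by (rule tendsto_rabs_zero_cancel)
    then have "(\<lambda>m. S (m\<^sup>2) \<omega> / real (m\<^sup>2)) \<longlonglongrightarrow> 0"
      by (rule LIMSEQ_imp_Suc)
    moreover have "\<bar>S (Suc n) \<omega> - S n \<omega>\<bar> \<le> c" for n
      using D [OF elim(1), of n] by (simp add: S_def)
    ultimately show ?case
      using tendsto_div_of_squares [of "\<lambda>n. S n \<omega>" c] by (simp add: S_def)
  qed
qed


section \<open>Adaptive Metropolis chains\<close>

lemma measurable_curried:
  assumes "(\<lambda>(s, x). V s x) \<in> borel_measurable (borel \<Otimes>\<^sub>M borel)" "f \<in> N \<rightarrow>\<^sub>M borel" "g \<in> N \<rightarrow>\<^sub>M borel"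
  shows "(\<lambda>x. V (f x) (g x)) \<in> borel_measurable N"
  using measurable_compose [OF measurable_Pair [OF assms(2,3)] assms(1)] by simp

text \<open>Rectangles form an intersection-stable generator containing the whole space, so a finite
  measure is determined by its values on them.\<close>

lemma measure_eqI_triple:
  assumes sets: "sets P = sets (A \<Otimes>\<^sub>M (B \<Otimes>\<^sub>M C))" "sets P' = sets (A \<Otimes>\<^sub>M (B \<Otimes>\<^sub>M C))"
    and fin: "emeasure P (space P) \<noteq> \<infinity>"
    and eq: "\<And>a b c. a \<in> sets A \<Longrightarrow> b \<in> sets B \<Longrightarrow> c \<in> sets C \<Longrightarrow>
      emeasure P (a \<times> (b \<times> c)) = emeasure P' (a \<times> (b \<times> c))"
  shows "P = P'"
proof -
  let ?R = "{b \<times> c | b c. b \<in> sets B \<and> c \<in> sets C}"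
  let ?E = "{a \<times> r | a r. a \<in> sets A \<and> r \<in> ?R}"
  let ?\<Omega> = "space A \<times> (space B \<times> space C)"
  have R: "?R \<subseteq> Pow (space (B \<Otimes>\<^sub>M C))" "sets (B \<Otimes>\<^sub>M C) = sigma_sets (space (B \<Otimes>\<^sub>M C)) ?R"
    using sets.space_closed [of B] sets.space_closed [of C]
    by (auto simp: space_pair_measure sets_pair_measure)
  have "sets (A \<Otimes>\<^sub>M (B \<Otimes>\<^sub>M C)) = sets (sigma (space A \<times> space (B \<Otimes>\<^sub>M C)) ?E)"
  proof (rule sets_pair_eq [where Ca = "{space A}" and Cb = "{space (B \<Otimes>\<^sub>M C)}"])
    show "{space (B \<Otimes>\<^sub>M C)} \<subseteq> ?R"
      unfolding space_pair_measure by blast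
    show "sets A \<subseteq> Pow (space A)"
      by (rule sets.space_closed)
    show "sets A = sigma_sets (space A) (sets A)"
      by (rule sets.sigma_sets_eq [symmetric])
    show "?R \<subseteq> Pow (space (B \<Otimes>\<^sub>M C))"
      by (rule R(1))
    show "sets (B \<Otimes>\<^sub>M C) = sigma_sets (space (B \<Otimes>\<^sub>M C)) ?R"
      by (rule R(2))
  qed simp_all
  moreover have E: "?E \<subseteq> Pow ?\<Omega>"
  proof
    fix x assume "x \<in> ?E"
    then obtain a b c where x: "x = a \<times> (b \<times> c)" and "a \<in> sets A" "b \<in> sets B" "c \<in> sets C"
      by blast
    then have "a \<subseteq> space A" "b \<subseteq> space B" "c \<subseteq> space C"
      by (simp_all add: sets.sets_into_space)
    then show "x \<in> Pow ?\<Omega>"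
      unfolding x Pow_iff by (intro Sigma_mono)
  qed
  ultimately have sets_E: "sets (A \<Otimes>\<^sub>M (B \<Otimes>\<^sub>M C)) = sigma_sets ?\<Omega> ?E"
    by (simp add: space_pair_measure)
  show ?thesis
  proof (rule measure_eqI_generator_eq [where E = ?E and \<Omega> = ?\<Omega> and A = "\<lambda>_. ?\<Omega>"])
    show "Int_stable ?E"
    proof (rule Int_stableI)
      fix x y assume "x \<in> ?E" "y \<in> ?E"
      then obtain a b c a' b' c' where *: "x = a \<times> (b \<times> c)" "y = a' \<times> (b' \<times> c')"
        "a \<in> sets A" "b \<in> sets B" "c \<in> sets C" "a' \<in> sets A" "b' \<in> sets B" "c' \<in> sets C"
        by blast
      then have "x \<inter> y = (a \<inter> a') \<times> ((b \<inter> b') \<times> (c \<inter> c'))"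
        by auto
      with * show "x \<inter> y \<in> ?E"
        by blast
    qed
    show "range (\<lambda>_. ?\<Omega>) \<subseteq> ?E"
      by blast
    have "space P = ?\<Omega>"
      using sets_eq_imp_space_eq [OF sets(1)] by (simp add: space_pair_measure)
    then show "emeasure P ?\<Omega> \<noteq> \<infinity>"
      using fin by simp
    show "sets P = sigma_sets ?\<Omega> ?E" "sets P' = sigma_sets ?\<Omega> ?E"
      using sets sets_E by simp_all
    show "emeasure P x = emeasure P' x" if "x \<in> ?E" for x
      using that eq by blast
  qed (use E in blast)+
qed

abbreviation unif :: "real measure" where
  "unif \<equiv> uniform_measure lborel {0<..<1}"

interpretation unif: prob_space unif
  by (rule prob_space_uniform_measure) auto

lemma measure_unif_lessThan: "0 \<le> a \<Longrightarrow> a \<le> 1 \<Longrightarrow> measure unif {..<a} = a"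
proof -
  assume a: "0 \<le> a" "a \<le> 1"
  then have "{0<..<1} \<inter> {..<a} = {0<..<a}"
    by auto
  then have "emeasure unif {..<a} = ennreal a"
    using a by (simp add: divide_ennreal_def)
  then show ?thesis
    using a by (simp add: measure_def del: emeasure_uniform_measure)
qed

text \<open>\<open>draws\<close> states the conditional law in integrated form over events of the
  past, which is what a comparison of joint laws on rectangles needs. Membership
  \<open>\<sigma>_mem\<close> is required at every point, so that bounds on kernels apply without
  null sets.\<close>

locale adaptive_metropolis = metropolis_family target q \<S> B R q0 + prob_space M + filtration "space M" F
  for target :: "real^'d \<Rightarrow> real" and q :: "'s::metric_space \<Rightarrow> real^'d \<Rightarrow> real"
    and \<S> :: "'s set" and B R q0 :: real and M :: "'w measure" and F :: "nat \<Rightarrow> 'w measure" +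
  fixes \<theta> \<theta>' :: "nat \<Rightarrow> 'w \<Rightarrow> real^'d" and U :: "nat \<Rightarrow> 'w \<Rightarrow> real" and \<sigma> :: "nat \<Rightarrow> 'w \<Rightarrow> 's"
  assumes subalg: "\<And>k. subalgebra M (F k)"
    and \<theta>_adapted: "\<And>k. \<theta> k \<in> borel_measurable (F k)"
    and \<sigma>_adapted: "\<And>k. \<sigma> k \<in> borel_measurable (F k)"
    and \<theta>'_measurable [measurable]: "\<And>k. \<theta>' (Suc k) \<in> borel_measurable M"
    and U_measurable [measurable]: "\<And>k. U (Suc k) \<in> borel_measurable M"
    and \<sigma>_mem: "\<And>k \<omega>. \<omega> \<in> space M \<Longrightarrow> \<sigma> k \<omega> \<in> \<S>"
    and start: "AE \<omega> in M. target (\<theta> 0 \<omega>) \<noteq> 0"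
    and draws: "\<And>k A X Y. A \<in> sets (F k) \<Longrightarrow> X \<in> sets borel \<Longrightarrow> Y \<in> sets borel \<Longrightarrow>
      emeasure M {\<omega> \<in> A. \<theta>' (Suc k) \<omega> \<in> X \<and> U (Suc k) \<omega> \<in> Y}
      = (\<integral>\<^sup>+ \<omega>. indicator A \<omega> * ((\<integral>\<^sup>+ y. indicator X y * ennreal (q (\<sigma> k \<omega>) (y - \<theta> k \<omega>)) \<partial>lborel)
          * emeasure unif Y) \<partial>M)"
    and move: "\<And>k. AE \<omega> in M. \<theta> (Suc k) \<omega> =
      (if U (Suc k) \<omega> < accept_prob target (\<theta> k \<omega>) (\<theta>' (Suc k) \<omega>) then \<theta>' (Suc k) \<omega> else \<theta> k \<omega>)"
begin

section \<open>The joint law of past, proposal and uniform variable\<close>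

lemma measurable_F_imp_M: "f \<in> F k \<rightarrow>\<^sub>M N \<Longrightarrow> f \<in> M \<rightarrow>\<^sub>M N"
  by (rule measurable_from_subalg [OF subalg])

lemma measurable_F_mono: "i \<le> j \<Longrightarrow> f \<in> F i \<rightarrow>\<^sub>M N \<Longrightarrow> f \<in> F j \<rightarrow>\<^sub>M N"
  using measurable_from_subalg [of "F j" "F i"] sets_F_mono [of i j]
  by (simp add: subalgebra_def space_F)

lemma \<theta>_measurable: "\<theta> k \<in> borel_measurable M"
  and \<sigma>_measurable: "\<sigma> k \<in> borel_measurable M"
  by (rule measurable_F_imp_M, rule \<theta>_adapted, rule measurable_F_imp_M, rule \<sigma>_adapted)

text \<open>Allows the sample point itself, seen through \<open>F k\<close>, to serve as the
  coordinate that carries the whole past.\<close>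

lemma measurable_ident_subalg: "(\<lambda>\<omega>. \<omega>) \<in> M \<rightarrow>\<^sub>M restr_to_subalg M (F k)"
proof (rule measurableI)
  fix A assume "A \<in> sets (restr_to_subalg M (F k))"
  then have "A \<in> sets M"
    using subalg [of k] by (auto simp: sets_restr_to_subalg [OF subalg] subalgebra_def)
  then show "(\<lambda>\<omega>. \<omega>) -` A \<inter> space M \<in> sets M"
    by auto
qed (simp add: space_restr_to_subalg)

text \<open>A proposal of target value 0 has acceptance probability 0, and the strict comparison
  with the almost surely positive uniform variable rejects it.\<close>

lemma support_invariant: "AE \<omega> in M. target (\<theta> k \<omega>) \<noteq> 0"
proof (induction k)
  case (Suc k)
  have "emeasure unif {..0} = 0"
  proof -
    have "{0<..<1} \<inter> {..0} = ({} :: real set)"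
      by auto
    then show ?thesis
      by simp
  qed
  then have "emeasure M {\<omega> \<in> space M. \<theta>' (Suc k) \<omega> \<in> UNIV \<and> U (Suc k) \<omega> \<in> {..0}} = 0"
    using sets.top [of "F k"] space_F [of k] by (subst draws) auto
  then have "AE \<omega> in M. 0 < U (Suc k) \<omega>"
    by (subst AE_iff_measurable [OF _ refl]) (auto simp: not_less)
  with Suc move [of k] show ?case
  proof eventually_elim
    case (elim \<omega>)
    then show ?case
      by (cases "target (\<theta>' (Suc k) \<omega>) = 0") (auto simp: accept_prob_def split: if_splits)
  qed
qed (rule start)

text \<open>Conditional independence in the form of a product density: given the past, the proposal
  has density \<open>q\<close> around the current state and the uniform variable is independent of
  it. On rectangles this is \<open>draws\<close> combined with iterated integration.\<close>

lemma joint_law: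
  "distr M (restr_to_subalg M (F k) \<Otimes>\<^sub>M (borel \<Otimes>\<^sub>M borel)) (\<lambda>\<omega>. (\<omega>, \<theta>' (Suc k) \<omega>, U (Suc k) \<omega>))
   = density (restr_to_subalg M (F k) \<Otimes>\<^sub>M (lborel \<Otimes>\<^sub>M unif)) (\<lambda>(\<omega>, y, u). ennreal (q (\<sigma> k \<omega>) (y - \<theta> k \<omega>)))"
proof -
  define Fr where "Fr = restr_to_subalg M (F k)"
  have space_Fr: "space Fr = space M" and sets_Fr: "sets Fr = sets (F k)"
    by (simp_all add: Fr_def space_restr_to_subalg sets_restr_to_subalg [OF subalg])
  have [measurable]: "\<theta> k \<in> borel_measurable Fr" "\<sigma> k \<in> borel_measurable Fr"
    by (auto simp: Fr_def intro!: measurable_in_subalg subalg \<theta>_adapted \<sigma>_adapted)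
  have tuple: "(\<lambda>\<omega>. (\<omega>, \<theta>' (Suc k) \<omega>, U (Suc k) \<omega>)) \<in> M \<rightarrow>\<^sub>M Fr \<Otimes>\<^sub>M (borel \<Otimes>\<^sub>M borel)"
    by (intro measurable_Pair measurable_ident_subalg [where k = k, folded Fr_def] \<theta>'_measurable U_measurable)
  interpret YU: pair_sigma_finite lborel unif ..
  have sf: "sigma_finite_measure (lborel \<Otimes>\<^sub>M unif)"
    by unfold_locales
  show ?thesis
    unfolding Fr_def [symmetric]
  proof (rule measure_eqI_triple [where A = Fr and B = borel and C = borel])
    show "sets (density (Fr \<Otimes>\<^sub>M (lborel \<Otimes>\<^sub>M unif)) (\<lambda>(\<omega>, y, u). ennreal (q (\<sigma> k \<omega>) (y - \<theta> k \<omega>))))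
        = sets (Fr \<Otimes>\<^sub>M (borel \<Otimes>\<^sub>M borel))"
      unfolding sets_density by (intro sets_pair_measure_cong) auto
    show "emeasure (distr M (Fr \<Otimes>\<^sub>M (borel \<Otimes>\<^sub>M borel)) (\<lambda>\<omega>. (\<omega>, \<theta>' (Suc k) \<omega>, U (Suc k) \<omega>)))
        (space (distr M (Fr \<Otimes>\<^sub>M (borel \<Otimes>\<^sub>M borel)) (\<lambda>\<omega>. (\<omega>, \<theta>' (Suc k) \<omega>, U (Suc k) \<omega>)))) \<noteq> \<infinity>"
      by (subst emeasure_distr [OF tuple]) auto
    fix A X Y assume A: "A \<in> sets Fr" and X [measurable]: "X \<in> sets (borel :: (real^'d) measure)"
      and Y [measurable]: "Y \<in> sets (borel :: real measure)"
    have AF: "A \<in> sets (F k)"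
      using A by (simp add: sets_Fr)
    have [measurable]: "A \<in> sets Fr" "A \<times> (X \<times> Y) \<in> sets (Fr \<Otimes>\<^sub>M (lborel \<Otimes>\<^sub>M unif))"
      using A by (auto intro!: pair_measureI)
    have "emeasure (distr M (Fr \<Otimes>\<^sub>M (borel \<Otimes>\<^sub>M borel)) (\<lambda>\<omega>. (\<omega>, \<theta>' (Suc k) \<omega>, U (Suc k) \<omega>))) (A \<times> (X \<times> Y))
        = emeasure M {\<omega> \<in> A. \<theta>' (Suc k) \<omega> \<in> X \<and> U (Suc k) \<omega> \<in> Y}"
    proof (subst emeasure_distr [OF tuple])
      have "A \<subseteq> space M"
        using sets.sets_into_space [OF A] by (simp add: space_Fr)
      then show "emeasure M ((\<lambda>\<omega>. (\<omega>, \<theta>' (Suc k) \<omega>, U (Suc k) \<omega>)) -` (A \<times> (X \<times> Y)) \<inter> space M)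
          = emeasure M {\<omega> \<in> A. \<theta>' (Suc k) \<omega> \<in> X \<and> U (Suc k) \<omega> \<in> Y}"
        by (intro arg_cong [where f = "emeasure M"]) auto
    qed auto
    also have "\<dots> = (\<integral>\<^sup>+ \<omega>. indicator A \<omega> * ((\<integral>\<^sup>+ y. indicator X y * ennreal (q (\<sigma> k \<omega>) (y - \<theta> k \<omega>)) \<partial>lborel)
          * emeasure unif Y) \<partial>M)"
      by (rule draws [OF AF X Y])
    also have "\<dots> = (\<integral>\<^sup>+ \<omega>. indicator A \<omega> * ((\<integral>\<^sup>+ y. indicator X y * ennreal (q (\<sigma> k \<omega>) (y - \<theta> k \<omega>)) \<partial>lborel)
          * emeasure unif Y) \<partial>Fr)"
      unfolding Fr_def
      by (rule nn_integral_subalgebra2 [OF subalg measurable_in_subalg' [OF subalg], symmetric])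
        (unfold Fr_def [symmetric], measurable)
    also have "\<dots> = (\<integral>\<^sup>+ \<omega>. \<integral>\<^sup>+ y. \<integral>\<^sup>+ u. ennreal (q (\<sigma> k \<omega>) (y - \<theta> k \<omega>))
          * indicator (A \<times> (X \<times> Y)) (\<omega>, y, u) \<partial>unif \<partial>lborel \<partial>Fr)"
    proof (intro nn_integral_cong)
      fix \<omega>
      have "(\<integral>\<^sup>+ u. ennreal (q (\<sigma> k \<omega>) (y - \<theta> k \<omega>)) * indicator (A \<times> (X \<times> Y)) (\<omega>, y, u) \<partial>unif)
          = indicator A \<omega> * emeasure unif Y * (indicator X y * ennreal (q (\<sigma> k \<omega>) (y - \<theta> k \<omega>)))" for y
      proof -
        have "(\<integral>\<^sup>+ u. ennreal (q (\<sigma> k \<omega>) (y - \<theta> k \<omega>)) * indicator (A \<times> (X \<times> Y)) (\<omega>, y, u) \<partial>unif)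
            = (\<integral>\<^sup>+ u. (indicator A \<omega> * (indicator X y * ennreal (q (\<sigma> k \<omega>) (y - \<theta> k \<omega>)))) * indicator Y u \<partial>unif)"
          by (intro nn_integral_cong) (auto simp: indicator_def)
        also have "\<dots> = (indicator A \<omega> * (indicator X y * ennreal (q (\<sigma> k \<omega>) (y - \<theta> k \<omega>)))) * emeasure unif Y"
          by (rule nn_integral_cmult_indicator) simp
        finally show ?thesis
          by (simp add: mult_ac)
      qed
      then show "indicator A \<omega> * ((\<integral>\<^sup>+ y. indicator X y * ennreal (q (\<sigma> k \<omega>) (y - \<theta> k \<omega>)) \<partial>lborel) * emeasure unif Y)
          = (\<integral>\<^sup>+ y. \<integral>\<^sup>+ u. ennreal (q (\<sigma> k \<omega>) (y - \<theta> k \<omega>)) * indicator (A \<times> (X \<times> Y)) (\<omega>, y, u) \<partial>unif \<partial>lborel)"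
        by (simp only:) (subst nn_integral_cmult, auto simp: mult_ac)
    qed
    also have "\<dots> = (\<integral>\<^sup>+ \<omega>. \<integral>\<^sup>+ p. (case p of (y, u) \<Rightarrow> ennreal (q (\<sigma> k \<omega>) (y - \<theta> k \<omega>))
          * indicator (A \<times> (X \<times> Y)) (\<omega>, y, u)) \<partial>(lborel \<Otimes>\<^sub>M unif) \<partial>Fr)"
    proof (intro nn_integral_cong)
      fix \<omega> assume "\<omega> \<in> space Fr"
      then have [measurable]: "(\<lambda>p. (\<omega>, p)) \<in> lborel \<Otimes>\<^sub>M unif \<rightarrow>\<^sub>M Fr \<Otimes>\<^sub>M (lborel \<Otimes>\<^sub>M unif)"
        by (rule measurable_Pair1')
      have [measurable]: "(\<lambda>p. indicator (A \<times> (X \<times> Y)) (\<omega>, p) :: ennreal) \<in> borel_measurable (lborel \<Otimes>\<^sub>M unif)"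
        by measurable
      show "(\<integral>\<^sup>+ y. \<integral>\<^sup>+ u. ennreal (q (\<sigma> k \<omega>) (y - \<theta> k \<omega>)) * indicator (A \<times> (X \<times> Y)) (\<omega>, y, u) \<partial>unif \<partial>lborel)
          = (\<integral>\<^sup>+ p. (case p of (y, u) \<Rightarrow> ennreal (q (\<sigma> k \<omega>) (y - \<theta> k \<omega>))
          * indicator (A \<times> (X \<times> Y)) (\<omega>, y, u)) \<partial>(lborel \<Otimes>\<^sub>M unif))"
        by (subst unif.nn_integral_fst [symmetric]) (auto simp: case_prod_unfold)
    qed
    also have "\<dots> = (\<integral>\<^sup>+ w. (case w of (\<omega>, y, u) \<Rightarrow> ennreal (q (\<sigma> k \<omega>) (y - \<theta> k \<omega>)))
          * indicator (A \<times> (X \<times> Y)) w \<partial>(Fr \<Otimes>\<^sub>M (lborel \<Otimes>\<^sub>M unif)))"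
      by (subst sigma_finite_measure.nn_integral_fst [OF sf, symmetric]) (auto simp: case_prod_unfold)
    also have "\<dots> = emeasure (density (Fr \<Otimes>\<^sub>M (lborel \<Otimes>\<^sub>M unif))
        (\<lambda>(\<omega>, y, u). ennreal (q (\<sigma> k \<omega>) (y - \<theta> k \<omega>)))) (A \<times> (X \<times> Y))"
      by (subst emeasure_density) auto
    finally show "emeasure (distr M (Fr \<Otimes>\<^sub>M (borel \<Otimes>\<^sub>M borel)) (\<lambda>\<omega>. (\<omega>, \<theta>' (Suc k) \<omega>, U (Suc k) \<omega>))) (A \<times> (X \<times> Y))
        = emeasure (density (Fr \<Otimes>\<^sub>M (lborel \<Otimes>\<^sub>M unif))
        (\<lambda>(\<omega>, y, u). ennreal (q (\<sigma> k \<omega>) (y - \<theta> k \<omega>)))) (A \<times> (X \<times> Y))" .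
  qed simp
qed

text \<open>Integrating the uniform variable first replaces the acceptance event by its probability;
  the remaining constant term is \<open>h x\<close>, because the proposal density has mass
  1.\<close>

lemma expectation_acceptance:
  assumes s: "s \<in> \<S>" and x: "target x \<noteq> 0" and h [measurable]: "h \<in> borel_measurable borel"
    and b: "\<And>y. \<bar>h y\<bar> \<le> c"
  shows "(\<integral>y. (\<integral>u. q s (y - x) * h (if u < accept_prob target x y then y else x) \<partial>unif) \<partial>lborel) = step s h x"
proof -
  have inner: "(\<integral>u. q s (y - x) * h (if u < accept_prob target x y then y else x) \<partial>unif)
      = q s (y - x) * h x + rate s x y * (h y - h x)" for y
  proof -
    let ?a = "accept_prob target x y"
    have "(\<integral>u. q s (y - x) * h (if u < ?a then y else x) \<partial>unif)
        = (\<integral>u. q s (y - x) * h x + (q s (y - x) * (h y - h x)) * indicator {..<?a} u \<partial>unif)"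
      by (intro Bochner_Integration.integral_cong) (auto simp: algebra_simps)
    also have "\<dots> = q s (y - x) * h x + (q s (y - x) * (h y - h x)) * ?a"
    proof -
      have "integrable unif (indicator {..<?a} :: real \<Rightarrow> real)"
        by (rule integrable_real_indicator)
          (auto simp: less_top [symmetric] unif.emeasure_finite simp del: emeasure_uniform_measure)
      moreover have "(\<integral>u. indicator {..<?a} u \<partial>unif) = ?a"
        using measure_unif_lessThan [OF accept_prob_nonneg accept_prob_le_1, of x y]
        by (simp del: measure_uniform_measure)
      moreover have "measure unif UNIV = 1"
        using unif.prob_space by (metis space_borel space_lborel space_uniform_measure)
      ultimately show ?thesis
        by (subst Bochner_Integration.integral_add) (auto simp del: measure_uniform_measure)
    qed
    finally show ?thesis
      by (simp add: rate_def mult_ac)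
  qed
  have iq: "integrable lborel (\<lambda>y. q s (y - x))"
    by (rule integrableI_nonneg) (auto simp: q_nonneg s nn_integral_q_shift)
  have q1: "(\<integral>y. q s (y - x) \<partial>lborel) = 1"
    by (subst integral_eq_nn_integral) (auto simp: q_nonneg s nn_integral_q_shift)
  have "\<bar>h y - h x\<bar> \<le> 2 * c" for y
    using b [of x] b [of y] by linarith
  then have ir: "integrable lborel (\<lambda>y. rate s x y * (h y - h x))"
    by (intro integrable_rate_times [OF s]) auto
  show ?thesis
    unfolding inner using x iq ir by (simp add: step_def q1)
qed

text \<open>The Markov property of one adaptive move, tested against bounded variables
  \<open>Z\<close> of the past. The parameter of \<open>V\<close> is the one used in the move, hence
  also known from the past.\<close>

lemma expectation_one_step:
  assumes Z: "Z \<in> borel_measurable (F k)" and Zb: "\<And>\<omega>. \<omega> \<in> space M \<Longrightarrow> \<bar>Z \<omega>\<bar> \<le> z"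
    and V: "(\<lambda>(s, x). V s x) \<in> borel_measurable (borel \<Otimes>\<^sub>M borel)"
    and Vb: "\<And>s x. s \<in> \<S> \<Longrightarrow> \<bar>V s x\<bar> \<le> c"
  shows "expectation (\<lambda>\<omega>. Z \<omega> * V (\<sigma> k \<omega>) (\<theta> (Suc k) \<omega>))
    = expectation (\<lambda>\<omega>. Z \<omega> * step (\<sigma> k \<omega>) (V (\<sigma> k \<omega>)) (\<theta> k \<omega>))"
proof -
  define Fr where "Fr = restr_to_subalg M (F k)"
  have space_Fr: "space Fr = space M" and sets_Fr: "sets Fr = sets (F k)"
    by (simp_all add: Fr_def space_restr_to_subalg sets_restr_to_subalg [OF subalg])
  note [measurable (raw)] = measurable_curried [OF V]
  have meas: "(\<lambda>\<omega>. Z \<omega> * V (\<sigma> k \<omega>) (\<theta> (Suc k) \<omega>)) \<in> borel_measurable M"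
  proof -
    note [measurable] = \<theta>_measurable \<sigma>_measurable measurable_F_imp_M [OF Z]
    show ?thesis by measurable
  qed
  have [measurable]: "\<theta> k \<in> borel_measurable Fr" "\<sigma> k \<in> borel_measurable Fr" "Z \<in> borel_measurable Fr"
    by (auto simp: Fr_def intro!: measurable_in_subalg subalg \<theta>_adapted \<sigma>_adapted Z)
  have [measurable_cong]: "sets unif = sets borel"
    by simp
  interpret Fp: prob_space Fr
    unfolding Fr_def by (rule prob_space_restr_to_subalg [OF subalg prob_space_axioms])
  interpret YU: pair_sigma_finite lborel unif ..
  interpret P: sigma_finite_measure "lborel \<Otimes>\<^sub>M unif"
    by unfold_locales
  interpret FP: pair_sigma_finite Fr "lborel \<Otimes>\<^sub>M unif" ..
  \<comment> \<open>The integrand as a function of past, proposal and uniform variable; the past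
    enters only through functions measurable for \<open>F k\<close>.\<close>
  define g where "g = (\<lambda>(\<omega>, y, u). Z \<omega> * V (\<sigma> k \<omega>)
      (if u < accept_prob target (\<theta> k \<omega>) y then y else \<theta> k \<omega>))"
  have g [measurable]: "g \<in> borel_measurable (Fr \<Otimes>\<^sub>M (lborel \<Otimes>\<^sub>M unif))"
    unfolding g_def by measurable
  have g' [measurable]: "g \<in> borel_measurable (Fr \<Otimes>\<^sub>M (borel \<Otimes>\<^sub>M borel))"
    unfolding g_def by measurable
  let ?w = "\<lambda>(\<omega>, y, u). q (\<sigma> k \<omega>) (y - \<theta> k \<omega>)"
  let ?X = "\<lambda>\<omega>. (\<omega>, \<theta>' (Suc k) \<omega>, U (Suc k) \<omega>)"
  let ?D = "distr M (Fr \<Otimes>\<^sub>M (borel \<Otimes>\<^sub>M borel)) ?X"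
  have w: "?w \<in> borel_measurable (Fr \<Otimes>\<^sub>M (lborel \<Otimes>\<^sub>M unif))" "AE p in (Fr \<Otimes>\<^sub>M (lborel \<Otimes>\<^sub>M unif)). 0 \<le> ?w p"
    by (measurable, rule AE_I2) (auto simp: space_pair_measure space_Fr intro!: q_nonneg \<sigma>_mem)
  have D: "?D = density (Fr \<Otimes>\<^sub>M (lborel \<Otimes>\<^sub>M unif)) (\<lambda>p. ennreal (?w p))"
    by (simp add: Fr_def joint_law case_prod_unfold)
  have X: "?X \<in> M \<rightarrow>\<^sub>M Fr \<Otimes>\<^sub>M (borel \<Otimes>\<^sub>M borel)"
    by (intro measurable_Pair measurable_ident_subalg [where k = k, folded Fr_def] \<theta>'_measurable U_measurable)
  have gb: "\<bar>g (?X \<omega>)\<bar> \<le> z * c" if "\<omega> \<in> space M" for \<omega>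
    using Zb [OF that] Vb [OF \<sigma>_mem [OF that, of k]] unfolding g_def
    by (auto simp: abs_mult intro!: mult_mono intro: order_trans [OF abs_ge_zero])
  have "integrable M (\<lambda>\<omega>. g (?X \<omega>))"
    by (rule integrable_const_bound [of _ "z * c"])
      (auto intro!: AE_I2 gb measurable_compose [OF X g'])
  then have "integrable ?D g"
    by (subst integrable_distr_eq [OF X g'])
  then have int: "integrable (Fr \<Otimes>\<^sub>M (lborel \<Otimes>\<^sub>M unif)) (\<lambda>p. ?w p * g p)"
    unfolding D by (subst (asm) integrable_density [OF g w]) (simp add: mult.commute)
  have "expectation (\<lambda>\<omega>. Z \<omega> * V (\<sigma> k \<omega>) (\<theta> (Suc k) \<omega>)) = expectation (\<lambda>\<omega>. g (?X \<omega>))"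
    using move [of k] by (intro integral_cong_AE meas measurable_compose [OF X g']) (auto simp: g_def)
  also have "\<dots> = (\<integral>p. g p \<partial>?D)"
    by (rule integral_distr [OF X g', symmetric])
  also have "\<dots> = (\<integral>p. ?w p * g p \<partial>(Fr \<Otimes>\<^sub>M (lborel \<Otimes>\<^sub>M unif)))"
    unfolding D by (subst integral_density [OF g w]) simp
  also have "\<dots> = (\<integral>\<omega>. (\<integral>r. ?w (\<omega>, r) * g (\<omega>, r) \<partial>(lborel \<Otimes>\<^sub>M unif)) \<partial>Fr)"
    by (rule FP.integral_fst' [OF int, symmetric])
  also have "\<dots> = (\<integral>\<omega>. Z \<omega> * step (\<sigma> k \<omega>) (V (\<sigma> k \<omega>)) (\<theta> k \<omega>) \<partial>Fr)"
  \<comment> \<open>The kernel identity is applied on the support and the inner Fubini step holds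
    for almost every past, hence an almost sure comparison.\<close>
  proof (rule integral_cong_AE)
    have "AE \<omega> in Fr. target (\<theta> k \<omega>) \<noteq> 0"
      unfolding Fr_def
    proof (rule AE_restr_to_subalg2 [OF subalg support_invariant])
      note [measurable] = \<theta>_adapted [of k]
      show "Measurable.pred (F k) (\<lambda>\<omega>. target (\<theta> k \<omega>) \<noteq> 0)"
        by measurable
    qed
    moreover have "AE \<omega> in Fr. integrable (lborel \<Otimes>\<^sub>M unif) (\<lambda>r. ?w (\<omega>, r) * g (\<omega>, r))"
      by (rule FP.AE_integrable_fst' [OF int])
    ultimately show "AE \<omega> in Fr. (\<integral>r. ?w (\<omega>, r) * g (\<omega>, r) \<partial>(lborel \<Otimes>\<^sub>M unif))
        = Z \<omega> * step (\<sigma> k \<omega>) (V (\<sigma> k \<omega>)) (\<theta> k \<omega>)"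
      using AE_space
    proof eventually_elim
      case (elim \<omega>)
      have s: "\<sigma> k \<omega> \<in> \<S>"
        using elim(3) by (auto simp: space_Fr intro: \<sigma>_mem)
      have "(\<integral>r. ?w (\<omega>, r) * g (\<omega>, r) \<partial>(lborel \<Otimes>\<^sub>M unif))
          = (\<integral>y. \<integral>u. ?w (\<omega>, y, u) * g (\<omega>, y, u) \<partial>unif \<partial>lborel)"
        by (rule YU.integral_fst' [OF elim(2), symmetric])
      also have "\<dots> = (\<integral>y. \<integral>u. Z \<omega> * (q (\<sigma> k \<omega>) (y - \<theta> k \<omega>) *
          V (\<sigma> k \<omega>) (if u < accept_prob target (\<theta> k \<omega>) y then y else \<theta> k \<omega>)) \<partial>unif \<partial>lborel)"
        by (simp add: g_def mult_ac)
      also have "\<dots> = Z \<omega> * (\<integral>y. \<integral>u. q (\<sigma> k \<omega>) (y - \<theta> k \<omega>) *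
          V (\<sigma> k \<omega>) (if u < accept_prob target (\<theta> k \<omega>) y then y else \<theta> k \<omega>) \<partial>unif \<partial>lborel)"
        by simp
      also have "\<dots> = Z \<omega> * step (\<sigma> k \<omega>) (V (\<sigma> k \<omega>)) (\<theta> k \<omega>)"
        by (subst expectation_acceptance [OF s elim(1) _ Vb [OF s]]) auto
      finally show ?case .
    qed
    show "(\<lambda>\<omega>. Z \<omega> * step (\<sigma> k \<omega>) (V (\<sigma> k \<omega>)) (\<theta> k \<omega>)) \<in> borel_measurable Fr"
      by measurable
  qed (rule borel_measurable_integrable [OF FP.integrable_fst' [OF int]])
  also have "\<dots> = expectation (\<lambda>\<omega>. Z \<omega> * step (\<sigma> k \<omega>) (V (\<sigma> k \<omega>)) (\<theta> k \<omega>))"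
    unfolding Fr_def
    by (rule integral_subalgebra2 [OF subalg measurable_in_subalg' [OF subalg]])
      (unfold Fr_def [symmetric], measurable)
  finally show ?thesis .
qed

text \<open>For \<open>i < j\<close> the earlier difference is measurable for \<open>F j\<close>, so
  it can be the test variable in \<open>expectation_one_step\<close>, which makes the two
  differences orthogonal.\<close>

lemma martingale_differences_negligible:
  assumes V: "(\<lambda>(s, x). V s x) \<in> borel_measurable (borel \<Otimes>\<^sub>M borel)"
    and Vb: "\<And>s x. s \<in> \<S> \<Longrightarrow> \<bar>V s x\<bar> \<le> c"
  shows "AE \<omega> in M. (\<lambda>n. (\<Sum>k<n. V (\<sigma> k \<omega>) (\<theta> (Suc k) \<omega>) - step (\<sigma> k \<omega>) (V (\<sigma> k \<omega>)) (\<theta> k \<omega>))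
    / real n) \<longlonglongrightarrow> 0"
proof -
  note [measurable (raw)] = measurable_curried [OF V]
  define D where "D k \<omega> = V (\<sigma> k \<omega>) (\<theta> (Suc k) \<omega>) - step (\<sigma> k \<omega>) (V (\<sigma> k \<omega>)) (\<theta> k \<omega>)" for k \<omega>
  have D_F: "D k \<in> borel_measurable (F (Suc k))" for k
  proof -
    note [measurable] = measurable_F_mono [OF le_SucI [OF order_refl] \<theta>_adapted [of k]]
      measurable_F_mono [OF le_SucI [OF order_refl] \<sigma>_adapted [of k]] \<theta>_adapted [of "Suc k"]
    show ?thesis
      unfolding D_def by measurable
  qed
  have Db: "\<bar>D k \<omega>\<bar> \<le> 2 * c" if "\<omega> \<in> space M" for k \<omega>
  proof -
    note s = \<sigma>_mem [OF that, of k]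
    have "\<bar>step (\<sigma> k \<omega>) (V (\<sigma> k \<omega>)) (\<theta> k \<omega>)\<bar> \<le> c"
      by (rule step_bound [OF s _ Vb [OF s]]) measurable
    then show ?thesis
      using Vb [OF s, of "\<theta> (Suc k) \<omega>"] unfolding D_def by linarith
  qed
  have meas: "(\<lambda>\<omega>. V (\<sigma> j \<omega>) (\<theta> (Suc j) \<omega>)) \<in> borel_measurable M"
    "(\<lambda>\<omega>. step (\<sigma> j \<omega>) (V (\<sigma> j \<omega>)) (\<theta> j \<omega>)) \<in> borel_measurable M" for j
  proof -
    note [measurable] = \<theta>_measurable \<sigma>_measurable
    show "(\<lambda>\<omega>. V (\<sigma> j \<omega>) (\<theta> (Suc j) \<omega>)) \<in> borel_measurable M"
      "(\<lambda>\<omega>. step (\<sigma> j \<omega>) (V (\<sigma> j \<omega>)) (\<theta> j \<omega>)) \<in> borel_measurable M"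
      by measurable
  qed
  have "AE \<omega> in M. (\<lambda>n. (\<Sum>k<n. D k \<omega>) / real n) \<longlonglongrightarrow> 0"
  proof (rule bounded_uncorrelated_slln [OF _ Db])
    show "D k \<in> borel_measurable M" for k
      by (rule measurable_F_imp_M [OF D_F])
    fix i j :: nat assume "i < j"
    then have Z: "D i \<in> borel_measurable (F j)"
      by (intro measurable_F_mono [OF _ D_F]) simp
    have int: "integrable M (\<lambda>\<omega>. D i \<omega> * X \<omega>)"
      if X: "X \<in> borel_measurable M" and b: "\<And>\<omega>. \<omega> \<in> space M \<Longrightarrow> \<bar>X \<omega>\<bar> \<le> c" for X
    proof (rule integrable_const_bound [of _ "2 * c * c"])
      show "AE \<omega> in M. norm (D i \<omega> * X \<omega>) \<le> 2 * c * c"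
      proof (rule AE_I2)
        fix \<omega> assume \<omega>: "\<omega> \<in> space M"
        have "\<bar>D i \<omega>\<bar> * \<bar>X \<omega>\<bar> \<le> (2 * c) * c"
          using Db [OF \<omega>, of i] b [OF \<omega>] by (intro mult_mono) auto
        then show "norm (D i \<omega> * X \<omega>) \<le> 2 * c * c"
          by (simp add: abs_mult)
      qed
      show "(\<lambda>\<omega>. D i \<omega> * X \<omega>) \<in> borel_measurable M"
        by (intro borel_measurable_times X measurable_F_imp_M [OF D_F])
    qed
    have "expectation (\<lambda>\<omega>. D i \<omega> * D j \<omega>)
        = expectation (\<lambda>\<omega>. D i \<omega> * V (\<sigma> j \<omega>) (\<theta> (Suc j) \<omega>)
            - D i \<omega> * step (\<sigma> j \<omega>) (V (\<sigma> j \<omega>)) (\<theta> j \<omega>))"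
      by (simp add: D_def [of j] right_diff_distrib)
    also have "\<dots> = expectation (\<lambda>\<omega>. D i \<omega> * V (\<sigma> j \<omega>) (\<theta> (Suc j) \<omega>))
        - expectation (\<lambda>\<omega>. D i \<omega> * step (\<sigma> j \<omega>) (V (\<sigma> j \<omega>)) (\<theta> j \<omega>))"
    proof (intro Bochner_Integration.integral_diff int meas)
      fix \<omega> assume \<omega>: "\<omega> \<in> space M"
      note s = \<sigma>_mem [OF \<omega>, of j]
      show "\<bar>V (\<sigma> j \<omega>) (\<theta> (Suc j) \<omega>)\<bar> \<le> c"
        by (rule Vb [OF s])
      show "\<bar>step (\<sigma> j \<omega>) (V (\<sigma> j \<omega>)) (\<theta> j \<omega>)\<bar> \<le> c"
        by (rule step_bound [OF s _ Vb [OF s]]) measurable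
    qed
    also have "\<dots> = 0"
      using expectation_one_step [OF Z Db V Vb] by simp
    finally show "expectation (\<lambda>\<omega>. D i \<omega> * D j \<omega>) = 0" .
  qed
  then show ?thesis
    by (simp add: D_def)
qed

text \<open>Pathwise: with \<open>V s = neumann f N s\<close>, the sum of \<open>f (\<theta> k)\<close> splits into the remainders
  \<open>(step s ^^ N) f\<close>, a telescoping sum, the variation of \<open>V\<close> in its parameter, and martingale
  differences.\<close>

lemma centred_average_tendsto_0:
  assumes f [measurable]: "f \<in> borel_measurable borel" and fb: "\<And>x. \<bar>f x\<bar> \<le> c"
    and mean: "(\<integral>x. f x * target x \<partial>lborel) = 0"
    and \<omega>: "\<omega> \<in> space M"
    and drift: "(\<lambda>n. (\<Sum>k<n. dist (\<sigma> k \<omega>) (\<sigma> (Suc k) \<omega>)) / real n) \<longlonglongrightarrow> 0"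
    and mart: "\<And>N. (\<lambda>n. (\<Sum>k<n. neumann f N (\<sigma> k \<omega>) (\<theta> (Suc k) \<omega>)
        - step (\<sigma> k \<omega>) (neumann f N (\<sigma> k \<omega>)) (\<theta> k \<omega>)) / real n) \<longlonglongrightarrow> 0"
  shows "(\<lambda>n. (\<Sum>k<n. f (\<theta> k \<omega>)) / real n) \<longlonglongrightarrow> 0"
proof (rule LIMSEQ_I)
  fix e :: real assume e: "0 < e"
  have c: "0 \<le> c"
    using fb [of 0] by linarith
  note s = \<sigma>_mem [OF \<omega>]
  have "(\<lambda>N. (1 - eps) ^ N * c) \<longlonglongrightarrow> 0 * c"
    using eps_pos eps_le_1 [OF s [of 0]] by (intro tendsto_mult LIMSEQ_realpow_zero tendsto_const) auto
  then have "\<forall>\<^sub>F N in sequentially. (1 - eps) ^ N * c < e / 3"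
    using e by (intro order_tendstoD(2)) auto
  \<comment> \<open>\<open>N\<close> is fixed before \<open>K\<close>, which depends on it. The
    margin is split into thirds: remainder of the series, additive error of the variation, and the
    terms that vanish as n grows.\<close>
  then obtain N where N: "(1 - eps) ^ N * c < e / 3"
    unfolding eventually_sequentially by blast
  define W where "W k j = neumann f N (\<sigma> k \<omega>) (\<theta> j \<omega>)" for k j
  define D where "D k = W k (Suc k) - step (\<sigma> k \<omega>) (neumann f N (\<sigma> k \<omega>)) (\<theta> k \<omega>)" for k
  define C where "C = real N * c"
  have W: "\<bar>W k j\<bar> \<le> C" for k j
    unfolding W_def C_def by (rule neumann_bound [OF s f fb])
  have "0 < e / 3"
    using e by simp
  from neumann_lipschitz_up_to [OF f fb this, of N] obtain K where K: "0 \<le> K"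
    and lip: "\<And>s s' x. s \<in> \<S> \<Longrightarrow> s' \<in> \<S> \<Longrightarrow> \<bar>neumann f N s x - neumann f N s' x\<bar> \<le> e / 3 + K * dist s s'"
    by blast
  define d where "d k = dist (\<sigma> k \<omega>) (\<sigma> (Suc k) \<omega>)" for k
  have split: "f (\<theta> k \<omega>) = (step (\<sigma> k \<omega>) ^^ N) f (\<theta> k \<omega>)
      + ((W k k - W (Suc k) (Suc k)) + ((W (Suc k) (Suc k) - W k (Suc k)) + D k))" for k
    using neumann_poisson [OF s [of k] f fb, where N = N and x = "\<theta> k \<omega>"] by (simp add: W_def D_def)
  have bound: "\<bar>\<Sum>k<n. f (\<theta> k \<omega>)\<bar>
      \<le> real n * (2 * e / 3) + 2 * C + K * (\<Sum>k<n. d k) + \<bar>\<Sum>k<n. D k\<bar>" for n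
  proof -
    have "(\<Sum>k<n. f (\<theta> k \<omega>)) = (\<Sum>k<n. (step (\<sigma> k \<omega>) ^^ N) f (\<theta> k \<omega>))
        + ((W 0 0 - W n n) + ((\<Sum>k<n. W (Suc k) (Suc k) - W k (Suc k)) + (\<Sum>k<n. D k)))"
      by (subst split) (simp only: sum.distrib sum_lessThan_telescope' [of "\<lambda>k. W k k"])
    moreover have "\<bar>\<Sum>k<n. (step (\<sigma> k \<omega>) ^^ N) f (\<theta> k \<omega>)\<bar> \<le> real n * (e / 3)"
    proof -
      have "\<bar>\<Sum>k<n. (step (\<sigma> k \<omega>) ^^ N) f (\<theta> k \<omega>)\<bar> \<le> (\<Sum>k<n. \<bar>(step (\<sigma> k \<omega>) ^^ N) f (\<theta> k \<omega>)\<bar>)"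
        by (rule sum_abs)
      also have "\<dots> \<le> (\<Sum>k<n. e / 3)"
        using iter_contract [OF s f fb mean] N by (intro sum_mono) (meson less_imp_le order_trans)
      finally show ?thesis by simp
    qed
    moreover have "\<bar>W 0 0 - W n n\<bar> \<le> 2 * C"
      using W [of 0 0] W [of n n] by linarith
    moreover have "\<bar>\<Sum>k<n. W (Suc k) (Suc k) - W k (Suc k)\<bar> \<le> real n * (e / 3) + K * (\<Sum>k<n. d k)"
    proof -
      have "\<bar>\<Sum>k<n. W (Suc k) (Suc k) - W k (Suc k)\<bar> \<le> (\<Sum>k<n. \<bar>W (Suc k) (Suc k) - W k (Suc k)\<bar>)"
        by (rule sum_abs)
      also have "\<dots> \<le> (\<Sum>k<n. e / 3 + K * d k)"
        unfolding W_def d_def by (subst dist_commute) (intro sum_mono lip s)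
      finally show ?thesis
        by (simp add: sum.distrib sum_distrib_left)
    qed
    ultimately show ?thesis
      by linarith
  qed
  have "(\<lambda>n. 2 * C / real n + K * ((\<Sum>k<n. d k) / real n) + \<bar>(\<Sum>k<n. D k) / real n\<bar>) \<longlonglongrightarrow> 0 + K * 0 + \<bar>0\<bar>"
    unfolding d_def D_def W_def
    by (intro tendsto_add tendsto_mult tendsto_const tendsto_rabs lim_const_over_n drift mart)
  then have "\<forall>\<^sub>F n in sequentially. 2 * C / real n + K * ((\<Sum>k<n. d k) / real n) + \<bar>(\<Sum>k<n. D k) / real n\<bar> < e / 3"
    using e by (intro order_tendstoD(2)) auto
  then have "\<forall>\<^sub>F n in sequentially. norm ((\<Sum>k<n. f (\<theta> k \<omega>)) / real n - 0) < e"
    using eventually_gt_at_top [of 0]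
  proof eventually_elim
    case (elim n)
    have "\<bar>\<Sum>k<n. f (\<theta> k \<omega>)\<bar> / real n
        \<le> (real n * (2 * e / 3) + 2 * C + K * (\<Sum>k<n. d k) + \<bar>\<Sum>k<n. D k\<bar>) / real n"
      by (intro divide_right_mono bound) simp
    also have "\<dots> = 2 * e / 3 + (2 * C / real n + K * ((\<Sum>k<n. d k) / real n) + \<bar>(\<Sum>k<n. D k) / real n\<bar>)"
      using elim(2) by (simp add: add_divide_distrib)
    also have "\<dots> < 2 * e / 3 + e / 3"
      using elim(1) by (rule add_strict_left_mono)
    finally show ?case
      by simp
  qed
  then show "\<exists>n0. \<forall>n\<ge>n0. norm ((\<Sum>k<n. f (\<theta> k \<omega>)) / real n - 0) < e"
    unfolding eventually_sequentially .
qed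

text \<open>Centring \<open>f\<close> reduces to mean zero. The exceptional sets are collected over
  the countably many truncation levels before any tolerance is chosen.\<close>

theorem law_of_large_numbers:
  assumes f [measurable]: "f \<in> borel_measurable borel" and fb: "\<And>x. \<bar>f x\<bar> \<le> c"
    and drift: "AE \<omega> in M. (\<lambda>n. (\<Sum>k<n. dist (\<sigma> k \<omega>) (\<sigma> (Suc k) \<omega>)) / real n) \<longlonglongrightarrow> 0"
  shows "AE \<omega> in M. (\<lambda>n. (\<Sum>k<n. f (\<theta> k \<omega>)) / real n) \<longlonglongrightarrow> (\<integral>x. f x * target x \<partial>lborel)"
proof -
  define \<mu> where "\<mu> = (\<integral>x. f x * target x \<partial>lborel)"
  define g where "g x = f x - \<mu>" for x
  have g [measurable]: "g \<in> borel_measurable borel"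
    unfolding g_def by measurable
  have gb: "\<bar>g x\<bar> \<le> c + \<bar>\<mu>\<bar>" for x
    using fb [of x] unfolding g_def by linarith
  have mean: "(\<integral>x. g x * target x \<partial>lborel) = 0"
    using integrable_times_target [OF f fb] by (simp add: g_def left_diff_distrib \<mu>_def)
  have "AE \<omega> in M. \<forall>N. (\<lambda>n. (\<Sum>k<n. neumann g N (\<sigma> k \<omega>) (\<theta> (Suc k) \<omega>)
        - step (\<sigma> k \<omega>) (neumann g N (\<sigma> k \<omega>)) (\<theta> k \<omega>)) / real n) \<longlonglongrightarrow> 0"
    unfolding AE_all_countable
  proof
    fix N
    show "AE \<omega> in M. (\<lambda>n. (\<Sum>k<n. neumann g N (\<sigma> k \<omega>) (\<theta> (Suc k) \<omega>)
        - step (\<sigma> k \<omega>) (neumann g N (\<sigma> k \<omega>)) (\<theta> k \<omega>)) / real n) \<longlonglongrightarrow> 0"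
      by (rule martingale_differences_negligible [OF _ neumann_bound [OF _ g gb]]) measurable
  qed
  with drift AE_space show ?thesis
  proof eventually_elim
    case (elim \<omega>)
    have "(\<lambda>n. (\<Sum>k<n. g (\<theta> k \<omega>)) / real n) \<longlonglongrightarrow> 0"
      by (rule centred_average_tendsto_0 [OF g gb mean elim(2,1)]) (use elim(3) in blast)
    then have "(\<lambda>n. (\<Sum>k<n. g (\<theta> k \<omega>)) / real n + \<mu>) \<longlonglongrightarrow> 0 + \<mu>"
      by (intro tendsto_intros)
    then have "(\<lambda>n. (\<Sum>k<n. g (\<theta> k \<omega>)) / real n + \<mu>) \<longlonglongrightarrow> \<mu>"
      by simp
    then show ?case
      unfolding \<mu>_def [symmetric]
    proof (rule Lim_transform_eventually)
      show "\<forall>\<^sub>F n in sequentially. (\<Sum>k<n. g (\<theta> k \<omega>)) / real n + \<mu> = (\<Sum>k<n. f (\<theta> k \<omega>)) / real n"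
        using eventually_gt_at_top [of 0]
        by eventually_elim (simp add: g_def sum_subtractf field_simps)
    qed
  qed
qed

end


section \<open>Gaussian proposals\<close>

text \<open>The centred normal density with the inverse covariance written out by Cramer's rule, which makes
  continuity in the covariance evident.\<close>

definition gauss :: "real^'d^'d \<Rightarrow> real^'d \<Rightarrow> real" where
  "gauss S z =
    exp (- (z \<bullet> (\<chi> k. det (\<chi> i j. if j = k then z $ i else S $ i $ j) / det S)) / 2)
      / sqrt ((2 * pi) ^ CARD('d) * det S)"

text \<open>The Cramer vector is the only solution of the linear system that the inverse matrix
  solves.\<close>

lemma mvn_density_eq_gauss:
  fixes S :: "real^'d^'d"
  assumes "det S \<noteq> 0" shows "mvn_density m S x = gauss S (x - m)"
proof -
  have "S *v (matrix_inv S *v (x - m)) = x - m"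
    using assms by (simp add: matrix_vector_mul_assoc matrix_inv_right invertible_det_nz)
  then show ?thesis
    using cramer [OF assms] by (simp add: mvn_density_def gauss_def)
qed

text \<open>Division by \<open>sqrt 0\<close> gives 0. With this value the density is extended
  measurably to all matrices.\<close>

lemma gauss_singular: "det S = 0 \<Longrightarrow> gauss S z = 0"
  by (simp add: gauss_def)

text \<open>Uniqueness of the Cramer solution makes it an odd function of z, so the exponent is
  even.\<close>

lemma gauss_even: "gauss S (- z) = gauss S z"
proof (cases "det S = 0")
  case False
  define v where "v z = (\<chi> k. det (\<chi> i j. if j = k then z $ i else S $ i $ j) / det S)" for z
  have v: "S *v x = z \<longleftrightarrow> x = v z" for x z
    unfolding v_def by (rule cramer [OF False])
  have "S *v v z = z"
    using v by blast
  then have "S *v (- v z) = - z"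
    by (simp add: vec.neg)
  then have "v (- z) = - v z"
    using v by metis
  then show ?thesis
    unfolding gauss_def v_def [symmetric] by simp
qed (simp add: gauss_singular)

lemma continuous_on_det:
  assumes "\<And>i j. continuous_on X (\<lambda>x. f x $ i $ j)"
  shows "continuous_on X (\<lambda>x. det (f x) :: real)"
  unfolding det_def by (intro continuous_intros assms)

lemma continuous_on_gauss: "continuous_on {p. det (fst p) \<noteq> 0} (\<lambda>p. gauss (fst p) (snd p))"
proof -
  have "continuous_on X (\<lambda>p. det (\<chi> i j. if j = k then snd p $ i else fst p $ i $ j))"
    for k and X :: "(((real^'d)^'d) \<times> (real^'d)) set"
  proof (rule continuous_on_det)
    fix i j
    show "continuous_on X (\<lambda>p. (\<chi> i j. if j = k then snd p $ i else fst p $ i $ j) $ i $ j)"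
      by (cases "j = k") (auto intro!: continuous_intros)
  qed
  moreover have "continuous_on X (\<lambda>p. det (fst p))" for X :: "(((real^'d)^'d) \<times> (real^'d)) set"
    by (intro continuous_on_det continuous_intros)
  ultimately show ?thesis
    unfolding gauss_def by (intro continuous_intros) auto
qed

text \<open>Continuity on the open set of nonsingular matrices is combined with the value 0
  elsewhere.\<close>

lemma gauss_measurable:
  "(\<lambda>(S, z). gauss S z) \<in> borel_measurable (borel \<Otimes>\<^sub>M borel)"
proof -
  have "open {p :: ((real^'d)^'d) \<times> (real^'d). det (fst p) \<noteq> 0}"
    by (intro open_Collect_neq continuous_on_det continuous_intros)
  then have "{p :: ((real^'d)^'d) \<times> (real^'d). det (fst p) \<noteq> 0} \<in> sets borel"
    by (rule borel_open)
  from borel_measurable_continuous_on_indicator [OF this continuous_on_gauss]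
  have "(\<lambda>p. indicator {p. det (fst p) \<noteq> 0} p *\<^sub>R gauss (fst p) (snd p))
      \<in> borel_measurable (borel :: (((real^'d)^'d) \<times> (real^'d)) measure)" .
  also have "(\<lambda>p. indicator {p. det (fst p) \<noteq> 0} p *\<^sub>R gauss (fst p) (snd p))
      = (\<lambda>(S :: real^'d^'d, z). gauss S z)"
    by (auto simp: fun_eq_iff indicator_def gauss_singular)
  finally show ?thesis
    by (simp add: borel_prod)
qed

section \<open>Compact sets of proposal covariances\<close>

definition pd_ball :: "real \<Rightarrow> real \<Rightarrow> (real^'d^'d) set" where
  "pd_ball a r = {S. norm S \<le> r \<and> (\<forall>x. a * (norm x)\<^sup>2 \<le> x \<bullet> (S *v x))}"

text \<open>A closed ball is intersected with one closed half-space for each vector x.\<close>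

lemma compact_pd_ball: "compact (pd_ball a r :: (real^'d^'d) set)"
proof -
  have "continuous_on UNIV (\<lambda>S :: real^'d^'d. x \<bullet> (S *v x))" for x :: "real^'d"
    unfolding inner_vec_def matrix_vector_mult_def by (simp, intro continuous_intros)
  then have "closed {S :: real^'d^'d. a * (norm x)\<^sup>2 \<le> x \<bullet> (S *v x)}" for x :: "real^'d"
    by (intro closed_Collect_le continuous_on_const)
  then have "compact (cball 0 r \<inter> (\<Inter>x. {S :: real^'d^'d. a * (norm x)\<^sup>2 \<le> x \<bullet> (S *v x)}))"
    by (intro compact_Int_closed compact_cball closed_INT ballI)
  moreover have "(pd_ball a r :: (real^'d^'d) set) = cball 0 r \<inter> (\<Inter>x. {S :: real^'d^'d. a * (norm x)\<^sup>2 \<le> x \<bullet> (S *v x)})"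
    by (auto simp: pd_ball_def)
  ultimately show ?thesis
    by simp
qed

lemma det_pos_pd_ball:
  assumes "S \<in> pd_ball a r" "0 < a" shows "0 < det S"
proof (rule det_pos_of_quadratic_form)
  fix x :: "real^'a" assume "x \<noteq> 0"
  then have "0 < a * (norm x)\<^sup>2"
    using assms(2) by simp
  also have "\<dots> \<le> x \<bullet> (S *v x)"
    using assms(1) by (simp add: pd_ball_def)
  finally show "0 < x \<bullet> (S *v x)" .
qed

lemma gauss_pos: "0 < det S \<Longrightarrow> 0 < gauss S z"
  by (simp add: gauss_def)

text \<open>Membership includes that the density integrates to \<open>1\<close>: for the covariances occurring in the
  algorithm this is implied by the law of the draws.\<close>

definition cov_set :: "real \<Rightarrow> real \<Rightarrow> (real^'d^'d) set" where
  "cov_set a r = {S \<in> pd_ball a r. (\<integral>\<^sup>+ z. ennreal (gauss S z) \<partial>lborel) = 1}"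

text \<open>Needed for measurability of the case distinction that modifies the covariance on a null
  set.\<close>

lemma cov_set_borel: "cov_set a r \<in> sets borel"
proof -
  have "pd_ball a r \<in> sets borel"
    by (intro borel_closed compact_imp_closed compact_pd_ball)
  moreover have "(\<lambda>S. \<integral>\<^sup>+ z. ennreal (gauss S z) \<partial>lborel) \<in> borel_measurable borel"
  proof -
    note [measurable (raw)] = measurable_curried [OF gauss_measurable]
    show ?thesis
      by measurable
  qed
  then have "{S \<in> space borel. (\<integral>\<^sup>+ z. ennreal (gauss S z) \<partial>lborel) = 1} \<in> sets borel"
    by (intro borel_measurable_eq) auto
  ultimately have "pd_ball a r \<inter> {S \<in> space borel. (\<integral>\<^sup>+ z. ennreal (gauss S z) \<partial>lborel) = 1} \<in> sets borel"
    by (rule sets.Int)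
  also have "pd_ball a r \<inter> {S \<in> space borel. (\<integral>\<^sup>+ z. ennreal (gauss S z) \<partial>lborel) = 1} = cov_set a r"
    by (auto simp: cov_set_def)
  finally show ?thesis .
qed

text \<open>On the compact product of \<open>pd_ball\<close> with the ball of radius
  \<open>2 * R\<close> the density is positive and continuous: its minimum provides
  \<open>q0\<close>, and Heine-Cantor provides the uniform modulus in the covariance.\<close>

lemma gauss_metropolis_family:
  fixes target :: "real^'d \<Rightarrow> real"
  assumes density: "is_density target" and B: "\<And>x. target x \<le> B"
    and R: "\<And>x. target x \<noteq> 0 \<Longrightarrow> norm x \<le> R" and a: "0 < a"
  obtains q0 where "metropolis_family target gauss (cov_set a r) B R q0"
proof -
  define X where "X = (pd_ball a r :: (real^'d^'d) set) \<times> cball (0 :: real^'d) (2 * R)"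
  have X: "compact X"
    unfolding X_def by (intro compact_Times compact_pd_ball compact_cball)
  have cont: "continuous_on X (\<lambda>p. gauss (fst p) (snd p))"
  proof (rule continuous_on_subset [OF continuous_on_gauss], rule subsetI)
    fix p assume "p \<in> X"
    then have "fst p \<in> pd_ball a r"
      by (simp add: X_def mem_Times_iff)
    from det_pos_pd_ball [OF this a] show "p \<in> {p. det (fst p) \<noteq> 0}"
      by simp
  qed
  have pos: "0 < gauss S z" if "S \<in> pd_ball a r" for S :: "real^'d^'d" and z
    by (intro gauss_pos det_pos_pd_ball [OF that a])
  have "\<exists>q0>0. \<forall>p\<in>X. q0 \<le> gauss (fst p) (snd p)"
  proof (cases "X = {}")
    case False
    then obtain p where "p \<in> X" "\<forall>p'\<in>X. gauss (fst p) (snd p) \<le> gauss (fst p') (snd p')"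
      using continuous_attains_inf [OF X _ cont] by blast
    then show ?thesis
      using pos [of "fst p" "snd p"] by (intro exI [of _ "gauss (fst p) (snd p)"]) (simp add: X_def mem_Times_iff)
  qed (auto intro: exI [of _ 1])
  then obtain q0 where q0: "0 < q0" "\<And>p. p \<in> X \<Longrightarrow> q0 \<le> gauss (fst p) (snd p)"
    by blast
  have unif: "uniformly_continuous_on X (\<lambda>p. gauss (fst p) (snd p))"
    by (rule compact_uniformly_continuous [OF cont X])
  have "metropolis_family target gauss (cov_set a r) B R q0"
  proof
    show "(\<lambda>(S, z). gauss S z) \<in> borel_measurable (borel \<Otimes>\<^sub>M borel)"
      by (rule gauss_measurable)
    fix e :: real assume "0 < e"
    then obtain \<delta> where \<delta>: "0 < \<delta>" and close: "\<And>p p'. p \<in> X \<Longrightarrow> p' \<in> X \<Longrightarrow> dist p' p < \<delta> \<Longrightarrow>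
        dist (gauss (fst p') (snd p')) (gauss (fst p) (snd p)) < e"
      using unif unfolding uniformly_continuous_on_def by metis
    have *: "\<bar>gauss S z - gauss S' z\<bar> \<le> e"
      if "S \<in> cov_set a r" "S' \<in> cov_set a r" "dist S S' < \<delta>" "norm z \<le> 2 * R" for S S' :: "real^'d^'d" and z
    proof -
      have "(S', z) \<in> X" "(S, z) \<in> X"
        using that by (simp_all add: X_def cov_set_def)
      moreover have "dist (S, z) (S', z) < \<delta>"
        using that by (simp add: dist_Pair_Pair)
      ultimately have "dist (gauss S z) (gauss S' z) < e"
        using close [of "(S', z)" "(S, z)"] by simp
      then show ?thesis
        by (simp add: dist_real_def)
    qed
    show "\<exists>\<delta>>0. \<forall>s\<in>cov_set a r :: (real^'d^'d) set. \<forall>s'\<in>cov_set a r. dist s s' < \<delta> \<longrightarrow>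
        (\<forall>z. norm z \<le> 2 * R \<longrightarrow> \<bar>gauss s z - gauss s' z\<bar> \<le> e)"
      by (intro exI [of _ \<delta>] conjI \<delta> ballI impI allI *)
  next
    fix S :: "real^'d^'d" and z assume S: "S \<in> cov_set a r"
    then have S': "S \<in> pd_ball a r"
      by (simp add: cov_set_def)
    show "0 \<le> gauss S z"
      using pos [OF S'] by (rule less_imp_le)
    show "(\<integral>\<^sup>+ z. ennreal (gauss S z) \<partial>lborel) = 1"
      using S by (simp add: cov_set_def)
    assume "norm z \<le> 2 * R"
    then show "q0 \<le> gauss S z"
      using q0(2) [of "(S, z)"] S' by (simp add: X_def)
  qed (fact density B R q0(1) gauss_even)+
  then show ?thesis
    by (rule that)
qed


section \<open>Drift of the adapted parameters\<close>

text \<open>\<open>T\<close> acts as a bounded potential: its increments telescope, so they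
  disappear after division by n.\<close>

lemma cesaro_null_of_drift:
  fixes d T w :: "nat \<Rightarrow> real"
  assumes nonneg: "\<And>k. 0 \<le> d k" and d: "\<And>k. d k \<le> T (Suc k) - T k + w k"
    and T: "\<And>k. \<bar>T k\<bar> \<le> C" and w: "w \<longlonglongrightarrow> 0"
  shows "(\<lambda>n. (\<Sum>k<n. d k) / real n) \<longlonglongrightarrow> 0"
proof (rule tendsto_sandwich [of "\<lambda>_. 0" _ _ "\<lambda>n. 2 * C / real n + (\<Sum>k<n. w k) / real n"])
  show "(\<lambda>n. 2 * C / real n + (\<Sum>k<n. w k) / real n) \<longlonglongrightarrow> 0"
    using tendsto_add [OF lim_const_over_n [of "2 * C"] cesaro_null [OF w]] by simp
  have "(\<Sum>k<n. d k) / real n \<le> 2 * C / real n + (\<Sum>k<n. w k) / real n" for n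
  proof -
    have "(\<Sum>k<n. d k) \<le> (\<Sum>k<n. T (Suc k) - T k + w k)"
      by (intro sum_mono d)
    also have "\<dots> = T n - T 0 + (\<Sum>k<n. w k)"
      by (simp add: sum.distrib sum_lessThan_telescope)
    also have "\<dots> \<le> 2 * C + (\<Sum>k<n. w k)"
      using T [of n] T [of 0] by linarith
    finally show ?thesis
      by (simp add: divide_right_mono add_divide_distrib [symmetric])
  qed
  then show "\<forall>\<^sub>F n in sequentially. (\<Sum>k<n. d k) / real n \<le> 2 * C / real n + (\<Sum>k<n. w k) / real n"
    by simp
  show "\<forall>\<^sub>F n in sequentially. 0 \<le> (\<Sum>k<n. d k) / real n"
    by (simp add: sum_nonneg nonneg)
qed simp

lemma scale_update_bounds:
  assumes "0 < \<delta>" "\<delta> \<le> 1"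
  shows "\<delta> \<le> scale_update \<delta> t g a l" "scale_update \<delta> t g a l \<le> 1 / \<delta>"
proof -
  have "\<delta> \<le> 1 / \<delta>"
    using assms by (simp add: field_simps mult_le_one)
  then show "\<delta> \<le> scale_update \<delta> t g a l" "scale_update \<delta> t g a l \<le> 1 / \<delta>"
    by (auto simp: scale_update_def)
qed

text \<open>For negative s this amounts to \<open>2 \<le> exp s + exp (- s)\<close>.\<close>

lemma abs_exp_minus_1_le: "\<bar>exp s - 1\<bar> \<le> exp \<bar>s\<bar> - 1" for s :: real
proof (cases "0 \<le> s")
  case False
  have "2 \<le> exp s + exp (- s)"
    using exp_ge_add_one_self [of s] exp_ge_add_one_self [of "- s"] by linarith
  then show ?thesis
    using False by simp
qed simp

text \<open>The old scale lies in the interval, so projection cannot increase the distance from it.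
  Before projection the scale is multiplied by the exponential of a number of modulus at most
  \<open>g\<close>.\<close>

lemma scale_update_increment:
  assumes \<delta>: "0 < \<delta>" "\<delta> \<le> 1" and l: "\<delta> \<le> l" "l \<le> 1 / \<delta>" and g: "0 \<le> g"
    and a: "0 \<le> a" "a \<le> 1" and t: "0 < t" "t < 1"
  shows "\<bar>scale_update \<delta> t g a l - l\<bar> \<le> (exp g - 1) / \<delta>"
proof -
  have l0: "0 < l"
    using \<delta> l by linarith
  let ?s = "g * (a - t)"
  have "\<bar>?s\<bar> \<le> g * 1"
    unfolding abs_mult using g a t by (intro mult_mono) auto
  then have "\<bar>exp ?s - 1\<bar> \<le> exp g - 1"
    using abs_exp_minus_1_le [of ?s] by (smt (verit) exp_le_cancel_iff)
  then have "l * \<bar>exp ?s - 1\<bar> \<le> (1 / \<delta>) * (exp g - 1)"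
    using l l0 \<delta> by (intro mult_mono) auto
  moreover have "\<bar>scale_update \<delta> t g a l - l\<bar> \<le> \<bar>exp (ln l + ?s) - l\<bar>"
    using l unfolding scale_update_def by linarith
  moreover have "exp (ln l + ?s) - l = l * (exp ?s - 1)"
    unfolding exp_add using l0 by (simp add: right_diff_distrib)
  ultimately show ?thesis
    using l0 by (simp add: abs_mult)
qed


section \<open>The algorithm\<close>

text \<open>\<open>measure\<close> is 0 on sets of infinite measure, so the value 1 rules them
  out.\<close>

lemma emeasure_eq_1_of_measure: "measure N X = 1 \<Longrightarrow> emeasure N X = 1"
  using emeasure_eq_ennreal_measure [of N X] by (cases "emeasure N X = \<top>") (auto simp: measure_def)

context vbam
begin

section \<open>Almost sure bounds along the path\<close>

definition cov :: "nat \<Rightarrow> 'w \<Rightarrow> real^'d^'d" where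
  "cov k \<omega> = lam k \<omega> *\<^sub>R Sig k \<omega>"

text \<open>The invariant of the recursion. Positivity of the filter covariance is part of it,
  because the bounds on an update require a positive semidefinite prediction.\<close>

definition good :: "nat \<Rightarrow> 'w \<Rightarrow> bool" where
  "good k \<omega> \<longleftrightarrow> psd (P k \<omega>) \<and> loewner_le (\<mu>1 *\<^sub>R mat 1) (Sig k \<omega>) \<and> loewner_le (Sig k \<omega>) (\<mu>2 *\<^sub>R mat 1)
    \<and> \<delta>lam \<le> lam k \<omega> \<and> lam k \<omega> \<le> 1 / \<delta>lam"

text \<open>The linear growth of the degrees of freedom is the source of the factor 1/k in the noise
  covariance updates.\<close>

lemma nu_ge: "nu k > real CARD('d) + 1 + real k" "nu k > real CARD('d) + 1"
proof -
  have "nu k = nu 0 + real k"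
    by (induction k) (auto simp: nu_Suc)
  then show "nu k > real CARD('d) + 1 + real k" "nu k > real CARD('d) + 1"
    using nu_0 by auto
qed

lemma psd_prediction:
  assumes "psd (P k \<omega>)" shows "psd (A k ** P k \<omega> ** transpose (A k) + Q k)"
  by (intro psd_add psd_congruence assms psd_Q)

lemma AE_good: "AE \<omega> in M. good k \<omega>"
proof (induction k)
  case 0
  from init show ?case
    by eventually_elim (use psd_P0 Sig0_bounds lam0_bounds in \<open>simp add: good_def\<close>)
next
  case (Suc k)
  from Suc filter_update [of k] scale [of k] show ?case
  proof eventually_elim
    case (elim \<omega>)
    then have g: "psd (P k \<omega>)" "loewner_le (\<mu>1 *\<^sub>R mat 1) (Sig k \<omega>)" "loewner_le (Sig k \<omega>) (\<mu>2 *\<^sub>R mat 1)"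
      "\<delta>lam \<le> lam k \<omega>" "lam k \<omega> \<le> 1 / \<delta>lam"
      by (simp_all add: good_def)
    note step = vbakf_step_bounds [OF elim(2) mu_bounds(1) g(2,3) psd_prediction [OF g(1)] nu_ge(2) nu_Suc]
    show ?case
      using step(1-3) g(4,5) elim(3) scale_update_bounds [OF delta_lam] by (simp add: good_def)
  qed
qed

lemma AE_good_all: "AE \<omega> in M. \<forall>k. good k \<omega>"
  by (simp add: AE_all_countable AE_good)

text \<open>The largest admissible scale times the norm bound for the noise covariance obtained from
  its trace.\<close>

definition rmax :: real where
  "rmax = (1 / \<delta>lam) * ((real CARD('d))^3 * \<mu>2)"

lemma good_norm_Sig:
  assumes "good k \<omega>"
  shows "norm (Sig k \<omega>) \<le> (real CARD('d))^3 * \<mu>2" "0 \<le> trace (Sig k \<omega>)" "trace (Sig k \<omega>) \<le> real CARD('d) * \<mu>2"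
proof -
  have psd: "psd (Sig k \<omega>)"
    using assms mu_bounds(1) by (auto simp: good_def intro: posdef_imp_psd loewner_pos_imp_posdef)
  then show "0 \<le> trace (Sig k \<omega>)"
    by (rule trace_psd_nonneg)
  show tr: "trace (Sig k \<omega>) \<le> real CARD('d) * \<mu>2"
    using assms by (intro trace_le_of_loewner_le) (simp add: good_def)
  have "norm (Sig k \<omega>) \<le> (real CARD('d))\<^sup>2 * trace (Sig k \<omega>)"
    by (rule psd_norm_le_trace [OF psd])
  also have "\<dots> \<le> (real CARD('d))\<^sup>2 * (real CARD('d) * \<mu>2)"
    by (intro mult_left_mono tr) simp
  finally show "norm (Sig k \<omega>) \<le> (real CARD('d))^3 * \<mu>2"
    by (simp add: power2_eq_square power3_eq_cube mult_ac)
qed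

lemma good_cov:
  assumes g: "good k \<omega>" shows "cov k \<omega> \<in> pd_ball (\<delta>lam * \<mu>1) rmax"
  unfolding pd_ball_def
proof (intro CollectI conjI allI)
  have l: "0 \<le> lam k \<omega>" "\<delta>lam \<le> lam k \<omega>" "lam k \<omega> \<le> 1 / \<delta>lam"
    using g delta_lam by (auto simp: good_def)
  have "norm (cov k \<omega>) = lam k \<omega> * norm (Sig k \<omega>)"
    using l by (simp add: cov_def)
  also have "\<dots> \<le> rmax"
    unfolding rmax_def using l good_norm_Sig(1) [OF g] delta_lam by (intro mult_mono) auto
  finally show "norm (cov k \<omega>) \<le> rmax" .
  fix x :: "real^'d"
  have "0 \<le> x \<bullet> ((Sig k \<omega> - \<mu>1 *\<^sub>R mat 1) *v x)"
    using g by (simp add: good_def loewner_le_def psd_def)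
  then have *: "\<mu>1 * (norm x)\<^sup>2 \<le> x \<bullet> (Sig k \<omega> *v x)"
    by (simp add: matrix_vector_mult_diff_rdistrib inner_diff_right inner_scaleR_mat_1)
  have "\<delta>lam * (\<mu>1 * (norm x)\<^sup>2) \<le> lam k \<omega> * (x \<bullet> (Sig k \<omega> *v x))"
    using l * mu_bounds(1) by (intro mult_mono) auto
  then show "\<delta>lam * \<mu>1 * (norm x)\<^sup>2 \<le> x \<bullet> (cov k \<omega> *v x)"
    by (simp add: cov_def scaleR_matrix_vector_assoc [symmetric] mult.assoc)
qed

lemma cov_bound_pos: "0 < \<delta>lam * \<mu>1"
  using delta_lam mu_bounds by simp

section \<open>Normalisation and law of the proposals\<close>

lemma emeasure_mvn:
  assumes "0 < det S" "X \<in> sets borel"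
  shows "emeasure (mvn t S) X = (\<integral>\<^sup>+ y. indicator X y * ennreal (gauss S (y - t)) \<partial>lborel)"
proof -
  note [measurable (raw)] = measurable_curried [OF gauss_measurable]
  have "mvn t S = density lborel (\<lambda>y. ennreal (gauss S (y - t)))"
    unfolding mvn_def using assms(1) by (simp add: mvn_density_eq_gauss)
  then show ?thesis
    using assms(2) by (simp add: emeasure_density mult.commute)
qed

text \<open>Taking both events in \<open>draws\<close> to be the whole space, the conditional
  expectation of 1 is on one side 1 and on the other the total mass of the normal law.\<close>

lemma AE_mvn_prob: "AE \<omega> in M. measure (mvn (theta k \<omega>) (cov k \<omega>)) UNIV = 1"
proof -
  interpret Fk: finite_measure_subalgebra M "F k"
    by unfold_locales (rule subalgebra_F)
  have "AE \<omega> in M. real_cond_exp M (F k) (\<lambda>_. 1) \<omega> = 1"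
    by (rule Fk.real_cond_exp_F_meas) auto
  moreover have "measure (uniform_measure lborel {0<..<1::real}) UNIV = 1"
    using unif.prob_space by (metis space_borel space_lborel space_uniform_measure)
  then have "AE \<omega> in M. real_cond_exp M (F k) (\<lambda>_. 1) \<omega> = measure (mvn (theta k \<omega>) (cov k \<omega>)) UNIV"
    using draws [of UNIV UNIV k] by (simp add: cov_def del: measure_uniform_measure)
  ultimately show ?thesis
    by eventually_elim simp
qed

lemma AE_cov_mem: "AE \<omega> in M. cov k \<omega> \<in> cov_set (\<delta>lam * \<mu>1) rmax"
  using AE_good [of k] AE_mvn_prob [of k]
proof eventually_elim
  case (elim \<omega>)
  note pd = good_cov [OF elim(1)]
  note det = det_pos_pd_ball [OF pd cov_bound_pos]
  have "emeasure (mvn (theta k \<omega>) (cov k \<omega>)) UNIV = 1"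
    using elim(2) by (rule emeasure_eq_1_of_measure)
  then have 1: "(\<integral>\<^sup>+ y. ennreal (gauss (cov k \<omega>) (y - theta k \<omega>)) \<partial>lborel) = 1"
    by (simp add: emeasure_mvn [OF det])
  note [measurable (raw)] = measurable_curried [OF gauss_measurable]
  have "(\<integral>\<^sup>+ y. ennreal (gauss (cov k \<omega>) (y - theta k \<omega>)) \<partial>lborel)
      = (\<integral>\<^sup>+ z. ennreal (gauss (cov k \<omega>) z) \<partial>lborel)"
    by (rule nn_integral_lborel_shift) measurable
  then show ?case
    using pd 1 by (simp add: cov_set_def)
qed

lemma cov_adapted: "cov k \<in> borel_measurable (F k)"
  unfolding cov_def by (intro borel_measurable_scaleR adapted)

text \<open>A set that contains a random variable almost surely has a member; it supplies the
  replacement value on the null set.\<close>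

lemma cov_set_nonempty: "cov_set (\<delta>lam * \<mu>1) rmax \<noteq> ({} :: (real^'d^'d) set)"
proof
  assume "cov_set (\<delta>lam * \<mu>1) rmax = ({} :: (real^'d^'d) set)"
  then have "AE \<omega> in M. False"
    using AE_cov_mem [of 0] by simp
  then show False
    by simp
qed

text \<open>A version of the proposal covariance which satisfies the bounds everywhere.\<close>

definition cov' :: "nat \<Rightarrow> 'w \<Rightarrow> real^'d^'d" where
  "cov' k \<omega> = (if cov k \<omega> \<in> cov_set (\<delta>lam * \<mu>1) rmax then cov k \<omega>
     else (SOME S. S \<in> cov_set (\<delta>lam * \<mu>1) rmax))"

lemma cov'_mem: "cov' k \<omega> \<in> cov_set (\<delta>lam * \<mu>1) rmax"
  using cov_set_nonempty by (auto simp: cov'_def some_in_eq)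

lemma AE_cov': "AE \<omega> in M. cov' k \<omega> = cov k \<omega>"
  using AE_cov_mem [of k] by eventually_elim (simp add: cov'_def)

lemma cov'_adapted: "cov' k \<in> borel_measurable (F k)"
proof -
  note [measurable] = cov_adapted [of k] cov_set_borel
  show ?thesis
    unfolding cov'_def by measurable
qed

text \<open>The conditional law is integrated over an event of \<open>F k\<close>. Total mass 1
  permits the passage from real-valued to extended measures, and the covariance may be replaced by
  its modification under the integral.\<close>

lemma joint_draws:
  assumes Z: "Z \<in> sets (F k)" and X: "X \<in> sets borel" and Y: "Y \<in> sets borel"
  shows "emeasure M {\<omega> \<in> Z. theta_star (Suc k) \<omega> \<in> X \<and> U (Suc k) \<omega> \<in> Y}
    = (\<integral>\<^sup>+ \<omega>. indicator Z \<omega> * ((\<integral>\<^sup>+ y. indicator X y * ennreal (gauss (cov' k \<omega>) (y - theta k \<omega>)) \<partial>lborel)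
        * emeasure unif Y) \<partial>M)"
proof -
  interpret Fk: finite_measure_subalgebra M "F k"
    by unfold_locales (rule subalgebra_F)
  have [measurable]: "theta_star (Suc k) \<in> borel_measurable M" "U (Suc k) \<in> borel_measurable M" "Z \<in> sets M"
    using adapted_draws [of k] Z subalgebra_F [of k] subalgebra_F [of "Suc k"]
    by (auto intro: measurable_from_subalg simp: subalgebra_def)
  note [measurable] = X Y
  let ?g = "\<lambda>\<omega>. indicator X (theta_star (Suc k) \<omega>) * indicator Y (U (Suc k) \<omega>) :: real"
  let ?W = "{\<omega> \<in> Z. theta_star (Suc k) \<omega> \<in> X \<and> U (Suc k) \<omega> \<in> Y}"
  have W: "?W = Z \<inter> {\<omega> \<in> space M. theta_star (Suc k) \<omega> \<in> X \<and> U (Suc k) \<omega> \<in> Y}"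
    using sets.sets_into_space [OF \<open>Z \<in> sets M\<close>] by auto
  have W_sets [measurable]: "?W \<in> sets M"
    unfolding W by measurable
  have int: "integrable M (\<lambda>\<omega>. indicator Z \<omega> * ?g \<omega>)"
    by (rule integrable_const_bound [of _ 1]) (auto simp: indicator_def)
  have iA: "indicator Z \<in> borel_measurable (F k)"
    using Z by simp
  have g_meas: "?g \<in> borel_measurable M"
    by measurable
  have "ennreal (measure M ?W) = ennreal (\<integral>\<omega>. indicator ?W \<omega> \<partial>M)"
    using W_sets by simp
  also have "(\<integral>\<omega>. indicator ?W \<omega> \<partial>M) = (\<integral>\<omega>. indicator Z \<omega> * ?g \<omega> \<partial>M)"
    by (intro Bochner_Integration.integral_cong) (auto simp: indicator_def)
  also have "\<dots> = (\<integral>\<omega>. indicator Z \<omega> * real_cond_exp M (F k) ?g \<omega> \<partial>M)"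
    by (rule Fk.real_cond_exp_intg(2) [OF int iA g_meas, symmetric])
  also have "ennreal \<dots> = (\<integral>\<^sup>+ \<omega>. ennreal (indicator Z \<omega> * real_cond_exp M (F k) ?g \<omega>) \<partial>M)"
  proof (rule nn_integral_eq_integral [symmetric])
    show "integrable M (\<lambda>\<omega>. indicator Z \<omega> * real_cond_exp M (F k) ?g \<omega>)"
      by (rule Fk.real_cond_exp_intg(1) [OF int iA g_meas])
    show "AE \<omega> in M. 0 \<le> indicator Z \<omega> * real_cond_exp M (F k) ?g \<omega>"
      using draws [OF X Y, of k] by eventually_elim simp
  qed
  also have "\<dots> = (\<integral>\<^sup>+ \<omega>. indicator Z \<omega> *
      ((\<integral>\<^sup>+ y. indicator X y * ennreal (gauss (cov' k \<omega>) (y - theta k \<omega>)) \<partial>lborel) * emeasure unif Y) \<partial>M)"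
  proof (rule nn_integral_cong_AE)
    show "AE \<omega> in M. ennreal (indicator Z \<omega> * real_cond_exp M (F k) ?g \<omega>)
        = indicator Z \<omega> * ((\<integral>\<^sup>+ y. indicator X y * ennreal (gauss (cov' k \<omega>) (y - theta k \<omega>)) \<partial>lborel)
            * emeasure unif Y)"
      using draws [OF X Y, of k] AE_cov' [of k] AE_good [of k] AE_mvn_prob [of k]
    proof eventually_elim
      case (elim \<omega>)
      note det = det_pos_pd_ball [OF good_cov [OF elim(3)] cov_bound_pos]
      let ?N = "mvn (theta k \<omega>) (cov k \<omega>)"
      have "emeasure ?N UNIV = 1"
        using elim(4) by (rule emeasure_eq_1_of_measure)
      moreover have "emeasure ?N X \<le> emeasure ?N UNIV"
        by (intro emeasure_mono) (auto simp: mvn_def)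
      ultimately have "ennreal (measure ?N X) = emeasure ?N X"
        by (intro emeasure_eq_ennreal_measure [symmetric]) (auto simp: top_unique)
      also have "\<dots> = (\<integral>\<^sup>+ y. indicator X y * ennreal (gauss (cov' k \<omega>) (y - theta k \<omega>)) \<partial>lborel)"
        unfolding elim(2) by (rule emeasure_mvn [OF det X])
      finally have 1: "ennreal (measure ?N X)
          = (\<integral>\<^sup>+ y. indicator X y * ennreal (gauss (cov' k \<omega>) (y - theta k \<omega>)) \<partial>lborel)" .
      have "ennreal (indicator Z \<omega> * (measure ?N X * measure unif Y))
          = indicator Z \<omega> * (ennreal (measure ?N X) * emeasure unif Y)"
        unfolding unif.emeasure_eq_measure [of Y]
        by (simp add: ennreal_mult indicator_def del: measure_uniform_measure)
      then show ?case
        unfolding elim(1) 1 [symmetric] cov_def .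
    qed
  qed
  finally show ?thesis
    by (simp add: emeasure_eq_measure)
qed

text \<open>The terms of the convergent series of powers vanish, and so do their roots.\<close>

lemma gain_tendsto_0: "(\<lambda>k. gam (Suc k)) \<longlonglongrightarrow> 0"
proof -
  obtain \<delta> where \<delta>: "0 < \<delta>" "summable (\<lambda>k. gam (Suc k) powr (1 + \<delta>))"
    using gam_power_summable by blast
  have "(\<lambda>k. (gam (Suc k) powr (1 + \<delta>)) powr (1 / (1 + \<delta>))) \<longlonglongrightarrow> 0"
    using \<delta>(1) by (intro tendsto_zero_powrI [OF summable_LIMSEQ_zero [OF \<delta>(2)] tendsto_const]) auto
  moreover have "(gam (Suc k) powr (1 + \<delta>)) powr (1 / (1 + \<delta>)) = gam (Suc k)" for k
    using \<delta>(1) gam_nonneg [of "Suc k"] by (simp add: powr_powr)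
  ultimately show ?thesis
    by simp
qed

text \<open>By the product rule the scale changes at the old noise covariance and the noise
  covariance changes at the new scale. The first part vanishes with the gain; for the second the
  scaled trace is the bounded potential.\<close>

lemma cov_drift:
  assumes target: "\<And>x. 0 \<le> target x"
  shows "AE \<omega> in M. (\<lambda>n. (\<Sum>k<n. dist (cov' k \<omega>) (cov' (Suc k) \<omega>)) / real n) \<longlonglongrightarrow> 0"
proof -
  let ?d = "real CARD('d)"
  have "AE \<omega> in M. \<forall>k. cov' k \<omega> = cov k \<omega>"
    by (simp add: AE_all_countable AE_cov')
  moreover have "AE \<omega> in M. \<forall>k. vbakf_step \<mu>1 \<mu>2 (H (Suc k)) (A k *v m k \<omega>) (A k ** P k \<omega> ** transpose (A k) + Q k)
        (theta (Suc k) \<omega>) (nu k) (nu (Suc k)) (Sig k \<omega>) (Sig (Suc k) \<omega>) (m (Suc k) \<omega>) (P (Suc k) \<omega>)"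
    using filter_update by (simp add: AE_all_countable)
  moreover have "AE \<omega> in M. \<forall>k. lam (Suc k) \<omega> =
      (if adapt_scale
       then scale_update \<delta>lam target_acc (gam (Suc k))
              (accept_prob target (theta k \<omega>) (theta_star (Suc k) \<omega>)) (lam k \<omega>)
       else lam k \<omega>)"
    using scale by (simp add: AE_all_countable)
  ultimately show ?thesis
    using AE_good_all
  proof eventually_elim
    case (elim \<omega>)
    have g: "good k \<omega>" for k
      using elim(4) by blast
    \<comment> \<open>The first summand comes from the scale. In the second,
      \<open>nu (Suc k) - d - 1\<close> has been replaced by its lower bound
      \<open>Suc k\<close>.\<close>
    define w where "w k = (exp (gam (Suc k)) - 1) / \<delta>lam * (?d^3 * \<mu>2)
        + (1 / \<delta>lam) * (2 * ?d^3 * \<mu>2) / real (Suc k)" for k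
    define T where "T k = (1 / \<delta>lam) * (?d\<^sup>2 * trace (Sig k \<omega>))" for k
    have mu2: "0 \<le> \<mu>2"
      using mu_bounds by simp
    have inc: "dist (cov k \<omega>) (cov (Suc k) \<omega>) \<le> T (Suc k) - T k + w k" for k
    proof -
      have gk: "psd (P k \<omega>)" "loewner_le (\<mu>1 *\<^sub>R mat 1) (Sig k \<omega>)" "loewner_le (Sig k \<omega>) (\<mu>2 *\<^sub>R mat 1)"
        "\<delta>lam \<le> lam k \<omega>" "lam k \<omega> \<le> 1 / \<delta>lam"
        using g [of k] by (simp_all add: good_def)
      have l': "0 \<le> lam (Suc k) \<omega>" "lam (Suc k) \<omega> \<le> 1 / \<delta>lam"
        using g [of "Suc k"] delta_lam by (simp_all add: good_def)
      have lam: "\<bar>lam (Suc k) \<omega> - lam k \<omega>\<bar> \<le> (exp (gam (Suc k)) - 1) / \<delta>lam"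
      proof (cases adapt_scale)
        case True
        then show ?thesis
          using elim(3) target_acc gam_nonneg [of "Suc k"]
          by (auto intro!: scale_update_increment delta_lam gk simp: accept_prob_def target)
      next
        case False
        then show ?thesis
          using elim(3) delta_lam gam_nonneg [of "Suc k"] by simp
      qed
      have "norm (Sig (Suc k) \<omega> - Sig k \<omega>)
          \<le> ?d\<^sup>2 * (trace (Sig (Suc k) \<omega>) - trace (Sig k \<omega>)) + 2 * ?d^3 * \<mu>2 / (nu (Suc k) - ?d - 1)"
        using elim(2) by (intro vbakf_step_bounds(4) [OF _ mu_bounds(1) gk(2,3) psd_prediction [OF gk(1)] nu_ge(2) nu_Suc]) blast
      also have "2 * ?d^3 * \<mu>2 / (nu (Suc k) - ?d - 1) \<le> 2 * ?d^3 * \<mu>2 / real (Suc k)"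
        using nu_ge(1) [of "Suc k"] mu2 by (intro divide_left_mono mult_nonneg_nonneg mult_pos_pos) auto
      finally have Sig: "norm (Sig (Suc k) \<omega> - Sig k \<omega>)
          \<le> ?d\<^sup>2 * (trace (Sig (Suc k) \<omega>) - trace (Sig k \<omega>)) + 2 * ?d^3 * \<mu>2 / real (Suc k)"
        by simp
      have "dist (cov k \<omega>) (cov (Suc k) \<omega>)
          = norm ((lam (Suc k) \<omega> - lam k \<omega>) *\<^sub>R Sig k \<omega> + lam (Suc k) \<omega> *\<^sub>R (Sig (Suc k) \<omega> - Sig k \<omega>))"
        by (simp add: cov_def dist_norm norm_minus_commute algebra_simps)
      also have "\<dots> \<le> \<bar>lam (Suc k) \<omega> - lam k \<omega>\<bar> * norm (Sig k \<omega>)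
          + lam (Suc k) \<omega> * norm (Sig (Suc k) \<omega> - Sig k \<omega>)"
        using norm_triangle_ineq [of "(lam (Suc k) \<omega> - lam k \<omega>) *\<^sub>R Sig k \<omega>"
            "lam (Suc k) \<omega> *\<^sub>R (Sig (Suc k) \<omega> - Sig k \<omega>)"] l'(1)
        by (simp only: norm_scaleR abs_of_nonneg)
      \<comment> \<open>The new scale is replaced by its upper bound before the trace inequality is
        inserted: the norm is nonnegative, whereas the trace increment may be negative.\<close>
      also have "\<dots> \<le> (exp (gam (Suc k)) - 1) / \<delta>lam * (?d^3 * \<mu>2)
          + (1 / \<delta>lam) * norm (Sig (Suc k) \<omega> - Sig k \<omega>)"
        using lam good_norm_Sig(1) [OF g [of k]] l' delta_lam order_trans [OF abs_ge_zero lam]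
        by (intro add_mono mult_mono) auto
      also have "\<dots> \<le> (exp (gam (Suc k)) - 1) / \<delta>lam * (?d^3 * \<mu>2)
          + (1 / \<delta>lam) * (?d\<^sup>2 * (trace (Sig (Suc k) \<omega>) - trace (Sig k \<omega>)) + 2 * ?d^3 * \<mu>2 / real (Suc k))"
        using delta_lam by (intro add_left_mono mult_left_mono Sig) simp
      also have "\<dots> = T (Suc k) - T k + w k"
        by (simp add: T_def w_def algebra_simps diff_divide_distrib add_divide_distrib)
      finally show ?thesis .
    qed
    have T: "\<bar>T k\<bar> \<le> (1 / \<delta>lam) * (?d\<^sup>2 * (?d * \<mu>2))" for k
    proof -
      have "0 \<le> T k"
        using good_norm_Sig(2) [OF g [of k]] delta_lam by (simp add: T_def)
      moreover have "T k \<le> (1 / \<delta>lam) * (?d\<^sup>2 * (?d * \<mu>2))"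
        unfolding T_def using good_norm_Sig(3) [OF g [of k]] delta_lam by (intro mult_left_mono) auto
      ultimately show ?thesis
        by simp
    qed
    have "w \<longlonglongrightarrow> (exp 0 - 1) / \<delta>lam * (?d^3 * \<mu>2) + 0"
      unfolding w_def
      by (intro tendsto_intros gain_tendsto_0 LIMSEQ_Suc [OF lim_const_over_n]) (use delta_lam in auto)
    then have w: "w \<longlonglongrightarrow> 0"
      by simp
    have "(\<lambda>n. (\<Sum>k<n. dist (cov k \<omega>) (cov (Suc k) \<omega>)) / real n) \<longlonglongrightarrow> 0"
      by (rule cesaro_null_of_drift [OF zero_le_dist inc T w])
    then show ?case
      using elim(1) by simp
  qed
qed

lemma strong_law:
  assumes density: "is_density target" and bounded: "bounded (range target)"
    and support: "bounded {x. target x \<noteq> 0}"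
    and f: "f \<in> borel_measurable borel" and f_bounded: "bounded (range f)"
  shows "AE \<omega> in M. (\<lambda>n. (\<Sum>k<n. f (theta k \<omega>)) / real n) \<longlonglongrightarrow> (\<integral>x. f x * target x \<partial>lborel)"
proof -
  obtain B where B: "\<And>x. target x \<le> B"
    using bounded unfolding bounded_iff by (auto dest: abs_le_D1)
  obtain R where R: "\<And>x. target x \<noteq> 0 \<Longrightarrow> norm x \<le> R"
    using support unfolding bounded_iff by auto
  obtain c where c: "\<And>x. \<bar>f x\<bar> \<le> c"
    using f_bounded unfolding bounded_iff by auto
  obtain q0 where "metropolis_family target gauss (cov_set (\<delta>lam * \<mu>1) rmax) B R q0"
    using gauss_metropolis_family [OF density B R cov_bound_pos] by metis
  then interpret mf: metropolis_family target gauss "cov_set (\<delta>lam * \<mu>1) rmax" B R q0 .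
  have "AE \<omega> in M. target (theta 0 \<omega>) \<noteq> 0"
    using init by eventually_elim (use theta0_pos in simp)
  then interpret am: adaptive_metropolis target gauss "cov_set (\<delta>lam * \<mu>1) rmax" B R q0 M F
    theta theta_star U cov'
    by unfold_locales (rule subalgebra_F adapted(1) cov'_adapted cov'_mem joint_draws metropolis
        measurable_from_subalg [OF subalgebra_F adapted_draws(1)]
        measurable_from_subalg [OF subalgebra_F adapted_draws(2)] | assumption)+
  show ?thesis
    by (rule am.law_of_large_numbers [OF f c cov_drift]) (use density in \<open>simp add: is_density_def\<close>)
qed

end

theorem theorem1:
  fixes M :: "'w measure" and F :: "nat \<Rightarrow> 'w measure"
    and target :: "real^'d \<Rightarrow> real"
    and A Q :: "nat \<Rightarrow> real^'n^'n" and H :: "nat \<Rightarrow> real^'n^'d"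
    and \<mu>1 \<mu>2 \<delta>lam target_acc :: real and gam :: "nat \<Rightarrow> real" and adapt_scale :: bool
    and theta0 :: "real^'d" and Sig0 :: "real^'d^'d"
    and m0 :: "real^'n" and P0 :: "real^'n^'n" and lam0 :: real
    and nu :: "nat \<Rightarrow> real"
    and theta_star :: "nat \<Rightarrow> 'w \<Rightarrow> real^'d" and U :: "nat \<Rightarrow> 'w \<Rightarrow> real"
    and theta :: "nat \<Rightarrow> 'w \<Rightarrow> real^'d" and Sig :: "nat \<Rightarrow> 'w \<Rightarrow> real^'d^'d"
    and m :: "nat \<Rightarrow> 'w \<Rightarrow> real^'n" and P :: "nat \<Rightarrow> 'w \<Rightarrow> real^'n^'n"
    and lam :: "nat \<Rightarrow> 'w \<Rightarrow> real"
    and f :: "real^'d \<Rightarrow> real"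
  assumes vbam: "vbam M F target A Q H \<mu>1 \<mu>2 \<delta>lam target_acc gam adapt_scale
      theta0 Sig0 m0 P0 lam0 nu theta_star U theta Sig m P lam"
    and density: "is_density target"
    and bounded_target: "bounded (range target)"
    and bounded_support: "bounded (closure {x. target x \<noteq> 0})"
    and observable: "\<And>S :: nat \<Rightarrow> real^'d^'d.
      (\<And>k. k \<ge> 1 \<Longrightarrow> loewner_le (\<mu>1 *\<^sub>R mat 1) (S k) \<and> loewner_le (S k) (\<mu>2 *\<^sub>R mat 1)) \<Longrightarrow>
      uniformly_completely_observable A H S"
    and controllable: "uniformly_completely_controllable A Q"
    and gain_summable: "summable (\<lambda>k. gam (Suc k) / real (Suc k))"
    and f_measurable: "f \<in> borel_measurable borel"
    and f_bounded: "bounded (range f)"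
  shows "AE \<omega> in M. (\<lambda>n. (1 / real n) * (\<Sum>k = 1..n. f (theta k \<omega>)))
      \<longlonglongrightarrow> (\<integral>x. f x * target x \<partial>lborel)"
proof -
  interpret vbam M F target A Q H \<mu>1 \<mu>2 \<delta>lam target_acc gam adapt_scale
      theta0 Sig0 m0 P0 lam0 nu theta_star U theta Sig m P lam
    by (rule vbam)
  obtain c where c: "\<And>x. \<bar>f x\<bar> \<le> c"
    using f_bounded unfolding bounded_iff by auto
  have "AE \<omega> in M. (\<lambda>n. (\<Sum>k<n. f (theta k \<omega>)) / real n) \<longlonglongrightarrow> (\<integral>x. f x * target x \<partial>lborel)"
    using bounded_support closure_subset
    by (intro strong_law density bounded_target f_measurable f_bounded) (rule bounded_subset)
  then show ?thesis
  proof eventually_elim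
    case (elim \<omega>)
    \<comment> \<open>Passing from the indices below n to those from 1 to n exchanges one boundary
      term for another, which a bounded \<open>f\<close> makes negligible.\<close>
    have "(\<lambda>n. (f (theta n \<omega>) - f (theta 0 \<omega>)) / real n) \<longlonglongrightarrow> 0"
    proof (rule Lim_null_comparison [OF always_eventually lim_const_over_n [of "2 * c"]], rule allI)
      fix n
      have "\<bar>f (theta n \<omega>) - f (theta 0 \<omega>)\<bar> \<le> 2 * c"
        using c [of "theta n \<omega>"] c [of "theta 0 \<omega>"] by linarith
      then show "norm ((f (theta n \<omega>) - f (theta 0 \<omega>)) / real n) \<le> 2 * c / real n"
        by (simp add: divide_right_mono)
    qed
    from tendsto_add [OF elim this]
    have "(\<lambda>n. (\<Sum>k<n. f (theta k \<omega>)) / real n + (f (theta n \<omega>) - f (theta 0 \<omega>)) / real n)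
        \<longlonglongrightarrow> (\<integral>x. f x * target x \<partial>lborel)"
      by simp
    moreover have "(1 / real n) * (\<Sum>k = 1..n. f (theta k \<omega>))
        = (\<Sum>k<n. f (theta k \<omega>)) / real n + (f (theta n \<omega>) - f (theta 0 \<omega>)) / real n" for n
    proof -
      have "(\<Sum>k = 1..n. f (theta k \<omega>)) = (\<Sum>k<n. f (theta (Suc k) \<omega>))"
        by (simp add: sum.atLeast1_atMost_eq)
      also have "\<dots> = (\<Sum>k<n. f (theta k \<omega>)) + (f (theta n \<omega>) - f (theta 0 \<omega>))"
        using sum_lessThan_telescope [of "\<lambda>k. f (theta k \<omega>)" n] by (simp add: sum_subtractf)
      finally show ?thesis
        by (simp add: add_divide_distrib)
    qed
    ultimately show ?case
      by simp
  qed
qed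

end
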